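(* Let $\mathbb{M}^d$ be a $d$-dimensional compact two-point homogeneous space which is not a sphere. Let $f,g:[-1,1]\to\mathbb{R}$ be continuous functions, neither identically zero, which are the isotropic parts of positive definite kernels on $\mathbb{M}^d$. The following assertions are equivalent: (i) $fg$ is the isotropic part of a strictly positive definite kernel on $\mathbb{M}^d$; (ii) at least one of $f$ and $g$ is the isotropic part of a strictly positive definite kernel on $\mathbb{M}^d$; (iii) at least one of $f$ and $g$ is not a polynomial.
   Context: By Wang's classification, a $d$-dimensional compact two-point homogeneous space $\mathbb{M}^d$ which is not a sphere is one of: the real projective spaces $\mathbb{P}^d(\mathbb{R})$, $d=2,3,\dots$; the complex projective spaces $\mathbb{P}^d(\mathbb{C})$, $d=4,6,\dots$; the quaternionic projective spaces $\mathbb{P}^d(\mathbb{H})$, $d=8,12,\dots$; the Cayley projective plane $\mathbb{P}^{16}(\mathrm{Cay})$ ($d$ is the real dimension). Each carries its usual Riemannian (geodesic) distance $|xy|$, normalized so that the largest distance equals $2\pi$. A continuous function $f:[-1,1]\to\mathbb{R}$ is called the isotropic part of the kernel $K(x,y)=f(\cos(|xy|/2))$, $x,y\in\mathbb{M}^d$. The kernel $K$ is positive definite if $\sum_{i,j=1}^n c_ic_jK(x_i,x_j)\ge 0$ for all $n\ge1$, all distinct $x_1,\dots,x_n\in\mathbb{M}^d$ and all real $c_1,\dots,c_n$; it is strictly positive definite if in addition the inequality is strict whenever $c_1,\dots,c_n$ are not all zero. *)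

theory Defs
  imports "HOL-Analysis.Analysis" "HOL-Computational_Algebra.Polynomial"
begin

section \<open>Positive definite isotropic kernels\<close>

text \<open>Finite families of pairwise distinct points are represented by finite sets.\<close>

definition pos_def_on :: "'a set \<Rightarrow> ('a \<Rightarrow> 'a \<Rightarrow> real) \<Rightarrow> bool" where
  "pos_def_on M K \<longleftrightarrow>
     (\<forall>S c. finite S \<and> S \<noteq> {} \<and> S \<subseteq> M \<longrightarrow> (\<Sum>x\<in>S. \<Sum>y\<in>S. c x * c y * K x y) \<ge> 0)"

definition strictly_pos_def_on :: "'a set \<Rightarrow> ('a \<Rightarrow> 'a \<Rightarrow> real) \<Rightarrow> bool" where
  "strictly_pos_def_on M K \<longleftrightarrow> pos_def_on M K \<and>
     (\<forall>S c. finite S \<and> S \<noteq> {} \<and> S \<subseteq> M \<and> (\<exists>x\<in>S. c x \<noteq> 0) \<longrightarrow>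
        (\<Sum>x\<in>S. \<Sum>y\<in>S. c x * c y * K x y) > 0)"

text \<open>A function on $[-1,1]$ is a total function whose values outside \<open>{-1..1}\<close> are irrelevant.\<close>

definition isotropic_kernel :: "('a \<Rightarrow> 'a \<Rightarrow> real) \<Rightarrow> (real \<Rightarrow> real) \<Rightarrow> 'a \<Rightarrow> 'a \<Rightarrow> real" where
  "isotropic_kernel \<delta> f = (\<lambda>x y. f (cos (\<delta> x y / 2)))"

definition isotropic_part_pd :: "'a set \<Rightarrow> ('a \<Rightarrow> 'a \<Rightarrow> real) \<Rightarrow> (real \<Rightarrow> real) \<Rightarrow> bool" where
  "isotropic_part_pd M \<delta> f \<longleftrightarrow>
     continuous_on {-1..1} f \<and> pos_def_on M (isotropic_kernel \<delta> f)"

definition isotropic_part_spd :: "'a set \<Rightarrow> ('a \<Rightarrow> 'a \<Rightarrow> real) \<Rightarrow> (real \<Rightarrow> real) \<Rightarrow> bool" where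
  "isotropic_part_spd M \<delta> f \<longleftrightarrow>
     continuous_on {-1..1} f \<and> strictly_pos_def_on M (isotropic_kernel \<delta> f)"

definition polynomial_on_interval :: "(real \<Rightarrow> real) \<Rightarrow> bool" where
  "polynomial_on_interval f \<longleftrightarrow> (\<exists>p :: real poly. \<forall>t\<in>{-1..1}. f t = poly p t)"


section \<open>Quaternions and octonions\<close>

text \<open>The pair \<open>(a, b)\<close> stands for $a + b j$, with $j c = \bar c\, j$ for complex $c$.\<close>

type_synonym quat = "complex \<times> complex"

definition quat_mult :: "quat \<Rightarrow> quat \<Rightarrow> quat" where
  "quat_mult x y = (fst x * fst y - snd x * cnj (snd y), fst x * snd y + snd x * cnj (fst y))"

definition quat_cnj :: "quat \<Rightarrow> quat" where
  "quat_cnj x = (cnj (fst x), - snd x)"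

text \<open>Octonions are the Cayley--Dickson double of the quaternions. Addition, real scaling and the
  Euclidean norm are those of the product type.\<close>

type_synonym oct = "quat \<times> quat"

definition oct_mult :: "oct \<Rightarrow> oct \<Rightarrow> oct" where
  "oct_mult x y =
     (quat_mult (fst x) (fst y) - quat_mult (quat_cnj (snd y)) (snd x),
      quat_mult (snd y) (fst x) + quat_mult (snd x) (quat_cnj (fst y)))"

definition oct_cnj :: "oct \<Rightarrow> oct" where
  "oct_cnj x = (quat_cnj (fst x), - snd x)"

definition oct_one :: oct where
  "oct_one = ((1, 0), (0, 0))"

definition oct_Re :: "oct \<Rightarrow> real" where
  "oct_Re x = Re (fst (fst x))"

lemma norm_quat_sq: "(norm (x :: quat))\<^sup>2 =
    (Re (fst x))\<^sup>2 + (Im (fst x))\<^sup>2 + (Re (snd x))\<^sup>2 + (Im (snd x))\<^sup>2"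
  by (simp add: norm_prod_def cmod_power2)

lemma norm_oct_sq: "(norm (x :: oct))\<^sup>2 = (norm (fst x))\<^sup>2 + (norm (snd x))\<^sup>2"
  by (simp add: norm_prod_def)

lemma quat_mult_assoc: "quat_mult (quat_mult x y) z = quat_mult x (quat_mult y z)"
  by (simp add: quat_mult_def algebra_simps)

lemma quat_cnj_mult: "quat_cnj (quat_mult x y) = quat_mult (quat_cnj y) (quat_cnj x)"
  by (simp add: quat_mult_def quat_cnj_def)

lemma norm_quat_cnj: "norm (quat_cnj x) = norm x"
  by (simp add: norm_prod_def quat_cnj_def)

lemma norm_quat_mult: "norm (quat_mult x y) = norm x * norm y"
proof -
  have "(norm (quat_mult x y))\<^sup>2 = (norm x * norm y)\<^sup>2"
    unfolding power_mult_distrib norm_quat_sq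
    by (simp add: quat_mult_def power2_eq_square algebra_simps)
  then show ?thesis
    by (metis mult_nonneg_nonneg norm_ge_zero power2_eq_imp_eq)
qed

lemma norm_oct_mult: "norm (oct_mult x y) = norm x * norm y"
proof -
  have "(norm (oct_mult x y))\<^sup>2 = (norm x * norm y)\<^sup>2"
    unfolding power_mult_distrib norm_oct_sq norm_quat_sq
    by (simp add: oct_mult_def quat_mult_def quat_cnj_def) algebra
  then show ?thesis
    by (metis mult_nonneg_nonneg norm_ge_zero power2_eq_imp_eq)
qed

lemma oct_mult_one: "oct_mult oct_one x = x" "oct_mult x oct_one = x"
  by (simp_all add: oct_mult_def oct_one_def quat_mult_def quat_cnj_def prod_eq_iff zero_prod_def)

lemma oct_mult_cnj: "oct_mult x (oct_cnj x) = (norm x)\<^sup>2 *\<^sub>R oct_one"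
  unfolding norm_oct_sq norm_quat_sq
  by (simp add: oct_mult_def oct_cnj_def oct_one_def quat_mult_def quat_cnj_def prod_eq_iff
      complex_eq_iff power2_eq_square algebra_simps)


section \<open>Projective spaces over the reals, complex numbers and quaternions\<close>

text \<open>The scalars form a type \<open>'k\<close> with multiplication \<open>m\<close> and conjugation \<open>s\<close>. The coordinates of
  a vector of $k^{n+1}$ are indexed by \<open>{..n}\<close>; beyond \<open>n\<close> they are zero. Scalars act on the right,
  which matters for the quaternions only.\<close>

definition nonzero_vectors :: "nat \<Rightarrow> (nat \<Rightarrow> 'k::real_normed_vector) set" where
  "nonzero_vectors n = {x. (\<forall>i>n. x i = 0) \<and> (\<exists>i\<le>n. x i \<noteq> 0)}"

definition line :: "('k \<Rightarrow> 'k \<Rightarrow> 'k) \<Rightarrow> (nat \<Rightarrow> 'k) \<Rightarrow> (nat \<Rightarrow> 'k) set" where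
  "line m x = range (\<lambda>a i. m (x i) a)"

definition proj_space :: "('k::real_normed_vector \<Rightarrow> 'k \<Rightarrow> 'k) \<Rightarrow> nat \<Rightarrow> (nat \<Rightarrow> 'k) set set" where
  "proj_space m n = line m ` nonzero_vectors n"

definition herm :: "('k::real_normed_vector \<Rightarrow> 'k \<Rightarrow> 'k) \<Rightarrow> ('k \<Rightarrow> 'k) \<Rightarrow> nat \<Rightarrow>
    (nat \<Rightarrow> 'k) \<Rightarrow> (nat \<Rightarrow> 'k) \<Rightarrow> 'k" where
  "herm m s n x y = (\<Sum>i\<le>n. m (s (x i)) (y i))"

definition vec_norm :: "nat \<Rightarrow> (nat \<Rightarrow> 'k::real_normed_vector) \<Rightarrow> real" where
  "vec_norm n x = sqrt (\<Sum>i\<le>n. (norm (x i))\<^sup>2)"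

text \<open>The Fubini--Study geodesic distance. The Riemannian quotient of the unit sphere by the unit
  scalars has geodesic distance \<open>arccos \<bar>\<langle>x, y\<rangle>\<bar>\<close> for unit vectors \<open>x\<close>, \<open>y\<close>, hence diameter $\pi/2$
  (attained by orthogonal lines); the factor 4 makes the diameter $2\pi$.\<close>

definition fs_dist :: "('k::real_normed_vector \<Rightarrow> 'k \<Rightarrow> 'k) \<Rightarrow> ('k \<Rightarrow> 'k) \<Rightarrow> nat \<Rightarrow>
    (nat \<Rightarrow> 'k) \<Rightarrow> (nat \<Rightarrow> 'k) \<Rightarrow> real" where
  "fs_dist m s n x y = 4 * arccos (norm (herm m s n x y) / (vec_norm n x * vec_norm n y))"

text \<open>Distance of two lines, by choice of representatives; independence of the choice is
  \<open>real_proj_dist_line\<close>, \<open>complex_proj_dist_line\<close>, \<open>quat_proj_dist_line\<close> below.\<close>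

definition proj_dist :: "('k::real_normed_vector \<Rightarrow> 'k \<Rightarrow> 'k) \<Rightarrow> ('k \<Rightarrow> 'k) \<Rightarrow> nat \<Rightarrow>
    (nat \<Rightarrow> 'k) set \<Rightarrow> (nat \<Rightarrow> 'k) set \<Rightarrow> real" where
  "proj_dist m s n L L' =
     fs_dist m s n (SOME x. x \<in> L \<inter> nonzero_vectors n) (SOME y. y \<in> L' \<inter> nonzero_vectors n)"

lemma proj_dist_line_aux:
  fixes m :: "'k::real_normed_vector \<Rightarrow> 'k \<Rightarrow> 'k"
  assumes assoc: "\<And>a b c. m (m a b) c = m a (m b c)"
    and nm: "\<And>a b. norm (m a b) = norm a * norm b"
    and sm: "\<And>a b. s (m a b) = m (s b) (s a)"
    and ns: "\<And>a. norm (s a) = norm a"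
    and addl: "\<And>a b c. m (a + b) c = m a c + m b c"
    and addr: "\<And>a b c. m a (b + c) = m a b + m a c"
    and one: "\<And>a. m a e = a"
    and x: "x \<in> nonzero_vectors n" and y: "y \<in> nonzero_vectors n"
  shows "proj_dist m s n (line m x) (line m y) = fs_dist m s n x y"
proof -
  have self: "\<exists>z. z \<in> line m v \<inter> nonzero_vectors n" if "v \<in> nonzero_vectors n" for v
  proof
    have "v = (\<lambda>i. m (v i) e)" by (simp add: one)
    then show "v \<in> line m v \<inter> nonzero_vectors n" using that by (auto simp: line_def)
  qed
  define x' where "x' = (SOME z. z \<in> line m x \<inter> nonzero_vectors n)"
  define y' where "y' = (SOME z. z \<in> line m y \<inter> nonzero_vectors n)"
  have x': "x' \<in> line m x \<inter> nonzero_vectors n"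
    unfolding x'_def by (rule someI_ex[OF self[OF x]])
  have y': "y' \<in> line m y \<inter> nonzero_vectors n"
    unfolding y'_def by (rule someI_ex[OF self[OF y]])
  obtain a where a: "x' = (\<lambda>i. m (x i) a)" using x' by (auto simp: line_def)
  obtain b where b: "y' = (\<lambda>i. m (y i) b)" using y' by (auto simp: line_def)
  have a0: "norm a \<noteq> 0"
  proof
    assume "norm a = 0"
    then have "norm (x' i) = 0" for i unfolding a nm by simp
    then show False using x' by (auto simp: nonzero_vectors_def)
  qed
  have b0: "norm b \<noteq> 0"
  proof
    assume "norm b = 0"
    then have "norm (y' i) = 0" for i unfolding b nm by simp
    then show False using y' by (auto simp: nonzero_vectors_def)
  qed
  have z1: "m 0 c = 0" "m c 0 = 0" for c
    using addl[of 0 0 c] addr[of c 0 0] by simp_all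
  have suml: "m (sum h A) c = (\<Sum>i\<in>A. m (h i) c)" for h c and A :: "nat set"
    by (induction A rule: infinite_finite_induct) (simp_all add: z1 addl)
  have sumr: "m c (sum h A) = (\<Sum>i\<in>A. m c (h i))" for h c and A :: "nat set"
    by (induction A rule: infinite_finite_induct) (simp_all add: z1 addr)
  have "herm m s n x' y' = m (s a) (m (herm m s n x y) b)"
    unfolding herm_def a b sm assoc suml sumr ..
  then have h: "norm (herm m s n x' y') = norm a * norm b * norm (herm m s n x y)"
    by (simp add: nm ns)
  have vx: "vec_norm n x' = norm a * vec_norm n x"
    unfolding vec_norm_def a nm power_mult_distrib sum_distrib_right[symmetric]
    by (simp add: real_sqrt_mult)
  have vy: "vec_norm n y' = norm b * vec_norm n y"
    unfolding vec_norm_def b nm power_mult_distrib sum_distrib_right[symmetric]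
    by (simp add: real_sqrt_mult)
  have "norm (herm m s n x' y') / (vec_norm n x' * vec_norm n y') =
      norm (herm m s n x y) / (vec_norm n x * vec_norm n y)"
    unfolding h vx vy using a0 b0 by (simp add: field_simps)
  then show ?thesis
    unfolding proj_dist_def x'_def[symmetric] y'_def[symmetric] fs_dist_def by simp
qed

abbreviation real_proj_space :: "nat \<Rightarrow> (nat \<Rightarrow> real) set set" where
  "real_proj_space \<equiv> proj_space (*)"

abbreviation real_proj_dist :: "nat \<Rightarrow> (nat \<Rightarrow> real) set \<Rightarrow> (nat \<Rightarrow> real) set \<Rightarrow> real" where
  "real_proj_dist \<equiv> proj_dist (*) (\<lambda>a. a)"

abbreviation complex_proj_space :: "nat \<Rightarrow> (nat \<Rightarrow> complex) set set" where
  "complex_proj_space \<equiv> proj_space (*)"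

abbreviation complex_proj_dist :: "nat \<Rightarrow> (nat \<Rightarrow> complex) set \<Rightarrow> (nat \<Rightarrow> complex) set \<Rightarrow> real" where
  "complex_proj_dist \<equiv> proj_dist (*) cnj"

abbreviation quat_proj_space :: "nat \<Rightarrow> (nat \<Rightarrow> quat) set set" where
  "quat_proj_space \<equiv> proj_space quat_mult"

abbreviation quat_proj_dist :: "nat \<Rightarrow> (nat \<Rightarrow> quat) set \<Rightarrow> (nat \<Rightarrow> quat) set \<Rightarrow> real" where
  "quat_proj_dist \<equiv> proj_dist quat_mult quat_cnj"

lemma real_proj_dist_line:
  assumes "x \<in> nonzero_vectors n" "y \<in> nonzero_vectors n"
  shows "real_proj_dist n (line (*) x) (line (*) y) = fs_dist (*) (\<lambda>a. a) n x y"
  by (rule proj_dist_line_aux[where e = 1]) (use assms in \<open>auto simp: algebra_simps abs_mult\<close>)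

lemma complex_proj_dist_line:
  assumes "x \<in> nonzero_vectors n" "y \<in> nonzero_vectors n"
  shows "complex_proj_dist n (line (*) x) (line (*) y) = fs_dist (*) cnj n x y"
  by (rule proj_dist_line_aux[where e = 1]) (use assms in \<open>auto simp: algebra_simps norm_mult\<close>)

lemma quat_proj_dist_line:
  assumes "x \<in> nonzero_vectors n" "y \<in> nonzero_vectors n"
  shows "quat_proj_dist n (line quat_mult x) (line quat_mult y) = fs_dist quat_mult quat_cnj n x y"
proof (rule proj_dist_line_aux[where e = "(1, 0)"])
  show "quat_mult (a + b) c = quat_mult a c + quat_mult b c" for a b c
    by (simp add: quat_mult_def algebra_simps)
  show "quat_mult a (b + c) = quat_mult a b + quat_mult a c" for a b c
    by (simp add: quat_mult_def algebra_simps)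
  show "quat_mult a (1, 0) = a" for a
    by (simp add: quat_mult_def)
qed (use assms in \<open>simp_all add: quat_mult_assoc norm_quat_mult quat_cnj_mult norm_quat_cnj\<close>)


section \<open>The Cayley projective plane\<close>

text \<open>The points are the primitive (trace-one) idempotents of the Albert algebra of Hermitian
  \<open>3 \<times> 3\<close> octonionic matrices with the Jordan product. Here \<open>tr (p \<circ> q)\<close> is $\cos^2\theta$ for
  the unnormalized geodesic distance $\theta\in[0,\pi/2]$, as for the rank-one projections
  $p = x x^*$, $q = y y^*$ in the associative case, where it equals $|\langle x,y\rangle|^2$.\<close>

definition oct_matrix_mult :: "oct^3^3 \<Rightarrow> oct^3^3 \<Rightarrow> oct^3^3" where
  "oct_matrix_mult p q = (\<chi> i j. \<Sum>k\<in>UNIV. oct_mult (p $ i $ k) (q $ k $ j))"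

definition jordan_mult :: "oct^3^3 \<Rightarrow> oct^3^3 \<Rightarrow> oct^3^3" where
  "jordan_mult p q = (1/2) *\<^sub>R (oct_matrix_mult p q + oct_matrix_mult q p)"

definition oct_trace :: "oct^3^3 \<Rightarrow> oct" where
  "oct_trace p = (\<Sum>i\<in>UNIV. p $ i $ i)"

definition albert_algebra :: "(oct^3^3) set" where
  "albert_algebra = {p. \<forall>i j. p $ i $ j = oct_cnj (p $ j $ i)}"

definition cayley_plane :: "(oct^3^3) set" where
  "cayley_plane = {p \<in> albert_algebra. jordan_mult p p = p \<and> oct_trace p = oct_one}"

text \<open>\<open>oct_Re\<close> only serves to read the trace, which is a real octonion here, as a real number.\<close>

definition cayley_dist :: "oct^3^3 \<Rightarrow> oct^3^3 \<Rightarrow> real" where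
  "cayley_dist p q = 4 * arccos (sqrt (oct_Re (oct_trace (jordan_mult p q))))"


section \<open>Compact two-point homogeneous spaces other than spheres\<close>

definition isometric_spaces ::
    "'a set \<Rightarrow> ('a \<Rightarrow> 'a \<Rightarrow> real) \<Rightarrow> 'b set \<Rightarrow> ('b \<Rightarrow> 'b \<Rightarrow> real) \<Rightarrow> bool" where
  "isometric_spaces M \<delta> N \<rho> \<longleftrightarrow>
     (\<exists>h. bij_betw h M N \<and> (\<forall>x\<in>M. \<forall>y\<in>M. \<rho> (h x) (h y) = \<delta> x y))"

text \<open>Wang's list. The parameter \<open>d\<close> is the real dimension, so the number of homogeneous
  coordinates is \<open>d + 1\<close>, \<open>d div 2 + 1\<close>, \<open>d div 4 + 1\<close> over the three associative division algebras.
  The projective lines, being spheres, are excluded.\<close>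

definition nonspherical_two_point_homogeneous ::
    "nat \<Rightarrow> 'a set \<Rightarrow> ('a \<Rightarrow> 'a \<Rightarrow> real) \<Rightarrow> bool" where
  "nonspherical_two_point_homogeneous d M \<delta> \<longleftrightarrow>
     (d \<ge> 2 \<and> isometric_spaces M \<delta> (real_proj_space d) (real_proj_dist d)) \<or>
     (\<exists>n\<ge>2. d = 2 * n \<and> isometric_spaces M \<delta> (complex_proj_space n) (complex_proj_dist n)) \<or>
     (\<exists>n\<ge>2. d = 4 * n \<and> isometric_spaces M \<delta> (quat_proj_space n) (quat_proj_dist n)) \<or>
     (d = 16 \<and> isometric_spaces M \<delta> cayley_plane cayley_dist)"

end

theory Submission imports Defs begin

text \<open>
  In terms of \<open>u x y = (1 + cos (\<delta> x y / 2)) / 2\<close>, the squared cosine of the angle between two lines (or the trace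
  form of two primitive idempotents), the kernel is \<open>F (u x y)\<close> with \<open>F s = f (2 s - 1)\<close>, and \<open>u\<close> has a finite
  feature expansion. If \<open>F\<close> is positive but not strictly positive definite, the Cauchy--Schwarz
  inequality turns a vanishing quadratic form into \<open>\<Sum> c\<^sub>i F (u x\<^sub>i R) = 0\<close> for all \<open>R\<close>. Convolving with the
  concentrating kernels \<open>u\<^sup>N\<close> and using two-point homogeneity, one sees that \<open>F\<close> is a limit of polynomials
  satisfying the same relation. Restricted to a geodesic circle through \<open>x\<^sub>1\<close> that misses the other \<open>x\<^sub>i\<close>, the top
  Fourier coefficient of the relation for a polynomial of degree \<open>k\<close> reads \<open>\<Sum> c\<^sub>i z\<^sub>i\<^sup>k = 0\<close> with
  \<open>\<bar>z\<^sub>1\<bar> > \<bar>z\<^sub>i\<bar>\<close>; hence the degrees are bounded and \<open>F\<close> is itself a polynomial. Such circles exist because the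
  spaces contain real projective planes, which is where spheres are excluded. Conversely a polynomial \<open>F\<close>
  gives a kernel of finite rank on an infinite set, and the Schur product of a strictly
  positive definite kernel with a nonzero isotropic positive definite one is strictly positive definite.
\<close>

section \<open>Positive definite kernels and sums of powers\<close>

text \<open>Neither an invariant measure nor an expansion in Jacobi polynomials is used. Positive
  definiteness of \<open>F\<close> enters both in Cauchy-Schwarz and in making the energy of
  \<open>(1 + F) u^N\<close> nonnegative, so that its minimizing means act as an invariant average.
  Averaging \<open>F (u P x) * u R x ^ N\<close> over \<open>x\<close> yields a function of
  \<open>u P R\<close> alone. It is a polynomial because points of the real plane enter
  \<open>u\<close> quadratically, and the relation survives because it holds at every averaged
  point. A priori the degrees of these polynomials grow with \<open>N\<close>; the bound on them
  matters because a pointwise limit of polynomials of bounded degree is a polynomial. On a sphere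
  every great circle through a point also contains its antipode, so no circle isolates the point and
  the top coefficient may cancel: even kernels need be neither strict nor polynomial there. In a
  real projective plane two geodesic circles through a point meet nowhere else.\<close>

text \<open>The definition speaks of sets of distinct points, whereas Cauchy-Schwarz below adjoins a
  point that may already occur. Weights of indices with the same point are merged into
  \<open>C\<close>.\<close>

lemma pos_def_on_family:
  assumes "pos_def_on M K" "finite I" "p ` I \<subseteq> M"
  shows "(\<Sum>i\<in>I. \<Sum>j\<in>I. c i * c j * K (p i) (p j)) \<ge> 0"
proof (cases "I = {}")
  case False
  define C where "C x = (\<Sum>i\<in>{i\<in>I. p i = x}. c i)" for x
  have "(\<Sum>i\<in>I. \<Sum>j\<in>I. c i * c j * K (p i) (p j)) =
      (\<Sum>x\<in>p ` I. \<Sum>i\<in>{i\<in>I. p i = x}. \<Sum>y\<in>p ` I. \<Sum>j\<in>{j\<in>I. p j = y}. c i * c j * K (p i) (p j))"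
    by (subst sum.image_gen[OF assms(2), of _ p]) (intro sum.cong refl sum.image_gen assms(2))
  also have "\<dots> = (\<Sum>x\<in>p ` I. \<Sum>y\<in>p ` I. C x * C y * K x y)"
  proof (rule sum.cong[OF refl])
    fix x assume "x \<in> p ` I"
    have "(\<Sum>i\<in>{i\<in>I. p i = x}. \<Sum>y\<in>p ` I. \<Sum>j\<in>{j\<in>I. p j = y}. c i * c j * K (p i) (p j))
       = (\<Sum>i\<in>{i\<in>I. p i = x}. \<Sum>y\<in>p ` I. c i * C y * K x y)"
    proof (intro sum.cong refl)
      fix i y assume "i \<in> {i \<in> I. p i = x}"
      then have "p i = x" by simp
      then have "(\<Sum>j\<in>{j\<in>I. p j = y}. c i * c j * K (p i) (p j)) = (\<Sum>j\<in>{j\<in>I. p j = y}. c i * c j * K x y)"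
        by (intro sum.cong refl) simp
      then show "(\<Sum>j\<in>{j\<in>I. p j = y}. c i * c j * K (p i) (p j)) = c i * C y * K x y"
        by (simp add: C_def sum_distrib_left sum_distrib_right)
    qed
    also have "\<dots> = (\<Sum>y\<in>p ` I. \<Sum>i\<in>{i\<in>I. p i = x}. c i * C y * K x y)"
      by (rule sum.swap)
    also have "\<dots> = (\<Sum>y\<in>p ` I. C x * C y * K x y)"
      by (simp add: C_def[of x] sum_distrib_right)
    finally show "(\<Sum>i\<in>{i\<in>I. p i = x}. \<Sum>y\<in>p ` I. \<Sum>j\<in>{j\<in>I. p j = y}. c i * c j * K (p i) (p j))
       = (\<Sum>y\<in>p ` I. C x * C y * K x y)" .
  qed
  also have "\<dots> \<ge> 0"
    using assms False by (intro assms(1)[unfolded pos_def_on_def, rule_format]) auto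
  finally show ?thesis .
qed simp

section \<open>Polynomials: discriminants, top coefficients, pointwise limits\<close>

lemma quadratic_nonneg_discriminant:
  fixes a b c :: real
  assumes "\<And>t. a + 2 * t * b + t\<^sup>2 * c \<ge> 0"
  and "c \<ge> 0"
  shows "b\<^sup>2 \<le> a * c"
proof (cases "c = 0")
  case True
  show ?thesis
  proof (cases "b = 0")
    case False
    have "a + 2 * (- (a + 1) / (2 * b)) * b \<ge> 0" using assms(1)[of "- (a + 1) / (2 * b)"] True by simp
    moreover have "a + 2 * (- (a + 1) / (2 * b)) * b = -1" using False by (simp add: field_simps)
    ultimately show ?thesis by simp
  qed (use True in simp)
next
  case False
  then have c: "c > 0" using assms(2) by simp
  have "a + 2 * (- b / c) * b + (- b / c)\<^sup>2 * c \<ge> 0" by (rule assms(1))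
  moreover have "a + 2 * (- b / c) * b + (- b / c)\<^sup>2 * c = (a * c - b\<^sup>2) / c"
    using c by (simp add: field_simps power2_eq_square)
  ultimately show ?thesis using c by (simp add: zero_le_divide_iff)
qed

text \<open>Works with degree bounds instead of exact degrees because the quadratics
  \<open>[:cnj z, a, z:]\<close> met below may have leading coefficient zero.\<close>

lemma coeff_mult_degree_le:
  fixes p q :: "'a::comm_semiring_1 poly"
  assumes "degree p \<le> a" "degree q \<le> b"
  shows "coeff (p * q) (a + b) = coeff p a * coeff q b"
proof -
  have "coeff (p * q) (a + b) = (\<Sum>i\<le>a + b. coeff p i * coeff q (a + b - i))"
    by (rule coeff_mult)
  also have "\<dots> = (\<Sum>i\<in>{a}. coeff p i * coeff q (a + b - i))"
  proof (rule sum.mono_neutral_right)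
    show "\<forall>i\<in>{..a + b} - {a}. coeff p i * coeff q (a + b - i) = 0"
    proof
      fix i assume "i \<in> {..a + b} - {a}"
      then have "i > a \<or> a + b - i > b" by auto
      then show "coeff p i * coeff q (a + b - i) = 0"
        using assms by (auto simp: coeff_eq_0)
    qed
  qed auto
  finally show ?thesis by simp
qed

lemma coeff_power_degree_le:
  fixes p :: "'a::comm_semiring_1 poly"
  assumes "degree p \<le> a"
  shows "coeff (p ^ n) (a * n) = coeff p a ^ n"
proof (induction n)
  case (Suc n)
  have "degree (p ^ n) \<le> a * n"
    using degree_power_le[of p n] assms by (meson le_trans mult_le_mono1)
  then have "coeff (p * p ^ n) (a + a * n) = coeff p a * coeff (p ^ n) (a * n)"
    using assms by (rule coeff_mult_degree_le[rotated])
  then show ?case using Suc by simp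
qed simp

text \<open>Divided differences at a fixed \<open>x0\<close> lower the degree bound by one and keep
  pointwise convergence, so induction on \<open>N\<close> ends at constants.\<close>

lemma poly_limit:
  fixes q :: "nat \<Rightarrow> real poly" and h :: "real \<Rightarrow> real"
  assumes "infinite X" "\<And>n. degree (q n) \<le> N" "\<And>x. x \<in> X \<Longrightarrow> (\<lambda>n. poly (q n) x) \<longlonglongrightarrow> h x"
  shows "\<exists>p. \<forall>x\<in>X. h x = poly p x"
  using assms
proof (induction N arbitrary: q h X)
  case 0
  obtain x0 where x0: "x0 \<in> X" using 0(1) by fastforce
  have "h x = h x0" if "x \<in> X" for x
  proof -
    have "poly (q n) x = poly (q n) x0" for n
    proof -
      have "degree (q n) = 0" using 0(2)[of n] by simp
      then obtain a where "q n = [:a:]" by (rule degree_eq_zeroE)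
      then show ?thesis by simp
    qed
    then show ?thesis using LIMSEQ_unique[OF 0(3)[OF that]] 0(3)[OF x0] by simp
  qed
  then show ?case by (intro exI[of _ "[:h x0:]"]) simp
next
  case (Suc N)
  obtain x0 where x0: "x0 \<in> X" using Suc(2) by fastforce
  have "\<exists>p. \<forall>x\<in>X - {x0}. (h x - h x0) / (x - x0) = poly p x"
  proof (rule Suc.IH)
    show "infinite (X - {x0})" using Suc(2) by simp
    show "degree (synthetic_div (q n) x0) \<le> N" for n
      using Suc(3)[of n] by (simp add: degree_synthetic_div)
    fix x assume x: "x \<in> X - {x0}"
    have "poly (synthetic_div (q n) x0) x = (poly (q n) x - poly (q n) x0) / (x - x0)" for n
    proof -
      have "poly (q n) x = poly ([:-x0, 1:] * synthetic_div (q n) x0 + [:poly (q n) x0:]) x"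
        using synthetic_div_correct'[of x0 "q n"] by simp
      then show ?thesis using x by (simp add: field_simps)
    qed
    moreover have "(\<lambda>n. (poly (q n) x - poly (q n) x0) / (x - x0)) \<longlonglongrightarrow> (h x - h x0) / (x - x0)"
      using Suc(4)[of x] Suc(4)[OF x0] x by (intro tendsto_intros) auto
    ultimately show "(\<lambda>n. poly (synthetic_div (q n) x0) x) \<longlonglongrightarrow> (h x - h x0) / (x - x0)" by simp
  qed
  then obtain p where p: "\<And>x. x \<in> X \<Longrightarrow> x \<noteq> x0 \<Longrightarrow> (h x - h x0) / (x - x0) = poly p x" by auto
  have "h x = poly ([:-x0, 1:] * p + [:h x0:]) x" if "x \<in> X" for x
  proof (cases "x = x0")
    case False
    then show ?thesis using p[OF that False] by (simp add: field_simps)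
  qed simp
  then show ?case by blast
qed

text \<open>With \<open>w = cis \<phi>\<close>, the product of \<open>w\<close> and
  \<open>a + b * cos \<phi> + c * sin \<phi>\<close> is a quadratic in \<open>w\<close> with leading
  coefficient \<open>z\<close>. So \<open>w ^ k\<close> times the relation is a polynomial in
  \<open>w\<close> with infinitely many roots on the unit circle; the claim is its coefficient at
  \<open>w ^ (2 * k)\<close>, divided by the leading coefficient of \<open>j\<close>.\<close>

lemma trig_poly_top_coeff:
  fixes j :: "real poly" and a b c d :: "'i \<Rightarrow> real"
  assumes "\<And>\<phi>. (\<Sum>i\<in>S. d i * poly j (a i + b i * cos \<phi> + c i * sin \<phi>)) = 0"
    and "j \<noteq> 0" and "finite S"
  shows "(\<Sum>i\<in>S. of_real (d i) * (Complex (b i / 2) (- (c i / 2))) ^ degree j) = 0"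
proof -
  define k where "k = degree j"
  define z where "z i = Complex (b i / 2) (- (c i / 2))" for i
  define p where "p i = [:cnj (z i), of_real (a i), z i:]" for i
  \<comment> \<open>The factor \<open>monom 1 (k - l)\<close> pads the term of degree
    \<open>l\<close>, which carries only \<open>w ^ l\<close>, to the common factor
    \<open>w ^ k\<close>. Only \<open>l = k\<close> can reach degree \<open>2 * k\<close>.\<close>
  define Q where "Q = (\<Sum>i\<in>S. smult (of_real (d i))
     (\<Sum>l\<le>k. smult (of_real (coeff j l)) (p i ^ l * monom 1 (k - l))))"
  have "poly Q (cis \<phi>) = 0" for \<phi>
  proof -
    define w where "w = cis \<phi>"
    have w0: "w \<noteq> 0" by (simp add: w_def)
    have pw: "poly (p i) w = w * of_real (a i + b i * cos \<phi> + c i * sin \<phi>)" for i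
    proof -
      have "of_real (a i + b i * cos \<phi> + c i * sin \<phi>) = of_real (a i) + z i * w + cnj (z i) * cnj w"
        by (simp add: complex_eq_iff z_def w_def field_simps)
      moreover have "w * cnj w = 1" by (simp add: w_def cis_cnj cis_mult)
      ultimately show ?thesis by (simp add: p_def algebra_simps)
    qed
    have "poly Q w = (\<Sum>i\<in>S. of_real (d i) * (\<Sum>l\<le>k. of_real (coeff j l) * (poly (p i) w ^ l * w ^ (k - l))))"
      by (simp add: Q_def poly_sum poly_power poly_monom)
    also have "\<dots> = (\<Sum>i\<in>S. of_real (d i) * (w ^ k * of_real (poly j (a i + b i * cos \<phi> + c i * sin \<phi>))))"
    proof (rule sum.cong[OF refl])
      fix i assume "i \<in> S"
      let ?x = "a i + b i * cos \<phi> + c i * sin \<phi>"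
      have "(\<Sum>l\<le>k. of_real (coeff j l) * (poly (p i) w ^ l * w ^ (k - l)))
         = (\<Sum>l\<le>k. w ^ k * of_real (coeff j l * ?x ^ l))"
      proof (rule sum.cong[OF refl])
        fix l assume "l \<in> {..k}"
        then have "w ^ k = w ^ l * w ^ (k - l)" by (simp add: power_add[symmetric])
        then show "of_real (coeff j l) * (poly (p i) w ^ l * w ^ (k - l)) = w ^ k * of_real (coeff j l * ?x ^ l)"
          unfolding pw by (simp add: power_mult_distrib)
      qed
      also have "\<dots> = w ^ k * of_real (poly j ?x)"
        by (simp add: poly_altdef k_def sum_distrib_left)
      finally show "of_real (d i) * (\<Sum>l\<le>k. of_real (coeff j l) * (poly (p i) w ^ l * w ^ (k - l)))
        = of_real (d i) * (w ^ k * of_real (poly j ?x))" by simp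
    qed
    also have "\<dots> = w ^ k * of_real (\<Sum>i\<in>S. d i * poly j (a i + b i * cos \<phi> + c i * sin \<phi>))"
      by (simp add: sum_distrib_left mult_ac)
    also have "\<dots> = 0" by (simp only: assms(1)) simp
    finally show ?thesis by (simp add: w_def)
  qed
  then have sub: "cis ` {0<..<1} \<subseteq> {x. poly Q x = 0}" by auto
  have "inj_on cis {0<..<1}"
  proof (rule inj_onI)
    fix x y :: real assume "x \<in> {0<..<1}" "y \<in> {0<..<1}" "cis x = cis y"
    then have "cos x = cos y" "0 \<le> x" "x \<le> pi" "0 \<le> y" "y \<le> pi"
      using pi_ge_two by (auto simp: complex_eq_iff)
    then show "x = y" by (metis cos_inj_pi)
  qed
  then have "infinite (cis ` {0<..<1})" by (subst finite_image_iff) auto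
  then have "Q = 0" using sub poly_roots_finite[of Q] finite_subset by blast
  have dp: "degree (p i) \<le> 2" for i unfolding p_def by (simp add: degree_pCons_le)
  have top: "coeff (\<Sum>l\<le>k. smult (of_real (coeff j l)) (p i ^ l * monom 1 (k - l))) (2 * k)
     = of_real (coeff j k) * z i ^ k" for i
  proof -
    have "coeff (\<Sum>l\<le>k. smult (of_real (coeff j l)) (p i ^ l * monom 1 (k - l))) (2 * k)
       = (\<Sum>l\<le>k. of_real (coeff j l) * coeff (p i ^ l * monom 1 (k - l)) (2 * k))"
      by (simp add: coeff_sum)
    also have "\<dots> = (\<Sum>l\<in>{k}. of_real (coeff j l) * coeff (p i ^ l * monom 1 (k - l)) (2 * k))"
    proof (rule sum.mono_neutral_right)
      show "\<forall>l\<in>{..k} - {k}. of_real (coeff j l) * coeff (p i ^ l * monom 1 (k - l)) (2 * k) = 0"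
      proof
        fix l assume l: "l \<in> {..k} - {k}"
        have "degree (p i ^ l * monom 1 (k - l)) \<le> degree (p i ^ l) + degree (monom (1::complex) (k - l))"
          by (rule degree_mult_le)
        also have "\<dots> \<le> 2 * l + (k - l)"
          using degree_power_le[of "p i" l] dp[of i] by (intro add_mono) (auto simp: degree_monom_eq intro: le_trans mult_le_mono1)
        also have "\<dots> < 2 * k" using l by auto
        finally show "of_real (coeff j l) * coeff (p i ^ l * monom 1 (k - l)) (2 * k) = 0"
          by (simp add: coeff_eq_0)
      qed
    qed auto
    also have "\<dots> = of_real (coeff j k) * z i ^ k"
      using coeff_power_degree_le[OF dp[of i], of k] by (simp add: p_def numeral_2_eq_2)
    finally show ?thesis .
  qed
  have "0 = coeff Q (2 * k)" using \<open>Q = 0\<close> by simp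
  also have "\<dots> = (\<Sum>i\<in>S. of_real (d i) * (of_real (coeff j k) * z i ^ k))"
    by (simp add: Q_def coeff_sum[of _ S] top del: coeff_sum)
  also have "\<dots> = of_real (coeff j k) * (\<Sum>i\<in>S. of_real (d i) * z i ^ k)"
    by (simp add: sum_distrib_left mult_ac)
  finally show ?thesis using assms(2) by (simp add: k_def z_def)
qed

section \<open>Minimizing sequences, convergence from square bounds, dominant powers\<close>

text \<open>The explicit rate is the one that \<open>convergent_if_square_bound\<close> and
  \<open>tendsto_if_square_bound\<close> take as input.\<close>

lemma minimizing_sequence:
  fixes E :: "'b \<Rightarrow> real"
  assumes "X \<noteq> {}" "\<And>x. x \<in> X \<Longrightarrow> E x \<ge> 0"
  shows "\<exists>I L. (\<forall>n::nat. L n \<in> X \<and> E (L n) \<le> I + 1 / real (Suc n)) \<and> (\<forall>x\<in>X. I \<le> E x)"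
proof -
  have bdd: "bdd_below (E ` X)" using assms(2) by (auto intro!: bdd_belowI2)
  define I where "I = Inf (E ` X)"
  have "\<exists>x\<in>X. E x \<le> I + 1 / real (Suc n)" for n
  proof -
    have "Inf (E ` X) < I + 1 / real (Suc n)" by (simp add: I_def)
    then show ?thesis using cInf_lessD[of "E ` X" "I + 1 / real (Suc n)"] assms(1) by (auto intro: less_imp_le)
  qed
  then obtain L where "\<And>n. L n \<in> X \<and> E (L n) \<le> I + 1 / real (Suc n)" by metis
  moreover have "\<forall>x\<in>X. I \<le> E x" unfolding I_def using bdd by (auto intro: cInf_lower)
  ultimately show ?thesis by blast
qed

lemma tendsto_inverse_Suc_bound: "(\<lambda>n. C * (1 / real (Suc n))) \<longlonglongrightarrow> 0"
  using tendsto_mult_right[OF LIMSEQ_inverse_real_of_nat, of C] by (simp add: inverse_eq_divide)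

lemma convergent_if_square_bound:
  fixes a :: "nat \<Rightarrow> real"
  assumes "\<And>m n. (a m - a n)\<^sup>2 \<le> C * (1 / real (Suc m) + 1 / real (Suc n))" "C \<ge> 0"
  shows "convergent a"
proof -
  have "Cauchy a"
  proof (rule CauchyI)
    fix \<epsilon> :: real assume "\<epsilon> > 0"
    then have "\<forall>\<^sub>F n in sequentially. 2 * C * (1 / real (Suc n)) < \<epsilon>\<^sup>2"
      by (intro order_tendstoD(2)[OF tendsto_inverse_Suc_bound]) simp
    then obtain K where K: "\<And>n. n \<ge> K \<Longrightarrow> 2 * C * (1 / real (Suc n)) < \<epsilon>\<^sup>2"
      by (auto simp: eventually_sequentially)
    show "\<exists>K. \<forall>m\<ge>K. \<forall>n\<ge>K. norm (a m - a n) < \<epsilon>"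
    proof (intro exI[of _ K] allI impI)
      fix m n assume "m \<ge> K" "n \<ge> K"
      have "\<bar>a m - a n\<bar>\<^sup>2 \<le> C * (1 / real (Suc m) + 1 / real (Suc n))" using assms(1) by simp
      also have "\<dots> < \<epsilon>\<^sup>2" using K[OF \<open>m \<ge> K\<close>] K[OF \<open>n \<ge> K\<close>] unfolding distrib_left by linarith
      finally show "norm (a m - a n) < \<epsilon>"
        using \<open>\<epsilon> > 0\<close> power_less_imp_less_base[of "\<bar>a m - a n\<bar>" 2 \<epsilon>] by simp
    qed
  qed
  then show ?thesis by (rule Cauchy_convergent)
qed

lemma tendsto_if_square_bound:
  fixes a b :: "nat \<Rightarrow> real"
  assumes "\<And>n. (a n - b n)\<^sup>2 \<le> C * (1 / real (Suc n))" "a \<longlonglongrightarrow> l"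
  shows "b \<longlonglongrightarrow> l"
proof -
  have "(\<lambda>n. (a n - b n)\<^sup>2) \<longlonglongrightarrow> 0"
    by (rule tendsto_sandwich[OF _ _ tendsto_const tendsto_inverse_Suc_bound[of C]])
       (use assms(1) in auto)
  then have "(\<lambda>n. a n - b n) \<longlonglongrightarrow> 0" by simp
  from tendsto_diff[OF assms(2) this] show ?thesis by simp
qed

text \<open>After division by \<open>z i0 ^ k\<close> the other summands are geometric sequences
  tending to zero, so their sum eventually stays below \<open>\<bar>d i0\<bar>\<close>.\<close>

lemma sum_powers_dominant_nonzero:
  fixes z :: "'i \<Rightarrow> complex" and d :: "'i \<Rightarrow> real"
  assumes "finite S" "i0 \<in> S" "d i0 \<noteq> 0" "z i0 \<noteq> 0"
    and "\<And>i. i \<in> S \<Longrightarrow> i \<noteq> i0 \<Longrightarrow> cmod (z i) < cmod (z i0)"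
  shows "\<exists>k0. \<forall>k. (\<Sum>i\<in>S. of_real (d i) * z i ^ k) = 0 \<longrightarrow> k < k0"
proof -
  define q where "q i = cmod (z i) / cmod (z i0)" for i
  have q: "0 \<le> q i" "q i < 1" if "i \<in> S - {i0}" for i
    using assms(4) assms(5)[of i] that by (auto simp: q_def)
  have "(\<lambda>k. \<Sum>i\<in>S - {i0}. \<bar>d i\<bar> * q i ^ k) \<longlonglongrightarrow> (\<Sum>i\<in>S - {i0}. 0)"
    using q by (intro tendsto_sum tendsto_mult_right_zero LIMSEQ_realpow_zero)
  then have "\<forall>\<^sub>F k in sequentially. (\<Sum>i\<in>S - {i0}. \<bar>d i\<bar> * q i ^ k) < \<bar>d i0\<bar>"
    using assms(3) by (intro order_tendstoD(2)) auto
  then obtain k0 where k0: "\<And>k. k \<ge> k0 \<Longrightarrow> (\<Sum>i\<in>S - {i0}. \<bar>d i\<bar> * q i ^ k) < \<bar>d i0\<bar>"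
    by (auto simp: eventually_sequentially)
  have "k < k0" if k: "(\<Sum>i\<in>S. of_real (d i) * z i ^ k) = 0" for k
  proof (rule ccontr)
    assume "\<not> k < k0"
    then have lt: "(\<Sum>i\<in>S - {i0}. \<bar>d i\<bar> * q i ^ k) < \<bar>d i0\<bar>" using k0 by simp
    have "of_real (d i0) * z i0 ^ k = - (\<Sum>i\<in>S - {i0}. of_real (d i) * z i ^ k)"
      using k assms(1,2) by (simp add: sum.remove[of S i0] eq_neg_iff_add_eq_0)
    then have "cmod (of_real (d i0) * z i0 ^ k) = cmod (\<Sum>i\<in>S - {i0}. of_real (d i) * z i ^ k)" by simp
    also have "\<dots> \<le> (\<Sum>i\<in>S - {i0}. cmod (of_real (d i) * z i ^ k))" by (rule norm_sum)
    also have "\<dots> = (\<Sum>i\<in>S - {i0}. \<bar>d i\<bar> * q i ^ k) * cmod (z i0) ^ k"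
      using assms(4) by (simp add: sum_distrib_right norm_mult norm_power q_def power_divide)
    also have "\<dots> < \<bar>d i0\<bar> * cmod (z i0) ^ k"
      using lt assms(4) by (intro mult_strict_right_mono) auto
    finally show False by (simp add: norm_mult norm_power)
  qed
  then show ?thesis by blast
qed

section \<open>Linear algebra: homogeneous systems, Gram factorization, Schur products\<close>

text \<open>Gaussian elimination, one equation at a time. It is applied with monomials as equations
  and points as unknowns.\<close>

lemma homogeneous_system_nontrivial:
  fixes \<phi> :: "'i \<Rightarrow> 'a \<Rightarrow> real"
  assumes "finite I" "finite S" "card S > card I"
  shows "\<exists>c. (\<exists>x\<in>S. c x \<noteq> 0) \<and> (\<forall>i\<in>I. (\<Sum>x\<in>S. c x * \<phi> i x) = 0)"
  using assms
proof (induction I arbitrary: S \<phi> rule: finite_induct)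
  case empty
  then have "S \<noteq> {}" by auto
  then show ?case by (intro exI[of _ "\<lambda>_. 1"]) auto
next
  case (insert j I)
  show ?case
  proof (cases "\<forall>x\<in>S. \<phi> j x = 0")
    case True
    then show ?thesis using insert.IH[of S \<phi>] insert.prems insert.hyps by auto
  next
    case False
    then obtain x0 where x0: "x0 \<in> S" "\<phi> j x0 \<noteq> 0" by blast
    \<comment> \<open>The pivot is \<open>x0\<close>: each \<open>\<psi> i\<close> is
      \<open>\<phi> i\<close> minus the multiple of \<open>\<phi> j\<close> that makes it vanish at
      \<open>x0\<close>. The weight at \<open>x0\<close> is afterwards solved from equation
      \<open>j\<close>.\<close>
    define \<psi> where "\<psi> i x = \<phi> i x - \<phi> j x * (\<phi> i x0 / \<phi> j x0)" for i x
    have "\<exists>c. (\<exists>x\<in>S - {x0}. c x \<noteq> 0) \<and> (\<forall>i\<in>I. (\<Sum>x\<in>S - {x0}. c x * \<psi> i x) = 0)"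
      using insert.prems insert.hyps x0 by (intro insert.IH) auto
    then obtain c where c: "\<exists>x\<in>S - {x0}. c x \<noteq> 0" "\<And>i. i \<in> I \<Longrightarrow> (\<Sum>x\<in>S - {x0}. c x * \<psi> i x) = 0" by blast
    define T where "T = (\<Sum>x\<in>S - {x0}. c x * \<phi> j x)"
    define c' where "c' x = (if x = x0 then - T / \<phi> j x0 else c x)" for x
    have split: "(\<Sum>x\<in>S. c' x * \<phi> i x) = - T / \<phi> j x0 * \<phi> i x0 + (\<Sum>x\<in>S - {x0}. c x * \<phi> i x)" for i
      using insert.prems x0 by (subst sum.remove[of S x0]) (auto simp: c'_def intro!: sum.cong)
    have "(\<Sum>x\<in>S. c' x * \<phi> i x) = 0" if "i \<in> I" for i
    proof -
      have "(\<Sum>x\<in>S - {x0}. c x * \<psi> i x) = (\<Sum>x\<in>S - {x0}. c x * \<phi> i x) - T * (\<phi> i x0 / \<phi> j x0)"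
        unfolding \<psi>_def T_def right_diff_distrib sum_subtractf sum_distrib_right by (simp only: mult.assoc)
      then show ?thesis using c(2)[OF that] by (simp add: split)
    qed
    moreover have "(\<Sum>x\<in>S. c' x * \<phi> j x) = 0" using x0 by (simp add: split T_def[symmetric])
    moreover have "\<exists>x\<in>S. c' x \<noteq> 0" using c(1) by (auto simp: c'_def)
    ultimately show ?thesis by (intro exI[of _ c']) auto
  qed
qed

text \<open>Cholesky factorization by induction: drop one point, factor the Schur complement of its
  diagonal entry, and restore its row by one more vector.\<close>

lemma pos_def_gram:
  fixes B :: "'a \<Rightarrow> 'a \<Rightarrow> real"
  assumes "finite S" "\<And>c. (\<Sum>x\<in>S. \<Sum>y\<in>S. c x * c y * B x y) \<ge> 0"
    and "\<And>x y. x \<in> S \<Longrightarrow> y \<in> S \<Longrightarrow> B x y = B y x"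
  shows "\<exists>(m::nat) v. \<forall>x\<in>S. \<forall>y\<in>S. B x y = (\<Sum>k<m. v k x * v k y)"
  using assms
proof (induction S arbitrary: B rule: finite_induct)
  case (insert a S)
  have expand: "(\<Sum>x\<in>insert a S. \<Sum>y\<in>insert a S. c x * c y * B x y) =
      (\<Sum>x\<in>S. \<Sum>y\<in>S. c x * c y * B x y) + 2 * c a * (\<Sum>x\<in>S. c x * B x a) + (c a)\<^sup>2 * B a a" for c
  proof -
    have "(\<Sum>x\<in>insert a S. \<Sum>y\<in>insert a S. c x * c y * B x y) =
       c a * c a * B a a + (\<Sum>y\<in>S. c a * c y * B a y) + ((\<Sum>x\<in>S. c x * c a * B x a) + (\<Sum>x\<in>S. \<Sum>y\<in>S. c x * c y * B x y))"
      using insert.hyps by (simp add: sum.distrib)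
    moreover have "(\<Sum>y\<in>S. c a * c y * B a y) = (\<Sum>x\<in>S. c x * c a * B x a)"
      using insert.prems(2) by (intro sum.cong) auto
    ultimately show ?thesis by (simp add: power2_eq_square sum_distrib_left mult_ac)
  qed
  have Baa: "B a a \<ge> 0"
    using insert.prems(1)[of "\<lambda>x. if x = a then 1 else 0"] insert.hyps(2) unfolding expand
    by (simp add: sum.neutral split: if_splits cong: sum.cong)
  have PSD: "(\<Sum>x\<in>S. \<Sum>y\<in>S. c x * c y * B x y) \<ge> 0" for c
  proof -
    have "(\<Sum>x\<in>S. \<Sum>y\<in>S. (c(a := 0)) x * (c(a := 0)) y * B x y) = (\<Sum>x\<in>S. \<Sum>y\<in>S. c x * c y * B x y)"
      using insert.hyps(2) by (intro sum.cong refl) auto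
    then show ?thesis using insert.prems(1)[of "c(a := 0)"] unfolding expand by simp
  qed
  have CS: "(\<Sum>x\<in>S. c x * B x a)\<^sup>2 \<le> (\<Sum>x\<in>S. \<Sum>y\<in>S. c x * c y * B x y) * B a a" for c
  proof (rule quadratic_nonneg_discriminant[OF _ Baa])
    fix t
    have "(\<Sum>x\<in>S. \<Sum>y\<in>S. (c(a := t)) x * (c(a := t)) y * B x y) = (\<Sum>x\<in>S. \<Sum>y\<in>S. c x * c y * B x y)"
      using insert.hyps(2) by (intro sum.cong refl) auto
    moreover have "(\<Sum>x\<in>S. (c(a := t)) x * B x a) = (\<Sum>x\<in>S. c x * B x a)"
      using insert.hyps(2) by (intro sum.cong refl) auto
    ultimately show "0 \<le> (\<Sum>x\<in>S. \<Sum>y\<in>S. c x * c y * B x y) + 2 * t * (\<Sum>x\<in>S. c x * B x a) + t\<^sup>2 * B a a"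
      using insert.prems(1)[of "c(a := t)"] unfolding expand by simp
  qed
  \<comment> \<open>The Schur complement of \<open>B a a\<close>. If \<open>B a a = 0\<close>,
    division by zero gives \<open>B' = B\<close>, which is right because \<open>CS\<close> then
    forces the row of \<open>a\<close> to vanish.\<close>
  define B' where "B' x y = B x y - B x a * B y a / B a a" for x y
  have "\<exists>(m::nat) v. \<forall>x\<in>S. \<forall>y\<in>S. B' x y = (\<Sum>k<m. v k x * v k y)"
  proof (rule insert.IH)
    fix c
    have "(\<Sum>x\<in>S. \<Sum>y\<in>S. c x * c y * B' x y) =
        (\<Sum>x\<in>S. \<Sum>y\<in>S. c x * c y * B x y) - (\<Sum>x\<in>S. c x * B x a)\<^sup>2 / B a a"
      by (simp add: B'_def right_diff_distrib sum_subtractf power2_eq_square sum_product sum_divide_distrib mult_ac)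
    also have "\<dots> \<ge> 0"
      using CS[of c] Baa PSD[of c] by (cases "B a a = 0") (auto simp: field_simps)
    finally show "0 \<le> (\<Sum>x\<in>S. \<Sum>y\<in>S. c x * c y * B' x y)" .
  qed (use insert.prems(2) in \<open>auto simp: B'_def\<close>)
  then obtain m :: nat and v where v: "\<And>x y. x \<in> S \<Longrightarrow> y \<in> S \<Longrightarrow> B' x y = (\<Sum>k<m. v k x * v k y)" by blast
  have zero: "B x a = 0" if "B a a = 0" "x \<in> S" for x
  proof -
    have "(\<Sum>y\<in>S. (if y = x then 1 else 0) * B y a)\<^sup>2 \<le> 0"
      using CS[of "\<lambda>y. if y = x then 1 else 0"] that by simp
    then show ?thesis using that insert.hyps by (simp add: if_distrib[of "\<lambda>c. c * _"] cong: if_cong)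
  qed
  \<comment> \<open>Index \<open>m\<close> carries the row of \<open>a\<close>; the old indices are
    set to zero at \<open>a\<close>, so entries involving \<open>a\<close> come from index
    \<open>m\<close> alone.\<close>
  define v' where "v' k x = (if k = m then B x a / sqrt (B a a) else if x = a then 0 else v k x)" for k x
  have "B x y = (\<Sum>k<Suc m. v' k x * v' k y)" if xy: "x \<in> insert a S" "y \<in> insert a S" for x y
  proof -
    have top: "v' m x * v' m y = B x a * B y a / B a a" for x y
      using Baa by (simp add: v'_def flip: real_sqrt_mult)
    have "(\<Sum>k<m. v' k x * v' k y) = (if x = a \<or> y = a then 0 else B' x y)"
      using v[of x y] xy by (auto simp: v'_def)
    then have "(\<Sum>k<Suc m. v' k x * v' k y) = (if x = a \<or> y = a then 0 else B' x y) + B x a * B y a / B a a"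
      by (simp add: top)
    also have "\<dots> = B x y"
      using zero[of x] zero[of y] insert.prems(2)[of x y] xy by (cases "B a a = 0") (auto simp: B'_def)
    finally show ?thesis by simp
  qed
  then show ?case by blast
qed simp

text \<open>Schur's product argument: a Gram factorization of \<open>G\<close> splits the form into
  forms of \<open>K\<close> with weights \<open>c x * v k x\<close>. As \<open>G x x > 0\<close>,
  some \<open>v k x\<close> is nonzero at a point with \<open>c x\<close> nonzero, and that summand
  is strictly positive.\<close>

lemma strictly_pos_def_mult:
  fixes K G :: "'a \<Rightarrow> 'a \<Rightarrow> real"
  assumes "strictly_pos_def_on M K" "pos_def_on M G"
    and sym: "\<And>x y. x \<in> M \<Longrightarrow> y \<in> M \<Longrightarrow> G x y = G y x" and diag: "\<And>x. x \<in> M \<Longrightarrow> G x x > 0"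
  shows "strictly_pos_def_on M (\<lambda>x y. K x y * G x y)"
proof -
  have *: "(\<Sum>x\<in>S. \<Sum>y\<in>S. c x * c y * (K x y * G x y)) \<ge> 0 \<and>
      ((\<exists>x\<in>S. c x \<noteq> 0) \<longrightarrow> (\<Sum>x\<in>S. \<Sum>y\<in>S. c x * c y * (K x y * G x y)) > 0)"
    if S: "finite S" "S \<noteq> {}" "S \<subseteq> M" for S and c :: "'a \<Rightarrow> real"
  proof -
    have "\<exists>(m::nat) v. \<forall>x\<in>S. \<forall>y\<in>S. G x y = (\<Sum>k<m. v k x * v k y)"
    proof (rule pos_def_gram[OF S(1)])
      show "(\<Sum>x\<in>S. \<Sum>y\<in>S. c x * c y * G x y) \<ge> 0" for c
        using S by (intro assms(2)[unfolded pos_def_on_def, rule_format]) auto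
    qed (use sym S in auto)
    then obtain m :: nat and v where v: "\<And>x y. x \<in> S \<Longrightarrow> y \<in> S \<Longrightarrow> G x y = (\<Sum>k<m. v k x * v k y)" by blast
    define q where "q k = (\<Sum>x\<in>S. \<Sum>y\<in>S. (c x * v k x) * (c y * v k y) * K x y)" for k
    have "(\<Sum>x\<in>S. \<Sum>y\<in>S. c x * c y * (K x y * G x y)) = (\<Sum>x\<in>S. \<Sum>y\<in>S. \<Sum>k<m. (c x * v k x) * (c y * v k y) * K x y)"
      by (intro sum.cong refl) (simp add: v sum_distrib_left mult_ac)
    also have "\<dots> = (\<Sum>x\<in>S. \<Sum>k<m. \<Sum>y\<in>S. (c x * v k x) * (c y * v k y) * K x y)"
      by (intro sum.cong refl sum.swap)
    also have "\<dots> = (\<Sum>k<m. q k)" unfolding q_def by (rule sum.swap)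
    finally have eq: "(\<Sum>x\<in>S. \<Sum>y\<in>S. c x * c y * (K x y * G x y)) = (\<Sum>k<m. q k)" .
    have q0: "q k \<ge> 0" for k
      using S unfolding q_def
      by (intro assms(1)[unfolded strictly_pos_def_on_def, THEN conjunct1, unfolded pos_def_on_def, rule_format]) auto
    have "(\<Sum>k<m. q k) > 0" if "\<exists>x\<in>S. c x \<noteq> 0"
    proof -
      obtain x where x: "x \<in> S" "c x \<noteq> 0" using \<open>\<exists>x\<in>S. c x \<noteq> 0\<close> by blast
      have "(\<Sum>k<m. v k x * v k x) \<noteq> 0" using v[OF x(1) x(1)] diag[of x] x S by auto
      then obtain k where k: "k < m" "v k x * v k x \<noteq> 0" by (meson lessThan_iff sum.neutral)
      have ex: "\<exists>x\<in>S. c x * v k x \<noteq> 0" using x k by auto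
      have "q k > 0"
        using S ex unfolding q_def
        by (intro assms(1)[unfolded strictly_pos_def_on_def, THEN conjunct2, rule_format]) auto
      then show ?thesis using k q0 by (intro sum_pos2[of "{..<m}" k]) auto
    qed
    then show ?thesis unfolding eq using q0 by (auto intro: sum_nonneg)
  qed
  show ?thesis unfolding strictly_pos_def_on_def pos_def_on_def
    by (intro conjI allI impI; elim conjE) (use * in simp_all)
qed

section \<open>Transport of kernels along injections and isometries\<close>

lemma pos_def_on_cong:
  assumes "\<And>x y. x \<in> M \<Longrightarrow> y \<in> M \<Longrightarrow> K x y = K' x y"
  shows "pos_def_on M K \<longleftrightarrow> pos_def_on M K'"
    and "strictly_pos_def_on M K \<longleftrightarrow> strictly_pos_def_on M K'"
proof -
  have eq: "(\<Sum>x\<in>S. \<Sum>y\<in>S. c x * c y * K x y) = (\<Sum>x\<in>S. \<Sum>y\<in>S. c x * c y * K' x y)" if "S \<subseteq> M" for S c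
    using that assms by (intro sum.cong refl) (auto simp: subset_iff)
  show 1: "pos_def_on M K \<longleftrightarrow> pos_def_on M K'"
    unfolding pos_def_on_def using eq by simp
  show "strictly_pos_def_on M K \<longleftrightarrow> strictly_pos_def_on M K'"
    unfolding strictly_pos_def_on_def 1 using eq by simp
qed

lemma pos_def_on_pullback:
  assumes inj: "inj_on h M" and sub: "h ` M \<subseteq> N"
  shows "pos_def_on N K \<Longrightarrow> pos_def_on M (\<lambda>x y. K (h x) (h y))"
    and "strictly_pos_def_on N K \<Longrightarrow> strictly_pos_def_on M (\<lambda>x y. K (h x) (h y))"
proof -
  have push: "\<exists>d. finite (h ` S) \<and> h ` S \<noteq> {} \<and> h ` S \<subseteq> N \<and> ((\<exists>y\<in>h ` S. d y \<noteq> 0) \<longleftrightarrow> (\<exists>x\<in>S. c x \<noteq> 0)) \<and>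
     (\<Sum>x\<in>S. \<Sum>y\<in>S. c x * c y * K (h x) (h y)) = (\<Sum>x\<in>h ` S. \<Sum>y\<in>h ` S. d x * d y * K x y)"
    if S: "finite S" "S \<noteq> {}" "S \<subseteq> M" for S and c :: "_ \<Rightarrow> real"
    by (rule exI[of _ "\<lambda>y. c (inv_into S h y)"])
      (use S sub inj_on_subset[OF inj S(3)] in \<open>auto simp: sum.reindex\<close>)
  show pd: "pos_def_on M (\<lambda>x y. K (h x) (h y))" if "pos_def_on N K"
    unfolding pos_def_on_def
  proof (intro allI impI, elim conjE)
    fix S and c :: "_ \<Rightarrow> real" assume S: "finite S" "S \<noteq> {}" "S \<subseteq> M"
    show "0 \<le> (\<Sum>x\<in>S. \<Sum>y\<in>S. c x * c y * K (h x) (h y))"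
      using push[OF S, of c] that by (elim exE conjE) (simp add: pos_def_on_def)
  qed
  show "strictly_pos_def_on M (\<lambda>x y. K (h x) (h y))" if "strictly_pos_def_on N K"
    unfolding strictly_pos_def_on_def
  proof (intro conjI allI impI, use pd that in \<open>simp add: strictly_pos_def_on_def\<close>, elim conjE)
    fix S and c :: "_ \<Rightarrow> real" assume S: "finite S" "S \<noteq> {}" "S \<subseteq> M" "\<exists>x\<in>S. c x \<noteq> 0"
    show "0 < (\<Sum>x\<in>S. \<Sum>y\<in>S. c x * c y * K (h x) (h y))"
      using push[OF S(1-3), of c] S(4) that by (elim exE conjE) (simp add: strictly_pos_def_on_def)
  qed
qed

lemma pos_def_on_bij_betw:
  assumes h: "bij_betw h M N"
  shows "pos_def_on M (\<lambda>x y. K (h x) (h y)) \<longleftrightarrow> pos_def_on N K"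
    and "strictly_pos_def_on M (\<lambda>x y. K (h x) (h y)) \<longleftrightarrow> strictly_pos_def_on N K"
proof -
  define k where "k = inv_into M h"
  have k: "inj_on k N" "k ` N \<subseteq> M" and hk: "\<And>y. y \<in> N \<Longrightarrow> h (k y) = y"
    using bij_betw_inv_into[OF h] bij_betw_inv_into_right[OF h] by (auto simp: k_def bij_betw_def)
  have eq: "pos_def_on N (\<lambda>x y. K (h (k x)) (h (k y))) \<longleftrightarrow> pos_def_on N K"
    "strictly_pos_def_on N (\<lambda>x y. K (h (k x)) (h (k y))) \<longleftrightarrow> strictly_pos_def_on N K"
    by (rule pos_def_on_cong; simp add: hk)+
  have h': "inj_on h M" "h ` M \<subseteq> N" using h by (auto simp: bij_betw_def)
  show "pos_def_on M (\<lambda>x y. K (h x) (h y)) \<longleftrightarrow> pos_def_on N K"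
    using pos_def_on_pullback(1)[OF h'] pos_def_on_pullback(1)[OF k, of "\<lambda>x y. K (h x) (h y)"] eq(1) by blast
  show "strictly_pos_def_on M (\<lambda>x y. K (h x) (h y)) \<longleftrightarrow> strictly_pos_def_on N K"
    using pos_def_on_pullback(2)[OF h'] pos_def_on_pullback(2)[OF k, of "\<lambda>x y. K (h x) (h y)"] eq(2) by blast
qed

lemma isotropic_part_isometric:
  assumes "isometric_spaces M \<delta> N \<rho>"
  shows "isotropic_part_pd M \<delta> f \<longleftrightarrow> isotropic_part_pd N \<rho> f"
    and "isotropic_part_spd M \<delta> f \<longleftrightarrow> isotropic_part_spd N \<rho> f"
proof -
  obtain h where h: "bij_betw h M N" and eq: "\<And>x y. x \<in> M \<Longrightarrow> y \<in> M \<Longrightarrow> \<rho> (h x) (h y) = \<delta> x y"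
    using assms by (auto simp: isometric_spaces_def)
  have K: "isotropic_kernel \<delta> f x y = isotropic_kernel \<rho> f (h x) (h y)" if "x \<in> M" "y \<in> M" for x y
    using eq[OF that] by (simp add: isotropic_kernel_def)
  show "isotropic_part_pd M \<delta> f \<longleftrightarrow> isotropic_part_pd N \<rho> f"
    using pos_def_on_cong(1)[of M, OF K] pos_def_on_bij_betw(1)[OF h] by (simp add: isotropic_part_pd_def)
  show "isotropic_part_spd M \<delta> f \<longleftrightarrow> isotropic_part_spd N \<rho> f"
    using pos_def_on_cong(2)[of M, OF K] pos_def_on_bij_betw(2)[OF h] by (simp add: isotropic_part_spd_def)
qed

lemma polynomial_on_interval_mult:
  "polynomial_on_interval f \<Longrightarrow> polynomial_on_interval g \<Longrightarrow> polynomial_on_interval (\<lambda>t. f t * g t)"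
  unfolding polynomial_on_interval_def by (metis poly_mult)

section \<open>Means and two-point homogeneous models\<close>

text \<open>Finitely supported averages with dyadic weights, in the role of probability measures.
  Closure under midpoints is the convexity that the parallelogram argument uses.\<close>

inductive_set means :: "'a set \<Rightarrow> (('a \<Rightarrow> real) \<Rightarrow> real) set" for M where
  point: "q \<in> M \<Longrightarrow> (\<lambda>h. h q) \<in> means M"
| mid: "L \<in> means M \<Longrightarrow> L' \<in> means M \<Longrightarrow> (\<lambda>h. (L h + L' h) / 2) \<in> means M"

lemma means_add: "L \<in> means M \<Longrightarrow> L (\<lambda>x. h x + h' x) = L h + L h'"
  by (induction rule: means.induct) (auto simp: field_simps)

lemma means_diff: "L \<in> means M \<Longrightarrow> L (\<lambda>x. h x - h' x) = L h - L h'"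
  by (induction rule: means.induct) (auto simp: field_simps)

lemma means_cmult: "L \<in> means M \<Longrightarrow> L (\<lambda>x. r * h x) = r * L h"
  by (induction rule: means.induct) (auto simp: field_simps)

lemma means_const: "L \<in> means M \<Longrightarrow> L (\<lambda>x. r) = r"
  by (induction rule: means.induct) auto

lemma means_sum: "L \<in> means M \<Longrightarrow> L (\<lambda>x. \<Sum>i\<in>I. h i x) = (\<Sum>i\<in>I. L (h i))"
  by (induction rule: means.induct) (auto simp: sum_divide_distrib sum.distrib[symmetric])

lemma means_mono: "L \<in> means M \<Longrightarrow> (\<And>x. x \<in> M \<Longrightarrow> h x \<le> h' x) \<Longrightarrow> L h \<le> L h'"
  by (induction rule: means.induct) (auto simp: add_mono divide_right_mono)

lemma means_cong: "L \<in> means M \<Longrightarrow> (\<And>x. x \<in> M \<Longrightarrow> h x = h' x) \<Longrightarrow> L h = L h'"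
  by (induction rule: means.induct) auto

lemma means_push: "L \<in> means M \<Longrightarrow> g ` M \<subseteq> M \<Longrightarrow> (\<lambda>h. L (\<lambda>x. h (g x))) \<in> means M"
  by (induction rule: means.induct) (auto intro!: means.intros)

text \<open>Brings a mean into the shape of a weighted finite sum, to which positive definiteness
  applies.\<close>

lemma means_rep:
  assumes "L \<in> means M"
  shows "\<exists>S c. finite S \<and> S \<subseteq> M \<and> (\<forall>h. L h = (\<Sum>x\<in>S. c x * h x))"
  using assms
proof (induction rule: means.induct)
  case (point q)
  show ?case by (rule exI[of _ "{q}"], rule exI[of _ "\<lambda>_. 1"]) (use point in auto)
next
  case (mid L L')
  then obtain S c S' c' where *: "finite S" "S \<subseteq> M" "\<And>h. L h = (\<Sum>x\<in>S. c x * h x)"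
    "finite S'" "S' \<subseteq> M" "\<And>h. L' h = (\<Sum>x\<in>S'. c' x * h x)" by blast
  let ?d = "\<lambda>x. ((if x \<in> S then c x else 0) + (if x \<in> S' then c' x else 0)) / 2"
  have "(L h + L' h) / 2 = (\<Sum>x\<in>S \<union> S'. ?d x * h x)" for h
  proof -
    have "(\<Sum>x\<in>S. c x * h x) = (\<Sum>x\<in>S \<union> S'. (if x \<in> S then c x else 0) * h x)"
      using * by (intro sum.mono_neutral_cong_left) auto
    moreover have "(\<Sum>x\<in>S'. c' x * h x) = (\<Sum>x\<in>S \<union> S'. (if x \<in> S' then c' x else 0) * h x)"
      using * by (intro sum.mono_neutral_cong_left) auto
    ultimately show ?thesis unfolding *(3,6)
      by (simp add: sum.distrib[symmetric] sum_divide_distrib algebra_simps add_divide_distrib)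
  qed
  then show ?case using * by (intro exI[of _ "S \<union> S'"] exI[of _ ?d]) auto
qed

lemma means_diff_rep:
  assumes "L \<in> means M" "L' \<in> means M"
  shows "\<exists>S c. finite S \<and> S \<subseteq> M \<and> (\<forall>h. L h - L' h = (\<Sum>x\<in>S. c x * h x))"
proof -
  obtain S c S' c' where *: "finite S" "S \<subseteq> M" "\<And>h. L h = (\<Sum>x\<in>S. c x * h x)"
    "finite S'" "S' \<subseteq> M" "\<And>h. L' h = (\<Sum>x\<in>S'. c' x * h x)"
    using means_rep[OF assms(1)] means_rep[OF assms(2)] by blast
  let ?d = "\<lambda>x. (if x \<in> S then c x else 0) - (if x \<in> S' then c' x else 0)"
  have "L h - L' h = (\<Sum>x\<in>S \<union> S'. ?d x * h x)" for h
  proof -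
    have "(\<Sum>x\<in>S. c x * h x) = (\<Sum>x\<in>S \<union> S'. (if x \<in> S then c x else 0) * h x)"
      using * by (intro sum.mono_neutral_cong_left) auto
    moreover have "(\<Sum>x\<in>S'. c' x * h x) = (\<Sum>x\<in>S \<union> S'. (if x \<in> S' then c' x else 0) * h x)"
      using * by (intro sum.mono_neutral_cong_left) auto
    ultimately show ?thesis unfolding *(3,6)
      by (simp add: sum_subtractf[symmetric] algebra_simps)
  qed
  then show ?thesis using * by (intro exI[of _ "S \<union> S'"] exI[of _ ?d]) auto
qed

text \<open>The cross terms of the difference and of the midpoint cancel. Once midpoints have energy
  at least the infimum, the difference of two near-minimizers has small energy.\<close>

lemma energy_parallelogram:
  assumes "L \<in> means M" "L' \<in> means M"
  defines "D \<equiv> \<lambda>h. L h - L' h" and "m \<equiv> \<lambda>h. (L h + L' h) / 2"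
  shows "D (\<lambda>x. D (k x)) = 2 * L (\<lambda>x. L (k x)) + 2 * L' (\<lambda>x. L' (k x)) - 4 * m (\<lambda>x. m (k x))"
proof -
  have h: "L (\<lambda>x. h x / 2) = L h / 2" "L' (\<lambda>x. h x / 2) = L' h / 2" for h
    using means_cmult[OF assms(1), of "1/2" h] means_cmult[OF assms(2), of "1/2" h] by simp_all
  show ?thesis unfolding D_def m_def h
    by (simp add: means_diff[OF assms(1)] means_diff[OF assms(2)]
       means_add[OF assms(1)] means_add[OF assms(2)] field_simps)
qed

text \<open>Here \<open>u\<close> is the squared cosine of the angle, \<open>e\<close> its finite
  feature map, and \<open>\<nu>\<close> parametrizes an embedded real projective plane by unit
  vectors, opposite vectors giving the same point. The homogeneity clause moves any pair to a normal
  form inside that plane, so it covers transitivity on points and on pairs of equal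
  \<open>u\<close>.\<close>

locale two_point_model =
  fixes M :: "'a set" and u :: "'a \<Rightarrow> 'a \<Rightarrow> real" and A :: "'b set" and e :: "'b \<Rightarrow> 'a \<Rightarrow> real"
    and \<nu> :: "real \<Rightarrow> real \<Rightarrow> real \<Rightarrow> 'a"
  assumes finite_A: "finite A"
    and u_eq_sum: "P \<in> M \<Longrightarrow> Q \<in> M \<Longrightarrow> u P Q = (\<Sum>a\<in>A. e a P * e a Q)"
    and u_self: "P \<in> M \<Longrightarrow> u P P = 1"
    and u_nonneg: "P \<in> M \<Longrightarrow> Q \<in> M \<Longrightarrow> u P Q \<ge> 0"
    and u_eq_1D: "P \<in> M \<Longrightarrow> Q \<in> M \<Longrightarrow> u P Q = 1 \<Longrightarrow> P = Q"
    and nu_in: "x\<^sup>2 + y\<^sup>2 + z\<^sup>2 = 1 \<Longrightarrow> \<nu> x y z \<in> M"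
    and u_nu_nu: "x\<^sup>2 + y\<^sup>2 + z\<^sup>2 = 1 \<Longrightarrow> x'\<^sup>2 + y'\<^sup>2 + z'\<^sup>2 = 1 \<Longrightarrow>
        u (\<nu> x y z) (\<nu> x' y' z') = (x * x' + y * y' + z * z')\<^sup>2"
    and u_nu_quadratic: "P \<in> M \<Longrightarrow> \<exists>s1 s2 s3 s4 s5 s6. \<forall>x y z. x\<^sup>2 + y\<^sup>2 + z\<^sup>2 = 1 \<longrightarrow>
        u P (\<nu> x y z) = s1 * x\<^sup>2 + s2 * y\<^sup>2 + s3 * z\<^sup>2 + s4 * (x * y) + s5 * (x * z) + s6 * (y * z)"
    and two_point_homogeneous: "P \<in> M \<Longrightarrow> R \<in> M \<Longrightarrow> \<exists>g. g ` M = M \<and>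
        (\<forall>x\<in>M. \<forall>y\<in>M. u (g x) (g y) = u x y) \<and> g P = \<nu> 1 0 0 \<and>
        g R = \<nu> (sqrt (u P R)) 0 (sqrt (1 - u P R))"
begin

lemma u_sym: "P \<in> M \<Longrightarrow> Q \<in> M \<Longrightarrow> u P Q = u Q P"
  by (simp add: u_eq_sum mult.commute)

lemma u_dist_sq:
  assumes "P \<in> M" "Q \<in> M"
  shows "(\<Sum>a\<in>A. (e a P - e a Q)\<^sup>2) = 2 - 2 * u P Q"
proof -
  have "(\<Sum>a\<in>A. (e a P - e a Q)\<^sup>2) = u P P + u Q Q - 2 * u P Q"
    unfolding u_eq_sum[OF assms(1) assms(1)] u_eq_sum[OF assms(2) assms(2)] u_eq_sum[OF assms]
    by (simp add: power2_eq_square algebra_simps sum.distrib sum_subtractf sum_distrib_left)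
  then show ?thesis using assms by (simp add: u_self)
qed

lemma u_le_1: "P \<in> M \<Longrightarrow> Q \<in> M \<Longrightarrow> u P Q \<le> 1"
  using u_dist_sq[of P Q] sum_nonneg[of A "\<lambda>a. (e a P - e a Q)\<^sup>2"] by simp

text \<open>Feature vectors are unit vectors, so this is Cauchy-Schwarz combined with
  \<open>u_dist_sq\<close>. It turns closeness measured by \<open>u\<close> into continuity of
  \<open>u P\<close>.\<close>

lemma u_lipschitz:
  assumes "P \<in> M" "Q \<in> M" "R \<in> M"
  shows "(u P Q - u P R)\<^sup>2 \<le> 2 - 2 * u Q R"
proof -
  have "u P Q - u P R = (\<Sum>a\<in>A. e a P * (e a Q - e a R))"
    using assms by (simp add: u_eq_sum sum_subtractf right_diff_distrib)
  then have "(u P Q - u P R)\<^sup>2 \<le> (\<Sum>a\<in>A. (e a P)\<^sup>2) * (\<Sum>a\<in>A. (e a Q - e a R)\<^sup>2)"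
    by (simp add: Cauchy_Schwarz_ineq_sum)
  moreover have "(\<Sum>a\<in>A. (e a P)\<^sup>2) = 1"
    using u_self[OF assms(1)] u_eq_sum[OF assms(1,1)] by (simp add: power2_eq_square)
  ultimately show ?thesis using u_dist_sq[OF assms(2,3)] by simp
qed

text \<open>Each feature of \<open>u (r i) (r j)\<close> is absorbed into the weight
  \<open>c\<close>, one factor of the power at a time. Separate families \<open>p\<close> and
  \<open>r\<close> allow \<open>F\<close> and \<open>u ^ N\<close> to be evaluated at different
  points, as in \<open>F (u P x) * u R x ^ N\<close>.\<close>

lemma pos_def_times_power:
  assumes "pos_def_on M (\<lambda>x y. F (u x y))" "finite I" "p ` I \<subseteq> M" "r ` I \<subseteq> M"
  shows "(\<Sum>i\<in>I. \<Sum>j\<in>I. c i * c j * (F (u (p i) (p j)) * u (r i) (r j) ^ N)) \<ge> 0"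
proof (induction N arbitrary: c)
  case 0
  then show ?case using pos_def_on_family[OF assms(1-3)] by simp
next
  case (Suc N)
  have "(\<Sum>i\<in>I. \<Sum>j\<in>I. c i * c j * (F (u (p i) (p j)) * u (r i) (r j) ^ Suc N))
     = (\<Sum>i\<in>I. \<Sum>j\<in>I. \<Sum>a\<in>A. (c i * e a (r i)) * (c j * e a (r j)) * (F (u (p i) (p j)) * u (r i) (r j) ^ N))"
  proof (intro sum.cong refl)
    fix i j assume "i \<in> I" "j \<in> I"
    then have eq: "u (r i) (r j) = (\<Sum>a\<in>A. e a (r i) * e a (r j))"
      using assms(4) by (intro u_eq_sum) auto
    let ?G = "F (u (p i) (p j)) * u (r i) (r j) ^ N"
    have "c i * c j * (F (u (p i) (p j)) * u (r i) (r j) ^ Suc N) = u (r i) (r j) * (c i * c j * ?G)"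
      by (simp add: mult_ac)
    also have "\<dots> = (\<Sum>a\<in>A. e a (r i) * e a (r j)) * (c i * c j * ?G)"
      by (rule arg_cong[OF eq])
    also have "\<dots> = (\<Sum>a\<in>A. (c i * e a (r i)) * (c j * e a (r j)) * ?G)"
      by (subst sum_distrib_right) (intro sum.cong refl, simp add: mult_ac)
    finally show "c i * c j * (F (u (p i) (p j)) * u (r i) (r j) ^ Suc N) =
       (\<Sum>a\<in>A. (c i * e a (r i)) * (c j * e a (r j)) * ?G)" .
  qed
  also have "\<dots> = (\<Sum>i\<in>I. \<Sum>a\<in>A. \<Sum>j\<in>I. (c i * e a (r i)) * (c j * e a (r j)) * (F (u (p i) (p j)) * u (r i) (r j) ^ N))"
    by (intro sum.cong refl sum.swap)
  also have "\<dots> = (\<Sum>a\<in>A. \<Sum>i\<in>I. \<Sum>j\<in>I. (c i * e a (r i)) * (c j * e a (r j)) * (F (u (p i) (p j)) * u (r i) (r j) ^ N))"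
    by (rule sum.swap)
  also have "\<dots> \<ge> 0" by (intro sum_nonneg Suc.IH)
  finally show ?case .
qed

text \<open>The extra index \<open>None\<close> stands for the pair \<open>(P, R)\<close> with
  weight \<open>t\<close>. The form is then quadratic in \<open>t\<close> with leading coefficient
  \<open>F 1\<close>, because \<open>u P P = u R R = 1\<close>. The \<open>option\<close> index
  keeps this entry apart when \<open>P\<close> or \<open>R\<close> lies in \<open>S\<close>.\<close>

lemma kernel_Cauchy_Schwarz:
  assumes "pos_def_on M (\<lambda>x y. F (u x y))" "finite S" "S \<subseteq> M" "P \<in> M" "R \<in> M"
  shows "(\<Sum>x\<in>S. c x * (F (u P x) * u R x ^ N))\<^sup>2 \<le>
     (\<Sum>x\<in>S. \<Sum>y\<in>S. c x * c y * (F (u x y) * u x y ^ N)) * F 1"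
proof (rule quadratic_nonneg_discriminant)
  fix t
  let ?I = "insert None (Some ` S)"
  let ?p = "\<lambda>i. case i of None \<Rightarrow> P | Some x \<Rightarrow> x"
  let ?r = "\<lambda>i. case i of None \<Rightarrow> R | Some x \<Rightarrow> x"
  let ?c = "\<lambda>i. case i of None \<Rightarrow> t | Some x \<Rightarrow> c x"
  have "0 \<le> (\<Sum>i\<in>?I. \<Sum>j\<in>?I. ?c i * ?c j * (F (u (?p i) (?p j)) * u (?r i) (?r j) ^ N))"
    by (rule pos_def_times_power[OF assms(1)]) (use assms in \<open>auto split: option.splits\<close>)
  also have "\<dots> = (\<Sum>j\<in>?I. t * ?c j * (F (u P (?p j)) * u R (?r j) ^ N)) +
      (\<Sum>x\<in>S. \<Sum>j\<in>?I. c x * ?c j * (F (u x (?p j)) * u x (?r j) ^ N))"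
    using assms(2) by (subst sum.insert) (auto simp: sum.reindex)
  also have "\<dots> = t * t * F 1 + (\<Sum>y\<in>S. t * c y * (F (u P y) * u R y ^ N)) +
      (\<Sum>x\<in>S. c x * t * (F (u P x) * u R x ^ N) + (\<Sum>y\<in>S. c x * c y * (F (u x y) * u x y ^ N)))"
  proof -
    have 1: "(\<Sum>j\<in>?I. t * ?c j * (F (u P (?p j)) * u R (?r j) ^ N))
      = t * t * F 1 + (\<Sum>y\<in>S. t * c y * (F (u P y) * u R y ^ N))"
      using assms by (subst sum.insert) (auto simp: sum.reindex u_self)
    have 2: "(\<Sum>j\<in>?I. c x * ?c j * (F (u x (?p j)) * u x (?r j) ^ N)) =
       c x * t * (F (u P x) * u R x ^ N) + (\<Sum>y\<in>S. c x * c y * (F (u x y) * u x y ^ N))"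
      if "x \<in> S" for x
      using assms that u_sym[of x P] u_sym[of x R]
      by (subst sum.insert) (auto simp: sum.reindex subset_iff)
    show ?thesis by (simp add: 1 2 del: sum.insert)
  qed
  also have "\<dots> = (\<Sum>x\<in>S. \<Sum>y\<in>S. c x * c y * (F (u x y) * u x y ^ N)) +
     2 * t * (\<Sum>x\<in>S. c x * (F (u P x) * u R x ^ N)) + t\<^sup>2 * F 1"
    by (simp add: sum.distrib sum_distrib_left mult_ac power2_eq_square)
  finally show "0 \<le> (\<Sum>x\<in>S. \<Sum>y\<in>S. c x * c y * (F (u x y) * u x y ^ N)) +
     2 * t * (\<Sum>x\<in>S. c x * (F (u P x) * u R x ^ N)) + t\<^sup>2 * F 1" .
next
  show "F 1 \<ge> 0"
    using pos_def_on_family[OF assms(1), of "{()}" "\<lambda>_. P" "\<lambda>_. 1"] assms(4) by (simp add: u_self)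
qed

definition isometry :: "('a \<Rightarrow> 'a) \<Rightarrow> bool" where
  "isometry g \<longleftrightarrow> g ` M = M \<and> (\<forall>x\<in>M. \<forall>y\<in>M. u (g x) (g y) = u x y)"

lemma isometry_in: "isometry g \<Longrightarrow> x \<in> M \<Longrightarrow> g x \<in> M"
  and isometry_u: "isometry g \<Longrightarrow> x \<in> M \<Longrightarrow> y \<in> M \<Longrightarrow> u (g x) (g y) = u x y"
  by (auto simp: isometry_def)

lemma hom_pair:
  assumes "P \<in> M" "R \<in> M"
  obtains g where "isometry g" "g P = \<nu> 1 0 0" "g R = \<nu> (sqrt (u P R)) 0 (sqrt (1 - u P R))"
  using two_point_homogeneous[OF assms] by (auto simp: isometry_def)

lemma sqrt_unit: "0 \<le> s \<Longrightarrow> s \<le> 1 \<Longrightarrow> (sqrt s)\<^sup>2 + 0\<^sup>2 + (sqrt (1 - s))\<^sup>2 = 1"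
  by simp

lemma base_in: "\<nu> 1 0 0 \<in> M" by (rule nu_in) simp

lemma u_base: "0 \<le> s \<Longrightarrow> s \<le> 1 \<Longrightarrow> u (\<nu> 1 0 0) (\<nu> (sqrt s) 0 (sqrt (1 - s))) = s"
  by (subst u_nu_nu) (auto simp: sqrt_unit)

lemma pos_def_const_1: "pos_def_on M (\<lambda>x y. 1)"
  unfolding pos_def_on_def
proof (intro allI impI)
  fix S :: "'a set" and c :: "'a \<Rightarrow> real"
  have "(\<Sum>x\<in>S. \<Sum>y\<in>S. c x * c y * 1) = (\<Sum>x\<in>S. c x)\<^sup>2"
    by (simp add: power2_eq_square sum_product)
  then show "0 \<le> (\<Sum>x\<in>S. \<Sum>y\<in>S. c x * c y * 1)" by simp
qed

lemma diff_energy_nonneg: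
  assumes "pos_def_on M (\<lambda>x y. F (u x y))" "L \<in> means M" "L' \<in> means M"
  defines "D \<equiv> \<lambda>h. L h - L' h"
  shows "0 \<le> D (\<lambda>x. D (\<lambda>y. F (u x y) * u x y ^ N))"
proof -
  obtain S c where S: "finite S" "S \<subseteq> M" and D: "\<And>h. D h = (\<Sum>x\<in>S. c x * h x)"
    using means_diff_rep[OF assms(2,3)] by (auto simp: D_def)
  have "D (\<lambda>x. D (\<lambda>y. F (u x y) * u x y ^ N)) = (\<Sum>x\<in>S. \<Sum>y\<in>S. c x * c y * (F (u x y) * u x y ^ N))"
    unfolding D by (simp add: sum_distrib_left mult_ac)
  also have "\<dots> \<ge> 0"
    using pos_def_times_power[OF assms(1) S(1), of "\<lambda>x. x" "\<lambda>x. x" c N] S(2) by simp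
  finally show ?thesis .
qed

lemma means_energy_nonneg:
  assumes "pos_def_on M (\<lambda>x y. F (u x y))" "L \<in> means M"
  shows "0 \<le> L (\<lambda>x. L (\<lambda>y. F (u x y) * u x y ^ N))"
proof -
  obtain S c where S: "finite S" "S \<subseteq> M" and D: "\<And>h. L h = (\<Sum>x\<in>S. c x * h x)"
    using means_rep[OF assms(2)] by auto
  have "L (\<lambda>x. L (\<lambda>y. F (u x y) * u x y ^ N)) = (\<Sum>x\<in>S. \<Sum>y\<in>S. c x * c y * (F (u x y) * u x y ^ N))"
    unfolding D by (simp add: sum_distrib_left mult_ac)
  also have "\<dots> \<ge> 0"
    using pos_def_times_power[OF assms(1) S(1), of "\<lambda>x. x" "\<lambda>x. x" c N] S(2) by simp
  finally show ?thesis .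
qed

lemma diff_Cauchy_Schwarz:
  assumes "pos_def_on M (\<lambda>x y. F (u x y))" "L \<in> means M" "L' \<in> means M" "P \<in> M" "R \<in> M"
  defines "D \<equiv> \<lambda>h. L h - L' h"
  shows "(D (\<lambda>x. F (u P x) * u R x ^ N))\<^sup>2 \<le> D (\<lambda>x. D (\<lambda>y. F (u x y) * u x y ^ N)) * F 1"
proof -
  obtain S c where S: "finite S" "S \<subseteq> M" and D: "\<And>h. D h = (\<Sum>x\<in>S. c x * h x)"
    using means_diff_rep[OF assms(2,3)] by (auto simp: D_def)
  have "D (\<lambda>x. D (\<lambda>y. F (u x y) * u x y ^ N)) = (\<Sum>x\<in>S. \<Sum>y\<in>S. c x * c y * (F (u x y) * u x y ^ N))"
    unfolding D by (simp add: sum_distrib_left mult_ac)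
  then show ?thesis
    using kernel_Cauchy_Schwarz[OF assms(1) S assms(4,5), of c N] by (simp add: D)
qed

lemma F1_nonneg:
  assumes "pos_def_on M (\<lambda>x y. F (u x y))"
  shows "F 1 \<ge> 0"
  using pos_def_on_family[OF assms, of "{()}" "\<lambda>_. \<nu> 1 0 0" "\<lambda>_. 1"] base_in by (simp add: u_self)

text \<open>The minimizers of the energy of \<open>(1 + F) u\<^sup>N\<close> take the place of the invariant measure: the
  parallelogram law makes a minimizing sequence Cauchy and asymptotically invariant.\<close>

lemma invariant_mean:
  assumes pd: "pos_def_on M (\<lambda>x y. F (u x y))"
  obtains L J \<beta> where "\<And>n::nat. L n \<in> means M"
    and "\<And>P R. P \<in> M \<Longrightarrow> R \<in> M \<Longrightarrow> (\<lambda>n. L n (\<lambda>x. F (u P x) * u R x ^ N)) \<longlonglongrightarrow> J P R"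
    and "\<And>R. R \<in> M \<Longrightarrow> (\<lambda>n. L n (\<lambda>x. u R x ^ N)) \<longlonglongrightarrow> \<beta>"
    and "\<And>g P R. isometry g \<Longrightarrow> P \<in> M \<Longrightarrow> R \<in> M \<Longrightarrow> J (g P) (g R) = J P R"
proof -
  define en where "en G D = D (\<lambda>x. D (\<lambda>y. G (u x y) * u x y ^ N))" for G :: "real \<Rightarrow> real" and D :: "('a \<Rightarrow> real) \<Rightarrow> real"
  \<comment> \<open>The summand 1 lets one minimizing sequence control the averages of
    \<open>u R x ^ N\<close> together with those of \<open>F (u P x) * u R x ^ N\<close>.\<close>
  define K where "K t = 1 + F t" for t
  have means_nonneg: "0 \<le> en K L" if "L \<in> means M" for L
  proof -
    have "en K L = en (\<lambda>_. 1) L + en F L"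
      by (simp add: en_def K_def distrib_right means_add[OF that])
    moreover have "0 \<le> en (\<lambda>_. 1) L" unfolding en_def
      by (rule means_energy_nonneg[where F = "\<lambda>_. 1"]) (use pos_def_const_1 that in auto)
    moreover have "0 \<le> en F L" unfolding en_def by (rule means_energy_nonneg[OF pd that])
    ultimately show ?thesis by simp
  qed
  have "means M \<noteq> {}" using means.point[OF base_in] by blast
  from minimizing_sequence[of "means M" "en K", OF this means_nonneg] obtain I L where
    L: "\<And>n::nat. L n \<in> means M" and LI': "\<And>n. en K (L n) \<le> I + 1 / real (Suc n)" and I: "\<And>L. L \<in> means M \<Longrightarrow> I \<le> en K L"
    by blast
  define r where "r n = 1 / real (Suc n)" for n
  have LI: "en K (L n) \<le> I + r n" for n using LI' by (simp add: r_def)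
  \<comment> \<open>The midpoint of two means is a mean, so its energy is at least
    \<open>I\<close>.\<close>
  have par: "en K (\<lambda>h. L1 h - L2 h) \<le> 2 * (en K L1 - I) + 2 * (en K L2 - I)"
    if "L1 \<in> means M" "L2 \<in> means M" for L1 L2
  proof -
    have "en K (\<lambda>h. L1 h - L2 h) = 2 * en K L1 + 2 * en K L2 - 4 * en K (\<lambda>h. (L1 h + L2 h) / 2)"
      unfolding en_def using energy_parallelogram[OF that, of "\<lambda>x y. K (u x y) * u x y ^ N"] by simp
    then show ?thesis using I[OF means.mid[OF that]] by simp
  qed
  define push where "push g L' = (\<lambda>h. L' (\<lambda>x. h (g x)))" for g :: "'a \<Rightarrow> 'a" and L' :: "('a \<Rightarrow> real) \<Rightarrow> real"
  have push_means: "push g L' \<in> means M" if "isometry g" "L' \<in> means M" for g L'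
    unfolding push_def using means_push[OF that(2), of g] that(1) by (auto simp: isometry_def)
  have push_en: "en K (push g L') = en K L'" if "isometry g" "L' \<in> means M" for g L'
    unfolding en_def push_def
    by (intro means_cong[OF that(2)]) (simp add: isometry_u[OF that(1)])
  \<comment> \<open>The energy of a difference is the sum of its nonnegative energies for
    \<open>u ^ N\<close> and \<open>F * u ^ N\<close>, hence it bounds each of them; Cauchy-Schwarz
    transfers the bound to the averages.\<close>
  have key: "(L1 (\<lambda>x. G (u P x) * u R x ^ N) - L2 (\<lambda>x. G (u P x) * u R x ^ N))\<^sup>2
      \<le> (2 * (en K L1 - I) + 2 * (en K L2 - I)) * G 1"
    if G: "G = F \<or> G = (\<lambda>_. 1)" and LL: "L1 \<in> means M" "L2 \<in> means M" and PR: "P \<in> M" "R \<in> M" for G L1 L2 P R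
  proof -
    let ?D = "\<lambda>h. L1 h - L2 h"
    have pdG: "pos_def_on M (\<lambda>x y. G (u x y))" using G pd pos_def_const_1 by auto
    have sum: "en K ?D = en (\<lambda>_. 1) ?D + en F ?D"
      by (simp add: en_def K_def distrib_right means_add[OF LL(1)] means_add[OF LL(2)]
         means_diff[OF LL(1)] means_diff[OF LL(2)])
    have "0 \<le> en (\<lambda>_. 1) ?D" unfolding en_def
      by (rule diff_energy_nonneg[where F = "\<lambda>_. 1"]) (use pos_def_const_1 LL in auto)
    moreover have "0 \<le> en F ?D" unfolding en_def by (rule diff_energy_nonneg[OF pd LL])
    ultimately have "en G ?D \<le> en K ?D" using G sum by auto
    also have "\<dots> \<le> 2 * (en K L1 - I) + 2 * (en K L2 - I)" by (rule par[OF LL])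
    finally have "en G ?D * G 1 \<le> (2 * (en K L1 - I) + 2 * (en K L2 - I)) * G 1"
      using F1_nonneg[OF pdG] by (intro mult_right_mono)
    moreover have "(?D (\<lambda>x. G (u P x) * u R x ^ N))\<^sup>2 \<le> en G ?D * G 1"
      unfolding en_def by (rule diff_Cauchy_Schwarz[OF pdG LL PR])
    ultimately show ?thesis by linarith
  qed
  have conv: "convergent (\<lambda>n. L n (\<lambda>x. G (u P x) * u R x ^ N))"
    if G: "G = F \<or> G = (\<lambda>_. 1)" and PR: "P \<in> M" "R \<in> M" for G P R
  proof (rule convergent_if_square_bound)
    have G1: "G 1 \<ge> 0" using G F1_nonneg[OF pd] by auto
    then show "2 * G 1 \<ge> 0" by simp
    fix m n
    have "(L m (\<lambda>x. G (u P x) * u R x ^ N) - L n (\<lambda>x. G (u P x) * u R x ^ N))\<^sup>2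
       \<le> (2 * (en K (L m) - I) + 2 * (en K (L n) - I)) * G 1"
      by (rule key[OF G L L PR])
    also have "\<dots> \<le> (2 * r m + 2 * r n) * G 1"
      using LI[of m] LI[of n] G1 by (intro mult_right_mono) auto
    finally show "(L m (\<lambda>x. G (u P x) * u R x ^ N) - L n (\<lambda>x. G (u P x) * u R x ^ N))\<^sup>2
      \<le> 2 * G 1 * (1 / real (Suc m) + 1 / real (Suc n))"
      by (simp add: r_def distrib_left distrib_right mult_ac)
  qed
  define J where "J G P R = lim (\<lambda>n. L n (\<lambda>x. G (u P x) * u R x ^ N))" for G P R
  have lim: "(\<lambda>n. L n (\<lambda>x. G (u P x) * u R x ^ N)) \<longlonglongrightarrow> J G P R"
    if "G = F \<or> G = (\<lambda>_. 1)" "P \<in> M" "R \<in> M" for G P R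
    using conv[OF that] by (simp add: J_def convergent_LIMSEQ_iff)
  \<comment> \<open>Pushing by \<open>g\<close> preserves energies, so the pushed sequence is
    minimizing too and \<open>key\<close> forces the same limits.\<close>
  have inv: "J G (g P) (g R) = J G P R"
    if G: "G = F \<or> G = (\<lambda>_. 1)" and g: "isometry g" and PR: "P \<in> M" "R \<in> M" for G P R g
  proof -
    have G1: "G 1 \<ge> 0" using G F1_nonneg[OF pd] by auto
    have gP: "g P \<in> M" "g R \<in> M" using g PR by (auto intro: isometry_in)
    have "(\<lambda>n. push g (L n) (\<lambda>x. G (u (g P) x) * u (g R) x ^ N)) \<longlonglongrightarrow> J G (g P) (g R)"
    proof (rule tendsto_if_square_bound[OF _ lim[OF G gP]])
      fix n
      have "(L n (\<lambda>x. G (u (g P) x) * u (g R) x ^ N) - push g (L n) (\<lambda>x. G (u (g P) x) * u (g R) x ^ N))\<^sup>2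
         \<le> (2 * (en K (L n) - I) + 2 * (en K (push g (L n)) - I)) * G 1"
        by (rule key[OF G L push_means[OF g L] gP])
      also have "\<dots> \<le> (4 * r n) * G 1"
        using LI[of n] G1 push_en[OF g L[of n]] by (intro mult_right_mono) auto
      finally show "(L n (\<lambda>x. G (u (g P) x) * u (g R) x ^ N) - push g (L n) (\<lambda>x. G (u (g P) x) * u (g R) x ^ N))\<^sup>2
         \<le> (4 * G 1) * (1 / real (Suc n))" by (simp add: r_def mult_ac)
    qed
    moreover have "push g (L n) (\<lambda>x. G (u (g P) x) * u (g R) x ^ N) = L n (\<lambda>x. G (u P x) * u R x ^ N)" for n
      unfolding push_def by (intro means_cong[OF L]) (simp add: isometry_u[OF g] PR)
    ultimately show ?thesis using lim[OF G PR] LIMSEQ_unique by simp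
  qed
  have const: "J (\<lambda>_. 1) R R = J (\<lambda>_. 1) (\<nu> 1 0 0) (\<nu> 1 0 0)" if R: "R \<in> M" for R
  proof -
    obtain g where "isometry g" "g R = \<nu> 1 0 0" using hom_pair[OF R R] by metis
    then show ?thesis using inv[of "\<lambda>_. 1" g R R] R by simp
  qed
  show ?thesis
  proof (rule that[of L "J F" "J (\<lambda>_. 1) (\<nu> 1 0 0) (\<nu> 1 0 0)"])
    show "(\<lambda>n. L n (\<lambda>x. u R x ^ N)) \<longlonglongrightarrow> J (\<lambda>_. 1) (\<nu> 1 0 0) (\<nu> 1 0 0)" if "R \<in> M" for R
      using lim[of "\<lambda>_. 1" R R] const[OF that] that by simp
  qed (use L lim inv in auto)
qed

section \<open>Covers, concentration and polynomial approximants\<close>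

text \<open>Total boundedness: the features lie in a cube, a grid of width \<open>1 / K\<close> cuts
  it into finitely many cells, and \<open>C\<close> takes one point from every cell that meets
  \<open>M\<close>.\<close>

lemma finite_cover:
  assumes "\<delta> > 0"
  obtains C where "finite C" "C \<subseteq> M" "\<And>Q. Q \<in> M \<Longrightarrow> \<exists>R\<in>C. u R Q \<ge> 1 - \<delta>"
proof -
  \<comment> \<open>Within one cell each squared feature difference is at most \<open>1 / K\<close>,
    so \<open>2 - 2 * u\<close> is at most \<open>card A / K\<close>, which is to be at most
    \<open>2 * \<delta>\<close>.\<close>
  obtain K :: nat where K: "real K > real (card A) / (2 * \<delta>)" using reals_Archimedean2 by blast
  moreover have "real (card A) / (2 * \<delta>) \<ge> 0" using assms by simp
  ultimately have "real K > 0" by linarith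
  then have K1: "real K \<ge> 1" by simp
  define cell where "cell Q = (\<lambda>a\<in>A. \<lfloor>e a Q * real K\<rfloor>)" for Q
  have "cell ` M \<subseteq> (\<Pi>\<^sub>E a\<in>A. {- int K..int K})"
  proof (intro image_subsetI)
    fix Q assume Q: "Q \<in> M"
    show "cell Q \<in> (\<Pi>\<^sub>E a\<in>A. {- int K..int K})"
      unfolding cell_def
    proof (intro restrict_PiE_iff[THEN iffD2] ballI)
      fix a assume a: "a \<in> A"
      have "(e a Q)\<^sup>2 \<le> (\<Sum>a\<in>A. (e a Q)\<^sup>2)"
        by (rule member_le_sum[OF a]) (auto simp: finite_A)
      also have "\<dots> = 1" using u_self[OF Q] u_eq_sum[OF Q Q] by (simp add: power2_eq_square)
      finally have "\<bar>e a Q\<bar> \<le> 1" by (simp add: abs_square_le_1)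
      then have "\<bar>e a Q * real K\<bar> \<le> real K" by (simp add: abs_mult mult_left_le_one_le)
      then show "\<lfloor>e a Q * real K\<rfloor> \<in> {- int K..int K}" by (simp add: abs_le_iff le_floor_iff floor_le_iff)
    qed
  qed
  then have fin: "finite (cell ` M)" by (rule finite_subset) (simp add: finite_A finite_PiE)
  define C where "C = inv_into M cell ` (cell ` M)"
  show ?thesis
  proof (rule that[of C])
    show "finite C" "C \<subseteq> M" using fin by (auto simp: C_def intro: inv_into_into)
    fix Q assume Q: "Q \<in> M"
    define R where "R = inv_into M cell (cell Q)"
    have R: "R \<in> M" "R \<in> C" "cell R = cell Q"
      using Q by (auto simp: R_def C_def intro: inv_into_into f_inv_into_f)
    have "(e a R - e a Q)\<^sup>2 \<le> 1 / real K" if a: "a \<in> A" for a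
    proof -
      have "\<lfloor>e a R * real K\<rfloor> = \<lfloor>e a Q * real K\<rfloor>"
        using fun_cong[OF R(3), of a] a by (simp add: cell_def)
      then have "\<bar>e a R * real K - e a Q * real K\<bar> \<le> 1" by linarith
      then have "\<bar>e a R - e a Q\<bar> * real K \<le> 1" by (simp add: abs_mult left_diff_distrib[symmetric])
      then have *: "\<bar>e a R - e a Q\<bar> \<le> 1 / real K" using K1 by (simp add: field_simps)
      then have "\<bar>e a R - e a Q\<bar> \<le> 1" using K1 by (smt (verit) divide_le_eq_1)
      then have "\<bar>e a R - e a Q\<bar> * \<bar>e a R - e a Q\<bar> \<le> 1 * (1 / real K)" using * by (intro mult_mono) auto
      then show ?thesis by (simp add: power2_eq_square)
    qed
    then have "(\<Sum>a\<in>A. (e a R - e a Q)\<^sup>2) \<le> real (card A) * (1 / real K)" by (rule sum_bounded_above)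
    also have "\<dots> \<le> 2 * \<delta>" using K K1 assms by (simp add: field_simps)
    finally have "u R Q \<ge> 1 - \<delta>" using u_dist_sq[OF R(1) Q] by simp
    then show "\<exists>R\<in>C. u R Q \<ge> 1 - \<delta>" using R by blast
  qed
qed

end

text \<open>As \<open>sqrt s * sqrt (1 - s)\<close> squares to a polynomial, every power is a
  polynomial plus a polynomial multiple of this root, and \<open>\<sigma>\<close> acts as
  conjugation. Adding both signs leaves \<open>2 * poly p s\<close>.\<close>

lemma power_conjugate_split:
  fixes a b c :: real
  shows "\<exists>p q. degree p \<le> 2 * n \<and> degree q \<le> 2 * n \<and> (\<forall>s\<in>{0..1}. \<forall>\<sigma>\<in>{1, -1}.
     (a + b * s + \<sigma> * (c * (sqrt s * sqrt (1 - s)))) ^ n = poly p s + \<sigma> * (sqrt s * sqrt (1 - s) * poly q s))"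
proof (induction n)
  case 0
  show ?case by (rule exI[of _ 1], rule exI[of _ 0]) simp
next
  case (Suc n)
  then obtain p q where pq: "degree p \<le> 2 * n" "degree q \<le> 2 * n" and
    eq: "\<And>s \<sigma>. s \<in> {0..1} \<Longrightarrow> \<sigma> \<in> {1, -1} \<Longrightarrow> (a + b * s + \<sigma> * (c * (sqrt s * sqrt (1 - s)))) ^ n
       = poly p s + \<sigma> * (sqrt s * sqrt (1 - s) * poly q s)" by blast
  define p' where "p' = [:a, b:] * p + [:0, c, - c:] * q"
  define q' where "q' = [:a, b:] * q + smult c p"
  have d1: "degree [:a, b:] \<le> 1" and d2: "degree [:0, c, - c:] \<le> 2"
    by (simp_all add: degree_pCons_le)
  have d3: "degree (v * r) \<le> 2 * Suc n" if "degree v \<le> 2" "degree r \<le> 2 * n" for v r :: "real poly"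
    using order_trans[OF degree_mult_le add_mono[OF that]] by simp
  have "degree p' \<le> 2 * Suc n" unfolding p'_def
    using d1 by (intro degree_add_le d3 d2 pq) simp
  moreover have "degree q' \<le> 2 * Suc n" unfolding q'_def
    using d1 pq degree_smult_le[of c p] by (intro degree_add_le d3) auto
  moreover have "(a + b * s + \<sigma> * (c * (sqrt s * sqrt (1 - s)))) ^ Suc n
       = poly p' s + \<sigma> * (sqrt s * sqrt (1 - s) * poly q' s)" if s: "s \<in> {0..1}" and \<sigma>: "\<sigma> \<in> {1, -1}" for s \<sigma>
  proof -
    define t where "t = sqrt s * sqrt (1 - s)"
    have "t * t = (sqrt s * sqrt s) * (sqrt (1 - s) * sqrt (1 - s))"
      unfolding t_def by (simp only: mult_ac)
    also have "\<dots> = s * (1 - s)" using s by simp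
    finally have t2: "t * t = s * (1 - s)" .
    have \<sigma>2: "\<sigma> * \<sigma> = 1" using \<sigma> by auto
    have "(a + b * s + \<sigma> * (c * t)) ^ Suc n = (a + b * s + \<sigma> * (c * t)) * (poly p s + \<sigma> * (t * poly q s))"
      using eq[OF s \<sigma>] by (simp add: t_def)
    also have "\<dots> = (a + b * s) * poly p s + c * (\<sigma> * \<sigma>) * (t * t) * poly q s +
        \<sigma> * (t * ((a + b * s) * poly q s + c * poly p s))"
      by (simp add: algebra_simps)
    also have "\<dots> = poly p' s + \<sigma> * (t * poly q' s)"
      unfolding t2 \<sigma>2 by (simp add: p'_def q'_def algebra_simps)
    finally show ?thesis by (simp add: t_def)
  qed
  ultimately show ?case by blast
qed

context two_point_model
begin

text \<open>The two points have the same value \<open>s\<close> of \<open>u\<close> with the base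
  point, and adding them cancels the radical. The degree bound is uniform in \<open>L\<close>, as
  \<open>poly_limit\<close> requires.\<close>

lemma mean_even_poly:
  assumes "L \<in> means M"
  shows "\<exists>q. degree q \<le> 2 * N \<and> (\<forall>s\<in>{0..1}.
    L (\<lambda>x. w x * u (\<nu> (sqrt s) 0 (sqrt (1 - s))) x ^ N) +
    L (\<lambda>x. w x * u (\<nu> (sqrt s) 0 (- sqrt (1 - s))) x ^ N) = poly q s)"
  using assms
proof (induction rule: means.induct)
  case (point x)
  obtain s1 s2 s3 s4 s5 s6 where *: "\<And>a b c. a\<^sup>2 + b\<^sup>2 + c\<^sup>2 = 1 \<Longrightarrow> u x (\<nu> a b c) =
     s1 * a\<^sup>2 + s2 * b\<^sup>2 + s3 * c\<^sup>2 + s4 * (a * b) + s5 * (a * c) + s6 * (b * c)"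
    using u_nu_quadratic[OF point] by blast
  obtain p q where p: "degree p \<le> 2 * N" and
    eq: "\<And>s \<sigma>. s \<in> {0..1} \<Longrightarrow> \<sigma> \<in> {1, -1} \<Longrightarrow> (s3 + (s1 - s3) * s + \<sigma> * (s5 * (sqrt s * sqrt (1 - s)))) ^ N
       = poly p s + \<sigma> * (sqrt s * sqrt (1 - s) * poly q s)"
    using power_conjugate_split[of N s3 "s1 - s3" s5] by blast
  have u: "u (\<nu> (sqrt s) 0 (\<sigma> * sqrt (1 - s))) x = s3 + (s1 - s3) * s + \<sigma> * (s5 * (sqrt s * sqrt (1 - s)))"
    if "s \<in> {0..1}" "\<sigma> \<in> {1, -1}" for s \<sigma>
  proof -
    have 1: "(sqrt s)\<^sup>2 + 0\<^sup>2 + (\<sigma> * sqrt (1 - s))\<^sup>2 = 1" using that by auto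
    have 2: "(\<sigma> * sqrt (1 - s))\<^sup>2 = 1 - s" using that by auto
    show ?thesis using u_sym[OF nu_in[OF 1] point] *[OF 1] that unfolding 2 by (simp add: algebra_simps)
  qed
  show ?case
  proof (intro exI[of _ "smult (2 * w x) p"] conjI ballI)
    show "degree (smult (2 * w x) p) \<le> 2 * N" using p degree_smult_le le_trans by blast
    fix s :: real assume s: "s \<in> {0..1}"
    show "w x * u (\<nu> (sqrt s) 0 (sqrt (1 - s))) x ^ N + w x * u (\<nu> (sqrt s) 0 (- sqrt (1 - s))) x ^ N
       = poly (smult (2 * w x) p) s"
    proof -
      define y where "y \<sigma> = u (\<nu> (sqrt s) 0 (\<sigma> * sqrt (1 - s))) x" for \<sigma>
      have "y \<sigma> ^ N = poly p s + \<sigma> * (sqrt s * sqrt (1 - s) * poly q s)" if "\<sigma> \<in> {1, -1}" for \<sigma>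
        using u[OF s that] eq[OF s that] by (simp add: y_def)
      from this[of 1] this[of "-1"] have "y 1 ^ N + y (-1) ^ N = 2 * poly p s" by simp
      then show ?thesis by (simp add: y_def flip: distrib_left)
    qed
  qed
next
  case (mid L L')
  then obtain q q' where "degree q \<le> 2 * N" "degree q' \<le> 2 * N" and
    **: "\<And>s. s\<in>{0..1} \<Longrightarrow> L (\<lambda>x. w x * u (\<nu> (sqrt s) 0 (sqrt (1 - s))) x ^ N) +
    L (\<lambda>x. w x * u (\<nu> (sqrt s) 0 (- sqrt (1 - s))) x ^ N) = poly q s"
    "\<And>s. s\<in>{0..1} \<Longrightarrow> L' (\<lambda>x. w x * u (\<nu> (sqrt s) 0 (sqrt (1 - s))) x ^ N) +
    L' (\<lambda>x. w x * u (\<nu> (sqrt s) 0 (- sqrt (1 - s))) x ^ N) = poly q' s" by blast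
  then show ?case
    by (intro exI[of _ "smult (1/2) (q + q')"]) (auto intro!: degree_add_le simp: field_simps simp flip: **)
qed

lemma invariant_pair_function:
  assumes inv: "\<And>g P R. isometry g \<Longrightarrow> P \<in> M \<Longrightarrow> R \<in> M \<Longrightarrow> J (g P) (g R) = (J P R :: real)"
    and "P \<in> M" "R \<in> M"
  shows "J P R = J (\<nu> 1 0 0) (\<nu> (sqrt (u P R)) 0 (sqrt (1 - u P R)))"
  using hom_pair[OF assms(2,3)] inv[OF _ assms(2,3)] by metis

text \<open>The limiting average \<open>J N P R\<close> plays the part of the convolution of
  \<open>F (u P x)\<close> with \<open>u R x ^ N\<close>, and \<open>\<beta> N\<close> that of the
  total mass of the latter. By invariance \<open>J N P R\<close> depends on \<open>u P R\<close>
  only; its normalization \<open>h N\<close> supplies the polynomials.\<close>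

lemma polynomial_approximation:
  assumes pd: "pos_def_on M (\<lambda>x y. F (u x y))" and cont: "continuous_on {0..1} F"
    and S: "finite S" "S \<subseteq> M" and ann: "\<And>R. R \<in> M \<Longrightarrow> (\<Sum>x\<in>S. c x * F (u x R)) = 0"
  shows "\<exists>j. (\<forall>s\<in>{0..1}. (\<lambda>N. poly (j N) s) \<longlonglongrightarrow> F s) \<and>
    (\<forall>N. \<forall>R\<in>M. (\<Sum>x\<in>S. c x * poly (j N) (u x R)) = 0)"
proof -
  define lims where "lims N L J \<beta> \<longleftrightarrow> (\<forall>n::nat. L n \<in> means M) \<and>
     (\<forall>P\<in>M. \<forall>R\<in>M. (\<lambda>n. L n (\<lambda>x. F (u P x) * u R x ^ N)) \<longlonglongrightarrow> J P R) \<and>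
     (\<forall>R\<in>M. (\<lambda>n. L n (\<lambda>x. u R x ^ N)) \<longlonglongrightarrow> \<beta>) \<and>
     (\<forall>g P R. isometry g \<longrightarrow> P \<in> M \<longrightarrow> R \<in> M \<longrightarrow> J (g P) (g R) = J P R)" for N L J \<beta>
  have "\<exists>L J \<beta>. lims N L J \<beta>" for N
  proof (rule invariant_mean[OF pd, of N])
    fix L J \<beta>
    assume *: "\<And>n::nat. L n \<in> means M"
      "\<And>P R. P \<in> M \<Longrightarrow> R \<in> M \<Longrightarrow> (\<lambda>n. L n (\<lambda>x. F (u P x) * u R x ^ N)) \<longlonglongrightarrow> J P R"
      "\<And>R. R \<in> M \<Longrightarrow> (\<lambda>n. L n (\<lambda>x. u R x ^ N)) \<longlonglongrightarrow> \<beta>"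
      "\<And>g P R. isometry g \<Longrightarrow> P \<in> M \<Longrightarrow> R \<in> M \<Longrightarrow> J (g P) (g R) = J P R"
    show ?thesis
      by (rule exI[of _ L], rule exI[of _ J], rule exI[of _ \<beta>], unfold lims_def) (intro conjI allI ballI impI *)
  qed
  then obtain L J \<beta> where lims: "\<And>N. lims N (L N) (J N) (\<beta> N)" by metis
  have L: "\<And>N n. L N n \<in> means M"
    and J: "\<And>N P R. P \<in> M \<Longrightarrow> R \<in> M \<Longrightarrow> (\<lambda>n. L N n (\<lambda>x. F (u P x) * u R x ^ N)) \<longlonglongrightarrow> J N P R"
    and \<beta>: "\<And>N R. R \<in> M \<Longrightarrow> (\<lambda>n. L N n (\<lambda>x. u R x ^ N)) \<longlonglongrightarrow> \<beta> N"
    and inv: "\<And>N g P R. isometry g \<Longrightarrow> P \<in> M \<Longrightarrow> R \<in> M \<Longrightarrow> J N (g P) (g R) = J N P R"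
    using lims by (auto simp: lims_def)
  \<comment> \<open>Every point is near some point of \<open>C\<close>, and all points of
    \<open>C\<close> have the same limiting mass. Hence \<open>\<beta> N\<close> decays no faster
    than \<open>(1 - \<delta>) ^ N\<close> up to a constant, which beats the far contribution
    \<open>(1 - 2 * \<delta>) ^ N\<close> below.\<close>
  have mass: "(1 - \<delta>) ^ N \<le> real (card C) * \<beta> N"
    if C: "finite C" "C \<subseteq> M" "\<And>Q. Q \<in> M \<Longrightarrow> \<exists>R\<in>C. u R Q \<ge> 1 - \<delta>" and \<delta>: "\<delta> \<le> 1" for N \<delta> C
  proof (rule LIMSEQ_le_const)
    show "(\<lambda>n. \<Sum>R\<in>C. L N n (\<lambda>x. u R x ^ N)) \<longlonglongrightarrow> real (card C) * \<beta> N"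
      using tendsto_sum[of C "\<lambda>R n. L N n (\<lambda>x. u R x ^ N)" "\<lambda>_. \<beta> N" sequentially] \<beta> C by auto
    have "(1 - \<delta>) ^ N \<le> (\<Sum>R\<in>C. L N n (\<lambda>x. u R x ^ N))" for n
    proof -
      have "(1 - \<delta>) ^ N = L N n (\<lambda>x. (1 - \<delta>) ^ N)" by (simp add: means_const[OF L])
      also have "\<dots> \<le> L N n (\<lambda>x. \<Sum>R\<in>C. u R x ^ N)"
      proof (rule means_mono[OF L])
        fix x assume x: "x \<in> M"
        obtain R where R: "R \<in> C" "u R x \<ge> 1 - \<delta>" using C(3)[OF x] by blast
        then have "(1 - \<delta>) ^ N \<le> u R x ^ N" using \<delta> by (intro power_mono) auto
        also have "\<dots> \<le> (\<Sum>R\<in>C. u R x ^ N)"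
          using C x R by (intro member_le_sum) (auto intro!: zero_le_power u_nonneg)
        finally show "(1 - \<delta>) ^ N \<le> (\<Sum>R\<in>C. u R x ^ N)" .
      qed
      also have "\<dots> = (\<Sum>R\<in>C. L N n (\<lambda>x. u R x ^ N))" by (rule means_sum[OF L])
      finally show ?thesis .
    qed
    then show "\<exists>K. \<forall>n\<ge>K. (1 - \<delta>) ^ N \<le> (\<Sum>R\<in>C. L N n (\<lambda>x. u R x ^ N))" by blast
  qed
  have \<beta>_pos: "\<beta> N > 0" for N
  proof -
    obtain C where C: "finite C" "C \<subseteq> M" "\<And>Q. Q \<in> M \<Longrightarrow> \<exists>R\<in>C. u R Q \<ge> 1 - 1/2"
      using finite_cover[of "1/2"] by auto
    have "0 < (1 - 1/2 :: real) ^ N" by simp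
    also have "\<dots> \<le> real (card C) * \<beta> N" by (rule mass[OF C]) auto
    finally show ?thesis by (simp add: zero_less_mult_iff)
  qed
  have "bounded (F ` {0..1})"
    using compact_continuous_image[OF cont compact_Icc] by (rule compact_imp_bounded)
  then obtain B where B: "\<And>s. s \<in> {0..1} \<Longrightarrow> \<bar>F s\<bar> \<le> B"
    unfolding bounded_iff real_norm_def by blast
  have "B \<ge> 0" using B[of 0] by simp
  define h where "h N s = J N (\<nu> 1 0 0) (\<nu> (sqrt s) 0 (sqrt (1 - s))) / \<beta> N" for N s
  have Jh: "J N P R = \<beta> N * h N (u P R)" if "P \<in> M" "R \<in> M" for N P R
    using invariant_pair_function[of "J N", OF inv that] \<beta>_pos[of N] by (simp add: h_def)
  have conv: "(\<lambda>N. h N s) \<longlonglongrightarrow> F s" if s: "s \<in> {0..1}" for s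
  proof -
    define P where "P = \<nu> 1 0 0"
    define R where "R = \<nu> (sqrt s) 0 (sqrt (1 - s))"
    have PR: "P \<in> M" "R \<in> M" "u P R = s"
      using s by (auto simp: P_def R_def u_base intro: nu_in)
    show ?thesis
    proof (rule LIMSEQ_I)
      fix \<epsilon> :: real assume "\<epsilon> > 0"
      then obtain \<eta> where \<eta>: "\<eta> > 0" "\<And>t. t \<in> {0..1} \<Longrightarrow> \<bar>t - s\<bar> < \<eta> \<Longrightarrow> \<bar>F t - F s\<bar> < \<epsilon> / 2"
        using cont s unfolding continuous_on_iff dist_real_def by (meson half_gt_zero)
      \<comment> \<open>Where \<open>u R x \<ge> 1 - 2 * \<delta>\<close>,
        \<open>u_lipschitz\<close> gives
        \<open>(u P x - s)\<^sup>2 \<le> 4 * \<delta> < \<eta>\<^sup>2\<close>. The cap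
        \<open>1/4\<close> keeps \<open>1 - 2 * \<delta>\<close> positive.\<close>
      define \<delta> where "\<delta> = min (1/4) (\<eta>\<^sup>2 / 8)"
      have \<delta>: "\<delta> > 0" "\<delta> \<le> 1/4" "4 * \<delta> < \<eta>\<^sup>2" using \<eta>(1) by (auto simp: \<delta>_def min_def)
      obtain C where C: "finite C" "C \<subseteq> M" "\<And>Q. Q \<in> M \<Longrightarrow> \<exists>R\<in>C. u R Q \<ge> 1 - \<delta>"
        using finite_cover[OF \<delta>(1)] by auto
      have est: "\<bar>J N P R - F s * \<beta> N\<bar> \<le> \<epsilon> / 2 * \<beta> N + 2 * B * (1 - 2 * \<delta>) ^ N" for N
      proof -
        have pt: "\<bar>F (u P x) * u R x ^ N - F s * u R x ^ N\<bar> \<le> \<epsilon> / 2 * u R x ^ N + 2 * B * (1 - 2 * \<delta>) ^ N"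
          if x: "x \<in> M" for x
        proof -
          have ux: "u P x \<in> {0..1}" "u R x \<in> {0..1}" using PR x u_nonneg u_le_1 by auto
          have eq: "\<bar>F (u P x) * u R x ^ N - F s * u R x ^ N\<bar> = \<bar>F (u P x) - F s\<bar> * u R x ^ N"
            using ux by (simp add: abs_mult left_diff_distrib[symmetric])
          show ?thesis
          proof (cases "u R x \<ge> 1 - 2 * \<delta>")
            case True
            have "(u P x - u P R)\<^sup>2 \<le> 2 - 2 * u x R" by (rule u_lipschitz[OF PR(1) x PR(2)])
            also have "\<dots> < \<eta>\<^sup>2" using True \<delta> u_sym[OF x PR(2)] by simp
            finally have "\<bar>u P x - s\<bar> < \<eta>"
              using \<eta>(1) PR(3) power_less_imp_less_base[of "\<bar>u P x - s\<bar>" 2 \<eta>] by simp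
            then have "\<bar>F (u P x) - F s\<bar> \<le> \<epsilon> / 2" using \<eta>(2) ux by force
            then have "\<bar>F (u P x) - F s\<bar> * u R x ^ N \<le> \<epsilon> / 2 * u R x ^ N"
              using ux by (intro mult_right_mono) auto
            moreover have "0 \<le> 2 * B * (1 - 2 * \<delta>) ^ N" using \<open>B \<ge> 0\<close> \<delta> by simp
            ultimately show ?thesis unfolding eq by linarith
          next
            case False
            have "\<bar>F (u P x) - F s\<bar> \<le> 2 * B" using B[OF ux(1)] B[OF s] by linarith
            moreover have "u R x ^ N \<le> (1 - 2 * \<delta>) ^ N" using False ux by (intro power_mono) auto
            ultimately have "\<bar>F (u P x) - F s\<bar> * u R x ^ N \<le> 2 * B * (1 - 2 * \<delta>) ^ N"
              using ux \<open>B \<ge> 0\<close> by (intro mult_mono) auto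
            moreover have "0 \<le> \<epsilon> / 2 * u R x ^ N" using ux \<open>\<epsilon> > 0\<close> by simp
            ultimately show ?thesis unfolding eq by linarith
          qed
        qed
        have "\<bar>L N n (\<lambda>x. F (u P x) * u R x ^ N) - F s * L N n (\<lambda>x. u R x ^ N)\<bar>
            \<le> \<epsilon> / 2 * L N n (\<lambda>x. u R x ^ N) + 2 * B * (1 - 2 * \<delta>) ^ N" for n
        proof -
          let ?l = "\<lambda>x. F (u P x) * u R x ^ N - F s * u R x ^ N"
          let ?r = "\<lambda>x. \<epsilon> / 2 * u R x ^ N + 2 * B * (1 - 2 * \<delta>) ^ N"
          have l: "L N n ?l = L N n (\<lambda>x. F (u P x) * u R x ^ N) - F s * L N n (\<lambda>x. u R x ^ N)"
            by (simp add: means_diff[OF L] means_cmult[OF L])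
          have r: "L N n ?r = \<epsilon> / 2 * L N n (\<lambda>x. u R x ^ N) + 2 * B * (1 - 2 * \<delta>) ^ N"
            by (simp only: means_add[OF L] means_cmult[OF L] means_const[OF L])
          have "L N n ?l \<le> L N n ?r" by (rule means_mono[OF L]) (use pt in \<open>simp add: abs_le_iff\<close>)
          moreover have "L N n (\<lambda>x. (-1) * ?r x) \<le> L N n ?l"
            by (rule means_mono[OF L]) (use pt in \<open>fastforce simp: abs_le_iff\<close>)
          then have "- L N n ?r \<le> L N n ?l" by (simp only: means_cmult[OF L])
          ultimately show ?thesis unfolding l r by (simp add: abs_le_iff)
        qed
        moreover have "(\<lambda>n. \<bar>L N n (\<lambda>x. F (u P x) * u R x ^ N) - F s * L N n (\<lambda>x. u R x ^ N)\<bar>)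
           \<longlonglongrightarrow> \<bar>J N P R - F s * \<beta> N\<bar>"
          by (intro tendsto_intros J \<beta> PR)
        moreover have "(\<lambda>n. \<epsilon> / 2 * L N n (\<lambda>x. u R x ^ N) + 2 * B * (1 - 2 * \<delta>) ^ N)
           \<longlonglongrightarrow> \<epsilon> / 2 * \<beta> N + 2 * B * (1 - 2 * \<delta>) ^ N"
          by (intro tendsto_intros J \<beta> PR)
        ultimately show ?thesis by (blast intro: LIMSEQ_le)
      qed
      define q where "q = (1 - 2 * \<delta>) / (1 - \<delta>)"
      have q: "0 \<le> q" "q < 1" using \<delta> by (auto simp: q_def)
      have bound: "\<bar>h N s - F s\<bar> \<le> \<epsilon> / 2 + 2 * B * real (card C) * q ^ N" for N
      proof -
        have "J N P R - F s * \<beta> N = \<beta> N * (h N s - F s)"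
          using Jh[OF PR(1,2), of N] PR(3) by (simp add: algebra_simps)
        then have "\<beta> N * \<bar>h N s - F s\<bar> = \<bar>J N P R - F s * \<beta> N\<bar>"
          using \<beta>_pos[of N] by (simp add: abs_mult)
        also have "\<dots> \<le> \<epsilon> / 2 * \<beta> N + 2 * B * (1 - 2 * \<delta>) ^ N" by (rule est)
        also have "(1 - 2 * \<delta>) ^ N = q ^ N * (1 - \<delta>) ^ N"
          using \<delta> by (simp add: q_def power_divide)
        also have "\<epsilon> / 2 * \<beta> N + 2 * B * (q ^ N * (1 - \<delta>) ^ N) \<le>
           \<epsilon> / 2 * \<beta> N + 2 * B * (q ^ N * (real (card C) * \<beta> N))"
          using \<delta> q \<open>B \<ge> 0\<close> by (intro add_left_mono mult_left_mono mass[OF C]) auto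
        also have "\<dots> = \<beta> N * (\<epsilon> / 2 + 2 * B * real (card C) * q ^ N)" by (simp add: algebra_simps)
        finally show ?thesis using \<beta>_pos[of N] by simp
      qed
      have "(\<lambda>N. 2 * B * real (card C) * q ^ N) \<longlonglongrightarrow> 0"
        using q by (intro tendsto_mult_right_zero LIMSEQ_realpow_zero)
      then have "\<forall>\<^sub>F N in sequentially. 2 * B * real (card C) * q ^ N < \<epsilon> / 2"
        using \<open>\<epsilon> > 0\<close> by (intro order_tendstoD(2)) auto
      then obtain N0 where "\<And>N. N \<ge> N0 \<Longrightarrow> 2 * B * real (card C) * q ^ N < \<epsilon> / 2"
        by (auto simp: eventually_sequentially)
      then show "\<exists>N0. \<forall>N\<ge>N0. norm (h N s - F s) < \<epsilon>"
        using bound by (intro exI[of _ N0]) (fastforce intro: le_less_trans)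
    qed
  qed
  have "\<exists>p. \<forall>s\<in>{0..1}. h N s = poly p s" for N
  proof -
    \<comment> \<open>The symmetrized average. Both summands tend to
      \<open>\<beta> N * h N s\<close>, whence the factor 2 below.\<close>
    let ?a = "\<lambda>n s. L N n (\<lambda>x. F (u (\<nu> 1 0 0) x) * u (\<nu> (sqrt s) 0 (sqrt (1 - s))) x ^ N) +
      L N n (\<lambda>x. F (u (\<nu> 1 0 0) x) * u (\<nu> (sqrt s) 0 (- sqrt (1 - s))) x ^ N)"
    have "\<exists>q. degree q \<le> 2 * N \<and> (\<forall>s\<in>{0..1}. ?a n s = poly q s)" for n
      by (rule mean_even_poly[OF L])
    then have "\<exists>q. \<forall>n. degree (q n) \<le> 2 * N \<and> (\<forall>s\<in>{0..1}. ?a n s = poly (q n) s)"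
      by (intro choice allI)
    then obtain q where q: "\<And>n. degree (q n) \<le> 2 * N" "\<And>n s. s \<in> {0..1} \<Longrightarrow> ?a n s = poly (q n) s"
      by blast
    have "\<exists>p. \<forall>s\<in>{0..1}. 2 * \<beta> N * h N s = poly p s"
    proof (rule poly_limit[OF _ q(1)])
      show "infinite {0..1::real}" by simp
      fix s :: real assume s: "s \<in> {0..1}"
      have in1: "\<nu> (sqrt s) 0 (sqrt (1 - s)) \<in> M" "\<nu> (sqrt s) 0 (- sqrt (1 - s)) \<in> M"
        using s by (auto intro: nu_in)
      have u2: "u (\<nu> 1 0 0) (\<nu> (sqrt s) 0 (- sqrt (1 - s))) = s" "u (\<nu> 1 0 0) (\<nu> (sqrt s) 0 (sqrt (1 - s))) = s"
        using s by (auto simp: u_base u_nu_nu)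
      have "(\<lambda>n. ?a n s) \<longlonglongrightarrow> J N (\<nu> 1 0 0) (\<nu> (sqrt s) 0 (sqrt (1 - s))) + J N (\<nu> 1 0 0) (\<nu> (sqrt s) 0 (- sqrt (1 - s)))"
        by (intro tendsto_add J base_in in1)
      also have "J N (\<nu> 1 0 0) (\<nu> (sqrt s) 0 (sqrt (1 - s))) + J N (\<nu> 1 0 0) (\<nu> (sqrt s) 0 (- sqrt (1 - s))) = 2 * \<beta> N * h N s"
        using Jh[OF base_in in1(1), of N] Jh[OF base_in in1(2), of N] by (simp add: u2)
      finally show "(\<lambda>n. poly (q n) s) \<longlonglongrightarrow> 2 * \<beta> N * h N s" using q(2)[OF s] by simp
    qed
    then obtain p where "\<forall>s\<in>{0..1}. 2 * \<beta> N * h N s = poly p s" ..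
    then show ?thesis using \<beta>_pos[of N] by (intro exI[of _ "smult (1 / (2 * \<beta> N)) p"]) (auto simp: field_simps)
  qed
  then obtain j where j: "\<And>N s. s \<in> {0..1} \<Longrightarrow> h N s = poly (j N) s" by metis
  show ?thesis
  proof (intro exI[of _ j] conjI ballI allI)
    show "(\<lambda>N. poly (j N) s) \<longlonglongrightarrow> F s" if "s \<in> {0..1}" for s
      using conv[OF that] j[OF that] by simp
    fix N R assume R: "R \<in> M"
    have "(\<lambda>n. \<Sum>x\<in>S. c x * L N n (\<lambda>Q. F (u x Q) * u R Q ^ N)) \<longlonglongrightarrow> (\<Sum>x\<in>S. c x * J N x R)"
      using S R by (intro tendsto_sum tendsto_mult_left J) auto
    \<comment> \<open>The relation for \<open>F\<close> holds at every \<open>Q\<close>, hence also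
      after weighting by \<open>u R Q ^ N\<close> and averaging.\<close>
    moreover have "(\<Sum>x\<in>S. c x * L N n (\<lambda>Q. F (u x Q) * u R Q ^ N)) = 0" for n
    proof -
      have "(\<Sum>x\<in>S. c x * L N n (\<lambda>Q. F (u x Q) * u R Q ^ N)) =
          L N n (\<lambda>Q. \<Sum>x\<in>S. c x * (F (u x Q) * u R Q ^ N))"
        by (simp only: means_sum[OF L] means_cmult[OF L])
      also have "\<dots> = L N n (\<lambda>Q. 0)"
      proof (rule means_cong[OF L])
        fix Q assume "Q \<in> M"
        have "(\<Sum>x\<in>S. c x * (F (u x Q) * u R Q ^ N)) = (\<Sum>x\<in>S. c x * F (u x Q)) * u R Q ^ N"
          by (simp add: sum_distrib_right mult.assoc)
        then show "(\<Sum>x\<in>S. c x * (F (u x Q) * u R Q ^ N)) = 0" using ann[OF \<open>Q \<in> M\<close>] by simp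
      qed
      finally show ?thesis by (simp add: means_const[OF L])
    qed
    ultimately have "(\<Sum>x\<in>S. c x * J N x R) = 0" by (simp add: LIMSEQ_const_iff)
    also have "(\<Sum>x\<in>S. c x * J N x R) = \<beta> N * (\<Sum>x\<in>S. c x * poly (j N) (u x R))"
    proof -
      have "c x * J N x R = \<beta> N * (c x * poly (j N) (u x R))" if "x \<in> S" for x
        using that S R Jh[of x R N] j[of "u x R" N] u_nonneg[of x R] u_le_1[of x R] by auto
      then show ?thesis unfolding sum_distrib_left by (rule sum.cong[OF refl])
    qed
    finally show "(\<Sum>x\<in>S. c x * poly (j N) (u x R)) = 0" using \<beta>_pos[of N] by simp
  qed
qed

end

section \<open>Geodesic circles through the base point and the degree bound\<close>

lemma cos_diff_squared_less_1:
  fixes x y :: real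
  assumes "x \<in> {0<..<pi}" "y \<in> {0<..<pi}" "x \<noteq> y"
  shows "(cos (x - y))\<^sup>2 < 1"
proof -
  have "sin (y - x) = - sin (x - y)" using sin_minus[of "x - y"] by simp
  then have "sin (x - y) \<noteq> 0"
    using assms sin_gt_zero[of "x - y"] sin_gt_zero[of "y - x"] by (cases "x < y") auto
  then have "(sin (x - y))\<^sup>2 > 0" by simp
  then show ?thesis by (simp add: cos_squared_eq)
qed

context two_point_model
begin

text \<open>The geodesic through the base point in direction \<open>t\<close> of the embedded plane.
  Opposite unit vectors give the same point, so it closes after \<open>\<theta> = pi\<close>, and
  \<open>u\<close> along it is a function of \<open>2 * \<theta>\<close>.\<close>

definition circ :: "real \<Rightarrow> real \<Rightarrow> 'a" where
  "circ t \<theta> = \<nu> (cos \<theta>) (sin \<theta> * cos t) (sin \<theta> * sin t)"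

lemma circ_unit: "(cos \<theta>)\<^sup>2 + (sin \<theta> * cos t)\<^sup>2 + (sin \<theta> * sin t)\<^sup>2 = (1::real)"
proof -
  have "(sin \<theta> * cos t)\<^sup>2 + (sin \<theta> * sin t)\<^sup>2 = (sin \<theta>)\<^sup>2 * ((cos t)\<^sup>2 + (sin t)\<^sup>2)"
    by (simp only: power_mult_distrib distrib_left)
  then show ?thesis by (simp add: add.assoc)
qed

lemma circ_in: "circ t \<theta> \<in> M"
  unfolding circ_def by (rule nu_in[OF circ_unit])

lemma u_circ: "u (circ t \<theta>) (circ t' \<theta>') = (cos \<theta> * cos \<theta>' + sin \<theta> * sin \<theta>' * cos (t - t'))\<^sup>2"
  unfolding circ_def by (subst u_nu_nu[OF circ_unit circ_unit]) (simp add: cos_diff algebra_simps)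

lemma u_base_circ: "u (\<nu> 1 0 0) (circ t \<theta>) = (cos \<theta>)\<^sup>2"
  unfolding circ_def by (subst u_nu_nu[OF _ circ_unit]) auto

lemma circ_expansion:
  assumes "P \<in> M"
  shows "\<exists>a b c. \<forall>\<theta>. u P (circ t \<theta>) = a + b * cos (2 * \<theta>) + c * sin (2 * \<theta>)"
proof -
  obtain s1 s2 s3 s4 s5 s6 where s: "\<And>x y z. x\<^sup>2 + y\<^sup>2 + z\<^sup>2 = 1 \<Longrightarrow>
     u P (\<nu> x y z) = s1 * x\<^sup>2 + s2 * y\<^sup>2 + s3 * z\<^sup>2 + s4 * (x * y) + s5 * (x * z) + s6 * (y * z)"
    using u_nu_quadratic[OF assms] by blast
  define k where "k = s2 * (cos t)\<^sup>2 + s3 * (sin t)\<^sup>2 + s6 * (cos t * sin t)"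
  define l where "l = s4 * cos t + s5 * sin t"
  have "u P (circ t \<theta>) = (s1 + k) / 2 + (s1 - k) / 2 * cos (2 * \<theta>) + l / 2 * sin (2 * \<theta>)" for \<theta>
  proof -
    have c: "cos (2 * \<theta>) = 2 * (cos \<theta>)\<^sup>2 - 1" and s2: "(sin \<theta>)\<^sup>2 = 1 - (cos \<theta>)\<^sup>2"
      by (simp_all add: cos_double_cos sin_squared_eq)
    have "u P (circ t \<theta>) = s1 * (cos \<theta>)\<^sup>2 + k * (sin \<theta>)\<^sup>2 + l * (sin \<theta> * cos \<theta>)"
      unfolding circ_def s[OF circ_unit] k_def l_def by (simp add: power2_eq_square algebra_simps)
    then show ?thesis unfolding c s2 sin_double by (simp add: algebra_simps add_divide_distrib diff_divide_distrib)
  qed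
  then show ?thesis by blast
qed

text \<open>Along the circle \<open>u P\<close> swings between \<open>a - \<rho>\<close> and
  \<open>a + \<rho>\<close>. The lower end is at least 0, and the upper end is below 1, since the
  value 1 would put \<open>P\<close> on the circle.\<close>

lemma circ_amplitude:
  assumes P: "P \<in> M" and eq: "\<And>\<theta>. u P (circ t \<theta>) = a + b * cos (2 * \<theta>) + c * sin (2 * \<theta>)"
    and off: "\<And>\<theta>. P \<noteq> circ t \<theta>"
  shows "b\<^sup>2 + c\<^sup>2 < 1 / 4"
proof -
  define \<rho> where "\<rho> = sqrt (b\<^sup>2 + c\<^sup>2)"
  have \<rho>2: "\<rho>\<^sup>2 = b\<^sup>2 + c\<^sup>2" by (simp add: \<rho>_def)
  have "\<exists>\<phi>. b * cos \<phi> + c * sin \<phi> = \<rho>"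
  proof (cases "\<rho> = 0")
    case True
    then have "b = 0" "c = 0" using \<rho>2 by (auto simp: sum_power2_eq_zero_iff)
    then show ?thesis using True by simp
  next
    case False
    have "(b / \<rho>)\<^sup>2 + (c / \<rho>)\<^sup>2 = 1" 
      unfolding power_divide \<rho>2[symmetric] add_divide_distrib[symmetric] using False by simp
    then obtain \<phi> where \<phi>: "b / \<rho> = cos \<phi>" "c / \<rho> = sin \<phi>" using sincos_total_2pi by metis
    have "b * cos \<phi> + c * sin \<phi> = (b\<^sup>2 + c\<^sup>2) / \<rho>"
      unfolding \<phi>[symmetric] by (simp add: power2_eq_square add_divide_distrib)
    also have "\<dots> = \<rho>" using False unfolding \<rho>2[symmetric] by (simp add: power2_eq_square)
    finally show ?thesis ..
  qed
  then obtain \<phi> where \<phi>: "b * cos \<phi> + c * sin \<phi> = \<rho>" ..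
  have 1: "u P (circ t (\<phi> / 2)) = a + \<rho>" using \<phi> by (simp add: eq)
  have 2: "2 * ((\<phi> + pi) / 2) = \<phi> + pi" by simp
  have "u P (circ t ((\<phi> + pi) / 2)) = a - \<rho>"
    unfolding eq 2 cos_periodic_pi sin_periodic_pi using \<phi> by simp
  then have "a - \<rho> \<ge> 0" using u_nonneg[OF P circ_in] by metis
  moreover have "a + \<rho> < 1"
    using u_le_1[OF P circ_in[of t "\<phi> / 2"]] u_eq_1D[OF P circ_in[of t "\<phi> / 2"]] off[of "\<phi> / 2"] 1 by fastforce
  ultimately have "\<rho> < 1 / 2" by simp
  then have "\<rho>\<^sup>2 < (1 / 2)\<^sup>2" by (intro power_strict_mono) (auto simp: \<rho>_def)
  then show ?thesis by (simp add: \<rho>2 power_divide)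
qed

text \<open>Circles with distinct directions in \<open>{0<..<pi}\<close> meet only in the base
  point, so each point of \<open>S\<close> excludes at most one direction.\<close>

lemma circ_avoiding:
  assumes "finite S" "\<nu> 1 0 0 \<notin> S" "S \<subseteq> M"
  obtains t where "\<And>P \<theta>. P \<in> S \<Longrightarrow> P \<noteq> circ t \<theta>"
proof -
  define bad where "bad P = {t \<in> {0<..<pi}. \<exists>\<theta>. P = circ t \<theta>}" for P
  have "finite (bad P)" if P: "P \<in> S" for P
  proof -
    have "t = t'" if bad: "t \<in> bad P" "t' \<in> bad P" for t t'
    proof (rule ccontr)
      assume "t \<noteq> t'"
      obtain \<theta> where "P = circ t \<theta>" using bad(1) by (auto simp: bad_def)
      moreover obtain \<theta>' where "P = circ t' \<theta>'" using bad(2) by (auto simp: bad_def)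
      ultimately have \<theta>: "P = circ t \<theta>" "P = circ t' \<theta>'" .
      have "P \<in> M" using P assms by auto
      have sin0: "sin \<theta>' \<noteq> 0"
      proof
        assume "sin \<theta>' = 0"
        then have "(cos \<theta>')\<^sup>2 = 1" by (simp add: cos_squared_eq)
        then have "u (\<nu> 1 0 0) P = 1" unfolding \<theta>(2) by (simp add: u_base_circ)
        then show False using u_eq_1D[OF base_in \<open>P \<in> M\<close>] P assms(2) by simp
      qed
      define \<kappa> where "\<kappa> = cos (t - t')"
      have "\<kappa>\<^sup>2 < 1"
        unfolding \<kappa>_def using bad \<open>t \<noteq> t'\<close> by (intro cos_diff_squared_less_1) (auto simp: bad_def)
      have "1 = u (circ t \<theta>) (circ t' \<theta>')" using u_self[OF \<open>P \<in> M\<close>] \<theta> by simp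
      also have "\<dots> = (cos \<theta> * cos \<theta>' + sin \<theta> * (sin \<theta>' * \<kappa>))\<^sup>2" by (simp add: u_circ \<kappa>_def mult_ac)
      \<comment> \<open>Cauchy-Schwarz for \<open>(cos \<theta>, sin \<theta>)\<close> and
        \<open>(cos \<theta>', sin \<theta>' * \<kappa>)\<close>. The second vector has length below
        1 because \<open>sin \<theta>'\<close> is nonzero and
        \<open>\<kappa>\<^sup>2 < 1\<close>.\<close>
      also have "\<dots> \<le> ((cos \<theta>)\<^sup>2 + (sin \<theta>)\<^sup>2) * ((cos \<theta>')\<^sup>2 + (sin \<theta>' * \<kappa>)\<^sup>2)"
      proof -
        have "(p * r + q * s)\<^sup>2 + (p * s - q * r)\<^sup>2 = (p\<^sup>2 + q\<^sup>2) * (r\<^sup>2 + s\<^sup>2)" for p q r s :: real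
          by (simp add: power2_eq_square algebra_simps)
        then show ?thesis by (metis le_add_same_cancel1 zero_le_power2)
      qed
      also have "\<dots> = (cos \<theta>')\<^sup>2 + (sin \<theta>')\<^sup>2 * \<kappa>\<^sup>2" by (simp add: power_mult_distrib)
      also have "\<dots> < (cos \<theta>')\<^sup>2 + (sin \<theta>')\<^sup>2 * 1"
        using sin0 \<open>\<kappa>\<^sup>2 < 1\<close> by (intro add_strict_left_mono mult_strict_left_mono) auto
      finally show False by simp
    qed
    then have "bad P = {} \<or> (\<exists>t. bad P = {t})" by blast
    then show ?thesis by auto
  qed
  then have "finite (\<Union>P\<in>S. bad P)" using assms(1) by blast
  moreover have "infinite {0<..<pi}" by simp
  ultimately obtain t where "t \<in> {0<..<pi}" "t \<notin> (\<Union>P\<in>S. bad P)" using finite_subset by (metis subsetI)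
  then show ?thesis using that[of t] unfolding bad_def by blast
qed

text \<open>On a circle through \<open>x0\<close> that avoids the other points of \<open>S\<close>, the top Fourier coefficient of the
  relation is a power sum in which the summand of \<open>x0\<close> dominates.\<close>

lemma degree_bound:
  assumes S: "finite S" "S \<subseteq> M" and x0: "x0 \<in> S" "c x0 \<noteq> 0"
  shows "\<exists>k0. \<forall>j. (\<forall>R\<in>M. (\<Sum>x\<in>S. c x * poly j (u x R)) = 0) \<longrightarrow> degree j \<le> k0"
proof -
  have x0M: "x0 \<in> M" using x0 S by auto
  obtain g where g: "isometry g" "g x0 = \<nu> 1 0 0" using hom_pair[OF x0M x0M] by metis
  have gM: "g x \<in> M" if "x \<in> S" for x using isometry_in[OF g(1)] that S by auto
  have gx: "g x \<noteq> \<nu> 1 0 0" if x: "x \<in> S" "x \<noteq> x0" for x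
  proof
    assume "g x = \<nu> 1 0 0"
    then have "u x x0 = 1"
      using isometry_u[OF g(1), of x x0] x S x0M g(2) u_self[OF base_in] by auto
    then show False using u_eq_1D[of x x0] x S x0M by auto
  qed
  have "finite (g ` (S - {x0}))" "\<nu> 1 0 0 \<notin> g ` (S - {x0})" "g ` (S - {x0}) \<subseteq> M"
    using S(1) gM gx by auto (metis gx)
  from circ_avoiding[OF this] obtain t where t: "\<And>P \<theta>. P \<in> g ` (S - {x0}) \<Longrightarrow> P \<noteq> circ t \<theta>"
    by blast
  have "\<forall>x\<in>S. \<exists>abc. \<forall>\<theta>. u (g x) (circ t \<theta>) = fst abc + fst (snd abc) * cos (2 * \<theta>) + snd (snd abc) * sin (2 * \<theta>)"
    using circ_expansion[OF gM] by simp
  from bchoice[OF this] obtain w where w: "\<And>x \<theta>. x \<in> S \<Longrightarrow>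
     u (g x) (circ t \<theta>) = fst (w x) + fst (snd (w x)) * cos (2 * \<theta>) + snd (snd (w x)) * sin (2 * \<theta>)" by blast
  define a where "a x = fst (w x)" for x
  define b where "b x = fst (snd (w x))" for x
  define d where "d x = snd (snd (w x))" for x
  have abd: "u (g x) (circ t \<theta>) = a x + b x * cos (2 * \<theta>) + d x * sin (2 * \<theta>)" if "x \<in> S" for x \<theta>
    using w[OF that] by (simp add: a_def b_def d_def)
  define z where "z x = Complex (b x / 2) (- (d x / 2))" for x
  have cz: "cmod (z x) = sqrt ((b x)\<^sup>2 + (d x)\<^sup>2) / 2" for x
  proof -
    have "(b x / 2)\<^sup>2 + (- (d x / 2))\<^sup>2 = ((b x)\<^sup>2 + (d x)\<^sup>2) / 4"
      by (simp add: power_divide)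
    then show ?thesis unfolding z_def complex_norm complex.sel by (simp only: real_sqrt_divide real_sqrt_four)
  qed
  \<comment> \<open>For \<open>x0\<close>, moved to the base point, the function is
    \<open>(cos \<theta>)\<^sup>2\<close>, of amplitude 1/2 in \<open>2 * \<theta>\<close>; by
    \<open>circ_amplitude\<close> the other points stay strictly below this.\<close>
  have z0: "cmod (z x0) = 1 / 4"
  proof -
    have base: "(cos \<theta>)\<^sup>2 = a x0 + b x0 * cos (2 * \<theta>) + d x0 * sin (2 * \<theta>)" for \<theta>
      using abd[OF x0(1), of \<theta>] by (simp add: g(2) u_base_circ)
    have "a x0 + b x0 = 1" using base[of 0] by simp
    moreover have "a x0 - b x0 = 0" using base[of "pi / 2"] by simp
    moreover have "a x0 + d x0 = 1 / 2" using base[of "pi / 4"] by (simp add: cos_45 power_divide)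
    ultimately have "b x0 = 1 / 2" "d x0 = 0" by linarith+
    then show ?thesis by (simp add: cz power_divide real_sqrt_divide)
  qed
  have z1: "cmod (z x) < cmod (z x0)" if x: "x \<in> S" "x \<noteq> x0" for x
  proof -
    have "(b x)\<^sup>2 + (d x)\<^sup>2 < 1 / 4"
      by (rule circ_amplitude[OF gM[OF x(1)] abd[OF x(1)]]) (use t x in auto)
    then have "sqrt ((b x)\<^sup>2 + (d x)\<^sup>2) < sqrt (1 / 4)" by (rule real_sqrt_less_mono)
    then show ?thesis unfolding z0 cz[of x] by (simp add: real_sqrt_divide)
  qed
  have "z x0 \<noteq> 0" using z0 by auto
  then obtain k0 where k0: "\<forall>k. (\<Sum>x\<in>S. of_real (c x) * z x ^ k) = 0 \<longrightarrow> k < k0"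
    using sum_powers_dominant_nonzero[of S x0 c z, OF S(1) x0 _ z1] by blast
  have "degree j \<le> k0" if j: "\<forall>R\<in>M. (\<Sum>x\<in>S. c x * poly j (u x R)) = 0" for j
  proof (cases "j = 0")
    case False
    \<comment> \<open>Since \<open>g\<close> is onto, each point of the circle is some
      \<open>g R\<close>, and the relation at \<open>R\<close> becomes a relation along the circle
      with \<open>\<phi> = 2 * \<theta>\<close>.\<close>
    have "(\<Sum>x\<in>S. c x * poly j (a x + b x * cos \<phi> + d x * sin \<phi>)) = 0" for \<phi>
    proof -
      obtain R where R: "R \<in> M" "g R = circ t (\<phi> / 2)"
        using g(1) circ_in[of t "\<phi> / 2"] unfolding isometry_def by (metis imageE)
      have "(\<Sum>x\<in>S. c x * poly j (a x + b x * cos \<phi> + d x * sin \<phi>)) = (\<Sum>x\<in>S. c x * poly j (u x R))"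
      proof (rule sum.cong[OF refl])
        fix x assume x: "x \<in> S"
        have "a x + b x * cos \<phi> + d x * sin \<phi> = u (g x) (g R)" using abd[OF x, of "\<phi> / 2"] R by simp
        also have "\<dots> = u x R" by (rule isometry_u[OF g(1)]) (use x S R in auto)
        finally show "c x * poly j (a x + b x * cos \<phi> + d x * sin \<phi>) = c x * poly j (u x R)" by simp
      qed
      then show ?thesis using j R by simp
    qed
    then have "(\<Sum>x\<in>S. of_real (c x) * z x ^ degree j) = 0"
      unfolding z_def using False S(1) by (intro trig_poly_top_coeff[where a = a]) auto
    then show ?thesis using k0 by (simp add: less_imp_le)
  qed simp
  then show ?thesis by blast
qed

lemma pos_def_not_strict_imp_polynomial:
  assumes pd: "pos_def_on M (\<lambda>x y. F (u x y))" and cont: "continuous_on {0..1} F"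
    and nst: "\<not> strictly_pos_def_on M (\<lambda>x y. F (u x y))"
  shows "\<exists>p. \<forall>s\<in>{0..1}. F s = poly p s"
proof -
  obtain S c x0 where S: "finite S" "S \<subseteq> M" and x0: "x0 \<in> S" "c x0 \<noteq> 0"
    and le: "\<not> (\<Sum>x\<in>S. \<Sum>y\<in>S. c x * c y * F (u x y)) > 0"
    using pd nst unfolding strictly_pos_def_on_def by blast
  have ann: "(\<Sum>x\<in>S. c x * F (u x R)) = 0" if R: "R \<in> M" for R
  proof -
    \<comment> \<open>The exponent 0 removes the weight, so the value at every \<open>R\<close> is
      bounded through the form itself, which is not positive here.\<close>
    have "(\<Sum>x\<in>S. c x * F (u R x))\<^sup>2 \<le> (\<Sum>x\<in>S. \<Sum>y\<in>S. c x * c y * F (u x y)) * F 1"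
      using kernel_Cauchy_Schwarz[OF pd S R R, of c 0] by simp
    also have "\<dots> \<le> 0" using le F1_nonneg[OF pd] by (simp add: mult_nonpos_nonneg)
    finally have "(\<Sum>x\<in>S. c x * F (u R x)) = 0" by simp
    moreover have "(\<Sum>x\<in>S. c x * F (u R x)) = (\<Sum>x\<in>S. c x * F (u x R))"
      using S R u_sym by (intro sum.cong refl) (metis subsetD)
    ultimately show ?thesis by simp
  qed
  obtain j where j: "\<And>s. s \<in> {0..1} \<Longrightarrow> (\<lambda>N. poly (j N) s) \<longlonglongrightarrow> F s"
    and jS: "\<And>N. \<forall>R\<in>M. (\<Sum>x\<in>S. c x * poly (j N) (u x R)) = 0"
    using polynomial_approximation[OF pd cont S ann] by blast
  obtain k0 where "\<And>N. degree (j N) \<le> k0"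
    using degree_bound[of S x0 c, OF S x0] jS by blast
  then show ?thesis by (intro poly_limit[of _ j k0] j) auto
qed

text \<open>On \<open>circ 0\<close> the kernel is a polynomial in
  \<open>(cos (t - s))\<^sup>2\<close>, hence built from the monomials
  \<open>cos t ^ i * sin t ^ j\<close> with exponents at most \<open>2 * k\<close>. With more points
  than monomials, some nonzero weight annihilates all monomials and thus the form.\<close>

lemma polynomial_imp_not_strictly_pos_def:
  assumes F: "\<And>s. s \<in> {0..1} \<Longrightarrow> F s = poly p s"
  shows "\<not> strictly_pos_def_on M (\<lambda>x y. F (u x y))"
proof
  assume st: "strictly_pos_def_on M (\<lambda>x y. F (u x y))"
  define k where "k = degree p"
  define I where "I = {..2 * k} \<times> {..2 * k}"
  have "infinite {0<..<pi}" by simp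
  then obtain T where T: "finite T" "card T = Suc (card I)" "T \<subseteq> {0<..<pi}"
    by (meson infinite_arbitrarily_large)
  have dist: "t = t'" if "t \<in> T" "t' \<in> T" "circ 0 t = circ 0 t'" for t t'
  proof (rule ccontr)
    assume "t \<noteq> t'"
    moreover have "t \<in> {0<..<pi}" "t' \<in> {0<..<pi}" using T that by auto
    ultimately have "(cos (t - t'))\<^sup>2 \<noteq> 1" using cos_diff_squared_less_1 by fastforce
    moreover have "u (circ 0 t) (circ 0 t') = (cos (t - t'))\<^sup>2" by (simp add: u_circ cos_diff)
    ultimately show False using that u_self[OF circ_in] by simp
  qed
  then have inj: "inj_on (circ 0) T" by (auto intro: inj_onI)
  have "\<exists>c. (\<exists>t\<in>T. c t \<noteq> 0) \<and> (\<forall>i\<in>I. (\<Sum>t\<in>T. c t * (cos t ^ fst i * sin t ^ snd i)) = 0)"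
    by (rule homogeneous_system_nontrivial) (use T in \<open>auto simp: I_def\<close>)
  then obtain c where c: "\<exists>t\<in>T. c t \<noteq> 0"
    "\<And>i. i \<in> I \<Longrightarrow> (\<Sum>t\<in>T. c t * (cos t ^ fst i * sin t ^ snd i)) = 0" by blast
  have zero: "(\<Sum>t\<in>T. c t * F (u (circ 0 t) (circ 0 s))) = 0" for s
  proof -
    let ?w = "\<lambda>l i. coeff p l * of_nat (2 * l choose i) * cos s ^ i * sin s ^ (2 * l - i)"
    let ?v = "\<lambda>l i t. c t * (cos t ^ i * sin t ^ (2 * l - i))"
    have "c t * F (u (circ 0 t) (circ 0 s)) =
       (\<Sum>l\<le>k. \<Sum>i\<le>2 * l. ?w l i * ?v l i t)" for t
    proof -
      have "F (u (circ 0 t) (circ 0 s)) = poly p (u (circ 0 t) (circ 0 s))"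
        using F u_nonneg[OF circ_in circ_in] u_le_1[OF circ_in circ_in] by simp
      also have "\<dots> = (\<Sum>l\<le>k. coeff p l * (cos t * cos s + sin t * sin s) ^ (2 * l))"
        by (simp add: poly_altdef k_def u_circ power_mult)
      also have "\<dots> = (\<Sum>l\<le>k. coeff p l * (\<Sum>i\<le>2 * l. of_nat (2 * l choose i) * (cos t * cos s) ^ i * (sin t * sin s) ^ (2 * l - i)))"
        by (simp only: binomial_ring)
      finally show ?thesis
        by (simp add: sum_distrib_left power_mult_distrib mult_ac)
    qed
    then have "(\<Sum>t\<in>T. c t * F (u (circ 0 t) (circ 0 s))) =
       (\<Sum>t\<in>T. \<Sum>l\<le>k. \<Sum>i\<le>2 * l. ?w l i * ?v l i t)" by simp
    also have "\<dots> = (\<Sum>l\<le>k. \<Sum>t\<in>T. \<Sum>i\<le>2 * l. ?w l i * ?v l i t)" by (rule sum.swap)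
    also have "\<dots> = (\<Sum>l\<le>k. \<Sum>i\<le>2 * l. \<Sum>t\<in>T. ?w l i * ?v l i t)" by (intro sum.cong refl sum.swap)
    also have "\<dots> = (\<Sum>l\<le>k. \<Sum>i\<le>2 * l. ?w l i * (\<Sum>t\<in>T. ?v l i t))" by (simp only: sum_distrib_left)
    also have "\<dots> = 0"
    proof (intro sum.neutral ballI)
      fix l i assume "l \<in> {..k}" "i \<in> {..2 * l}"
      then have "(i, 2 * l - i) \<in> I" by (auto simp: I_def)
      from c(2)[OF this] have "(\<Sum>t\<in>T. ?v l i t) = 0" by simp
      then show "?w l i * (\<Sum>t\<in>T. ?v l i t) = 0" by simp
    qed
    finally show ?thesis .
  qed
  define S where "S = circ 0 ` T"
  define d where "d = (\<lambda>x. c (inv_into T (circ 0) x))"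
  have d: "d (circ 0 t) = c t" if "t \<in> T" for t using inj that by (simp add: d_def)
  have S: "finite S" "S \<noteq> {}" "S \<subseteq> M" "\<exists>x\<in>S. d x \<noteq> 0"
    using T c(1) d circ_in by (auto simp: S_def)
  have "(\<Sum>x\<in>S. \<Sum>y\<in>S. d x * d y * F (u x y)) = (\<Sum>t\<in>T. \<Sum>s\<in>T. c t * c s * F (u (circ 0 t) (circ 0 s)))"
    unfolding S_def by (simp add: sum.reindex[OF inj] d)
  also have "\<dots> = (\<Sum>s\<in>T. \<Sum>t\<in>T. c t * c s * F (u (circ 0 t) (circ 0 s)))" by (rule sum.swap)
  also have "\<dots> = (\<Sum>s\<in>T. c s * (\<Sum>t\<in>T. c t * F (u (circ 0 t) (circ 0 s))))"
    by (simp add: sum_distrib_left mult_ac)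
  also have "\<dots> = 0" by (simp add: zero)
  finally have "\<not> (\<Sum>x\<in>S. \<Sum>y\<in>S. d x * d y * F (u x y)) > 0" by simp
  moreover have "(\<Sum>x\<in>S. \<Sum>y\<in>S. d x * d y * F (u x y)) > 0"
    using S by (intro st[unfolded strictly_pos_def_on_def, THEN conjunct2, rule_format]) auto
  ultimately show False by simp
qed

section \<open>The equivalence in an abstract model\<close>

lemma isotropic_kernel_eq:
  assumes "\<And>x y. x \<in> M \<Longrightarrow> y \<in> M \<Longrightarrow> cos (\<delta> x y / 2) = 2 * u x y - 1"
  shows "isotropic_part_pd M \<delta> f \<longleftrightarrow> continuous_on {-1..1} f \<and> pos_def_on M (\<lambda>x y. f (2 * u x y - 1))"
    and "isotropic_part_spd M \<delta> f \<longleftrightarrow> continuous_on {-1..1} f \<and> strictly_pos_def_on M (\<lambda>x y. f (2 * u x y - 1))"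
proof -
  have K: "isotropic_kernel \<delta> f x y = f (2 * u x y - 1)" if "x \<in> M" "y \<in> M" for x y
    using assms[OF that] by (simp add: isotropic_kernel_def)
  show "isotropic_part_pd M \<delta> f \<longleftrightarrow> continuous_on {-1..1} f \<and> pos_def_on M (\<lambda>x y. f (2 * u x y - 1))"
    using pos_def_on_cong(1)[of M, OF K] by (simp add: isotropic_part_pd_def)
  show "isotropic_part_spd M \<delta> f \<longleftrightarrow> continuous_on {-1..1} f \<and> strictly_pos_def_on M (\<lambda>x y. f (2 * u x y - 1))"
    using pos_def_on_cong(2)[of M, OF K] by (simp add: isotropic_part_spd_def)
qed

lemma isotropic_part_spd_equivalence:
  assumes \<delta>: "\<And>x y. x \<in> M \<Longrightarrow> y \<in> M \<Longrightarrow> cos (\<delta> x y / 2) = 2 * u x y - 1"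
    and f0: "\<exists>t\<in>{-1..1}. f t \<noteq> 0" and g0: "\<exists>t\<in>{-1..1}. g t \<noteq> 0"
    and f: "isotropic_part_pd M \<delta> f" and g: "isotropic_part_pd M \<delta> g"
  shows "(isotropic_part_spd M \<delta> (\<lambda>t. f t * g t) \<longleftrightarrow>
            isotropic_part_spd M \<delta> f \<or> isotropic_part_spd M \<delta> g) \<and>
         (isotropic_part_spd M \<delta> f \<or> isotropic_part_spd M \<delta> g \<longleftrightarrow>
            \<not> polynomial_on_interval f \<or> \<not> polynomial_on_interval g)"
proof -
  note pd_iff = isotropic_kernel_eq(1)[OF \<delta>] and spd_iff = isotropic_kernel_eq(2)[OF \<delta>]
  have nonpoly: "isotropic_part_spd M \<delta> f" if f: "isotropic_part_pd M \<delta> f" and np: "\<not> polynomial_on_interval f" for f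
  proof (rule ccontr)
    assume "\<not> isotropic_part_spd M \<delta> f"
    moreover have cont: "continuous_on {-1..1} f" and pd: "pos_def_on M (\<lambda>x y. f (2 * u x y - 1))"
      using f by (auto simp: pd_iff)
    ultimately have "\<not> strictly_pos_def_on M (\<lambda>x y. f (2 * u x y - 1))" by (simp add: spd_iff)
    moreover have "continuous_on {0..1} (\<lambda>s. f (2 * s - 1))"
      by (rule continuous_on_compose2[OF cont]) (auto intro!: continuous_intros)
    ultimately obtain p where p: "\<And>s. s \<in> {0..1} \<Longrightarrow> f (2 * s - 1) = poly p s"
      using pos_def_not_strict_imp_polynomial[where F = "\<lambda>s. f (2 * s - 1)"] pd by blast
    have "f t = poly (pcompose p [:1/2, 1/2:]) t" if "t \<in> {-1..1}" for t
      using p[of "(1 + t) / 2"] that by (simp add: poly_pcompose field_simps)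
    then show False using np by (auto simp: polynomial_on_interval_def)
  qed
  have poly: "\<not> isotropic_part_spd M \<delta> f" if pf: "polynomial_on_interval f" for f
  proof -
    obtain p where p: "\<And>t. t \<in> {-1..1} \<Longrightarrow> f t = poly p t"
      using pf unfolding polynomial_on_interval_def by blast
    have "\<not> strictly_pos_def_on M (\<lambda>x y. (\<lambda>s. f (2 * s - 1)) (u x y))"
      by (rule polynomial_imp_not_strictly_pos_def[where p = "pcompose p [:-1, 2:]"])
        (use p in \<open>auto simp: poly_pcompose algebra_simps\<close>)
    then show ?thesis by (simp add: spd_iff)
  qed
  have mult: "isotropic_part_spd M \<delta> (\<lambda>t. f t * g t)"
    if f: "isotropic_part_spd M \<delta> f" and g: "isotropic_part_pd M \<delta> g" and g0: "\<exists>t\<in>{-1..1}. g t \<noteq> 0" for f g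
  proof -
    define G where "G s = g (2 * s - 1)" for s
    have pdG: "pos_def_on M (\<lambda>x y. G (u x y))" using g by (simp add: pd_iff G_def)
    \<comment> \<open>Cauchy-Schwarz with a single point gives
      \<open>(G s)\<^sup>2 \<le> (G 1)\<^sup>2\<close>, so vanishing on the diagonal means vanishing
      everywhere. This is where \<open>g\<close> not being identically zero enters.\<close>
    have "G 1 \<noteq> 0"
    proof
      assume G1: "G 1 = 0"
      obtain t where t: "t \<in> {-1..1}" "g t \<noteq> 0" using g0 by blast
      define s where "s = (1 + t) / 2"
      have s: "0 \<le> s" "s \<le> 1" "G s \<noteq> 0" using t by (auto simp: s_def G_def field_simps)
      define R where "R = \<nu> (sqrt s) 0 (sqrt (1 - s))"
      have R: "R \<in> M" unfolding R_def by (rule nu_in[OF sqrt_unit[OF s(1,2)]])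
      have "(\<Sum>x\<in>{R}. 1 * (G (u (\<nu> 1 0 0) x) * u R x ^ 0))\<^sup>2 \<le>
         (\<Sum>x\<in>{R}. \<Sum>y\<in>{R}. 1 * 1 * (G (u x y) * u x y ^ 0)) * G 1"
        by (rule kernel_Cauchy_Schwarz[OF pdG, where c = "\<lambda>_. 1"]) (use R base_in in auto)
      then show False using G1 s by (simp add: R_def u_base)
    qed
    then have G1: "G 1 > 0" using F1_nonneg[OF pdG] by simp
    have "strictly_pos_def_on M (\<lambda>x y. f (2 * u x y - 1) * G (u x y))"
      by (rule strictly_pos_def_mult) (use f pdG G1 u_sym u_self in \<open>auto simp: spd_iff\<close>)
    then show ?thesis using f g by (auto simp: spd_iff pd_iff G_def intro: continuous_on_mult)
  qed
  have mult': "isotropic_part_spd M \<delta> (\<lambda>t. f t * g t)"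
    if "isotropic_part_spd M \<delta> f \<or> isotropic_part_spd M \<delta> g"
    using that mult[OF _ g g0] mult[of g f, OF _ f f0] by (auto simp: mult.commute[of "g _"])
  \<comment> \<open>If both factors are polynomials, so is the product, and \<open>poly\<close>
    denies its strictness; the other implications combine \<open>poly\<close>,
    \<open>nonpoly\<close> and \<open>mult'\<close>.\<close>
  show ?thesis
    using mult' nonpoly[OF f] nonpoly[OF g] poly[of f] poly[of g]
      poly[of "\<lambda>t. f t * g t"] polynomial_on_interval_mult[of f g] by blast
qed

end

section \<open>Projective spaces over associative scalars\<close>

text \<open>Common ground of the reals, complex numbers and quaternions. \<open>inner_left\<close>
  and \<open>inner_right\<close> say that multiplications by \<open>a\<close> and by
  \<open>s a\<close> are adjoint for the real inner product; they stand in for commutativity when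
  factors must be moved.\<close>

locale hermitian_scalars =
  fixes m :: "'k::euclidean_space \<Rightarrow> 'k \<Rightarrow> 'k" and s :: "'k \<Rightarrow> 'k" and e :: 'k
  assumes assoc: "m (m a b) c = m a (m b c)"
    and add_left: "m (a + b) c = m a c + m b c"
    and add_right: "m a (b + c) = m a b + m a c"
    and scale_left: "m (r *\<^sub>R a) b = r *\<^sub>R m a b"
    and scale_right: "m a (r *\<^sub>R b) = r *\<^sub>R m a b"
    and unit_left: "m e a = a" and unit_right: "m a e = a"
    and s_add: "s (a + b) = s a + s b"
    and s_scale: "s (r *\<^sub>R a) = r *\<^sub>R s a"
    and s_mult: "s (m a b) = m (s b) (s a)"
    and s_s: "s (s a) = a"
    and s_unit: "s e = e"
    and s_self: "m (s a) a = (norm a)\<^sup>2 *\<^sub>R e" "m a (s a) = (norm a)\<^sup>2 *\<^sub>R e"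
    and norm_mult': "norm (m a b) = norm a * norm b"
    and norm_s: "norm (s a) = norm a"
    and inner_left: "inner (m a b) c = inner b (m (s a) c)"
    and inner_right: "inner (m a b) c = inner a (m c (s b))"
    and norm_unit: "norm e = 1"
begin

lemma zero_mult: "m 0 a = 0" "m a 0 = 0"
  using scale_left[of 0 0 a] scale_right[of a 0 0] by simp_all

lemma s_zero: "s 0 = 0" using s_scale[of 0 0] by simp

lemma minus_mult: "m (- a) b = - m a b" "m a (- b) = - m a b"
  using scale_left[of "-1" a b] scale_right[of a "-1" b] by simp_all

lemma s_minus: "s (- a) = - s a" using s_scale[of "-1" a] by simp

lemma diff_left: "m (a - b) c = m a c - m b c" and diff_right: "m a (b - c) = m a b - m a c"
  and s_diff: "s (a - b) = s a - s b"
  using add_left[of a "- b" c] add_right[of a b "- c"] s_add[of a "- b"] by (simp_all add: minus_mult s_minus)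

lemma sum_left: "m (sum h A) c = (\<Sum>i\<in>A. m (h i) c)"
  and sum_right: "m c (sum h A) = (\<Sum>i\<in>A. m c (h i))"
  and s_sum: "s (sum h A) = (\<Sum>i\<in>A. s (h i))"
  by (induction A rule: infinite_finite_induct) (simp_all add: zero_mult add_left add_right s_zero s_add)

text \<open>A real multiple of \<open>a\<close> itself serves, or of \<open>e\<close> when
  \<open>a = 0\<close>. These are the phase factors for the Householder reflections.\<close>

lemma aligned:
  assumes "r \<ge> 0"
  obtains c where "norm c = r" "m (s a) c = (r * norm a) *\<^sub>R e"
proof (cases "a = 0")
  case True
  then show ?thesis using that[of "r *\<^sub>R e"] assms by (simp add: zero_mult s_zero norm_unit)
next
  case False
  show ?thesis
    by (rule that[of "(r / norm a) *\<^sub>R a"])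
      (use False assms in \<open>simp_all add: scale_right s_self power2_eq_square\<close>)
qed

context
  fixes n :: nat
begin

abbreviation "NV \<equiv> nonzero_vectors n :: (nat \<Rightarrow> 'k) set"
abbreviation "H \<equiv> herm m s n"
abbreviation "vn \<equiv> vec_norm n :: (nat \<Rightarrow> 'k) \<Rightarrow> real"
abbreviation mulr :: "(nat \<Rightarrow> 'k) \<Rightarrow> 'k \<Rightarrow> (nat \<Rightarrow> 'k)" where "mulr x a \<equiv> (\<lambda>i. m (x i) a)"

lemma vn_sq: "(vn x)\<^sup>2 = (\<Sum>i\<le>n. (norm (x i))\<^sup>2)"
  by (simp add: vec_norm_def sum_nonneg)

lemma vn_nonneg: "vn x \<ge> 0" by (simp add: vec_norm_def sum_nonneg)

lemma NV_iff: "x \<in> NV \<longleftrightarrow> (\<forall>i>n. x i = 0) \<and> vn x > 0"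
proof -
  have "vn x > 0 \<longleftrightarrow> (vn x)\<^sup>2 \<noteq> 0" using vn_nonneg[of x] by auto
  also have "\<dots> \<longleftrightarrow> (\<exists>i\<le>n. x i \<noteq> 0)"
    by (subst vn_sq, subst sum_nonneg_eq_0_iff) auto
  finally show ?thesis by (auto simp: nonzero_vectors_def)
qed

lemma H_self: "H x x = (vn x)\<^sup>2 *\<^sub>R e"
  by (simp add: herm_def s_self scaleR_sum_left vn_sq)

lemma s_H: "s (H x y) = H y x"
  by (simp add: herm_def s_sum s_mult s_s)

lemma H_mulr: "H x (mulr y a) = m (H x y) a"
  by (simp add: herm_def sum_left assoc)

lemma H_mulr_left: "H (mulr x a) y = m (s a) (H x y)"
  by (simp add: herm_def sum_right s_mult assoc)

lemma H_diff_right: "H x (\<lambda>i. y i - z i) = H x y - H x z"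
  by (simp add: herm_def diff_right sum_subtractf)

lemma H_diff_left: "H (\<lambda>i. x i - y i) z = H x z - H y z"
  by (simp add: herm_def diff_left s_diff sum_subtractf)

lemma H_scale_right: "H x (\<lambda>i. r *\<^sub>R y i) = r *\<^sub>R H x y"
  by (simp add: herm_def scale_right scaleR_sum_right)

lemma H_scale_left: "H (\<lambda>i. r *\<^sub>R x i) y = r *\<^sub>R H x y"
  by (simp add: herm_def scale_left s_scale scaleR_sum_right)

text \<open>The right side is the trace form of the unnormalized projections with entries
  \<open>m (x i) (s (x j))\<close>. Taking real coordinates of these entries gives the finite
  feature expansion.\<close>

lemma norm_H_sq: "(norm (H x y))\<^sup>2 = (\<Sum>i\<le>n. \<Sum>j\<le>n. inner (m (x i) (s (x j))) (m (y i) (s (y j))))"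
proof -
  have "inner (m (s (x i)) (y i)) (m (s (x j)) (y j)) = inner (m (x i) (s (x j))) (m (y i) (s (y j)))" for i j
    by (simp add: inner_left[of "s (x i)"] s_s) (metis assoc inner_commute inner_right)
  then show ?thesis
    unfolding power2_norm_eq_inner herm_def inner_sum_left inner_sum_right by simp (rule sum.swap)
qed

lemma vn_mulr: "vn (mulr x a) = vn x * norm a"
proof -
  have "(vn (mulr x a))\<^sup>2 = (vn x * norm a)\<^sup>2"
    unfolding vn_sq power_mult_distrib sum_distrib_right by (simp add: norm_mult' power_mult_distrib)
  then show ?thesis using vn_nonneg by (simp add: power2_eq_iff_nonneg)
qed

lemma mulr_NV: "x \<in> NV \<Longrightarrow> a \<noteq> 0 \<Longrightarrow> mulr x a \<in> NV"
  by (simp add: NV_iff vn_mulr zero_mult)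

lemma line_mulr:
  assumes "a \<noteq> 0"
  shows "line m (mulr x a) = line m x"
proof -
  define b where "b = (1 / (norm a)\<^sup>2) *\<^sub>R s a"
  have ab: "m a b = e" using assms by (simp add: b_def scale_right s_self)
  have "(\<lambda>i. m (m (x i) a) c) \<in> line m x" for c unfolding line_def by (auto simp: assoc)
  moreover have "(\<lambda>i. m (x i) c) \<in> line m (mulr x a)" for c
  proof -
    have "m a (m b c) = c" using ab by (metis assoc unit_left)
    then have "(\<lambda>i. m (x i) c) = (\<lambda>i. m (m (x i) a) (m b c))" by (simp add: assoc)
    then show ?thesis unfolding line_def by blast
  qed
  ultimately show ?thesis unfolding line_def by blast
qed

text \<open>The same choice term as in \<open>proj_dist\<close>, so that the distance unfolds
  directly to \<open>rep\<close>.\<close>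

definition rep :: "(nat \<Rightarrow> 'k) set \<Rightarrow> nat \<Rightarrow> 'k" where
  "rep L = (SOME x. x \<in> L \<inter> nonzero_vectors n)"

lemma rep_line:
  assumes "x \<in> NV"
  obtains a where "a \<noteq> 0" "rep (line m x) = mulr x a"
proof -
  have "x = mulr x e" by (simp add: unit_right)
  then have "x \<in> line m x \<inter> nonzero_vectors n" using assms unfolding line_def by blast
  then have *: "rep (line m x) \<in> line m x \<inter> nonzero_vectors n" unfolding rep_def by (rule someI[where P = "\<lambda>z. z \<in> line m x \<inter> nonzero_vectors n"])
  then obtain a where a: "rep (line m x) = mulr x a" by (auto simp: line_def)
  moreover have "a \<noteq> 0" using * unfolding a by (auto simp: NV_iff vn_mulr)
  ultimately show ?thesis using that by blast
qed

definition uv :: "(nat \<Rightarrow> 'k) \<Rightarrow> (nat \<Rightarrow> 'k) \<Rightarrow> real" where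
  "uv x y = (norm (H x y))\<^sup>2 / ((vn x)\<^sup>2 * (vn y)\<^sup>2)"

definition ul :: "(nat \<Rightarrow> 'k) set \<Rightarrow> (nat \<Rightarrow> 'k) set \<Rightarrow> real" where
  "ul L L' = uv (rep L) (rep L')"

lemma uv_mulr: "a \<noteq> 0 \<Longrightarrow> b \<noteq> 0 \<Longrightarrow> uv (mulr x a) (mulr y b) = uv x y"
  by (simp add: uv_def H_mulr H_mulr_left norm_mult' norm_s vn_mulr power_mult_distrib)

lemma ul_line:
  assumes "x \<in> NV" "y \<in> NV"
  shows "ul (line m x) (line m y) = uv x y"
proof -
  obtain a where a: "a \<noteq> 0" "rep (line m x) = mulr x a" using assms(1) by (rule rep_line)
  obtain b where b: "b \<noteq> 0" "rep (line m y) = mulr y b" using assms(2) by (rule rep_line)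
  show ?thesis unfolding ul_def a(2) b(2) by (rule uv_mulr[OF a(1) b(1)])
qed

lemma proj_space_cases:
  assumes "L \<in> proj_space m n"
  obtains x where "x \<in> NV" "L = line m x"
  using assms by (auto simp: proj_space_def)

lemma proj_space_rep:
  assumes "L \<in> proj_space m n"
  shows "rep L \<in> NV" "line m (rep L) = L"
proof -
  obtain x where x: "x \<in> NV" "L = line m x" using assms by (rule proj_space_cases)
  obtain a where "a \<noteq> 0" "rep (line m x) = mulr x a" using x(1) by (rule rep_line)
  then show "rep L \<in> NV" "line m (rep L) = L" using x by (simp_all add: mulr_NV line_mulr)
qed

section \<open>Unitary maps, normal forms of pairs of lines, and the resulting model\<close>

text \<open>Records what descends to lines: right scalars pass through, the Hermitian form is
  preserved, and the right inverse \<open>V\<close> makes the induced map on lines onto.\<close>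

definition unitary :: "((nat \<Rightarrow> 'k) \<Rightarrow> (nat \<Rightarrow> 'k)) \<Rightarrow> bool" where
  "unitary U \<longleftrightarrow> (\<forall>x\<in>NV. U x \<in> NV) \<and> (\<forall>x a. U (mulr x a) = mulr (U x) a) \<and>
     (\<forall>x y. H (U x) (U y) = H x y) \<and> (\<exists>V. \<forall>x\<in>NV. V x \<in> NV \<and> U (V x) = x)"

lemma unitary_comp:
  assumes U: "unitary U" and U': "unitary U'"
  shows "unitary (U \<circ> U')"
proof -
  obtain V where "\<forall>x\<in>NV. V x \<in> NV \<and> U (V x) = x" using U unfolding unitary_def by blast
  moreover obtain V' where "\<forall>x\<in>NV. V' x \<in> NV \<and> U' (V' x) = x" using U' unfolding unitary_def by blast
  ultimately have "\<exists>W. \<forall>x\<in>NV. W x \<in> NV \<and> (U \<circ> U') (W x) = x" by (intro exI[of _ "V' \<circ> V"]) auto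
  then show ?thesis using U U' by (simp add: unitary_def)
qed

lemma unitary_line: "unitary U \<Longrightarrow> (`) U (line m x) = line m (U x)"
  unfolding unitary_def line_def by (auto simp: image_image)

lemma unitary_proj_space: "unitary U \<Longrightarrow> (`) U ` proj_space m n = proj_space m n"
proof -
  assume U: "unitary U"
  then obtain V where V: "\<And>x. x \<in> NV \<Longrightarrow> V x \<in> NV \<and> U (V x) = x" unfolding unitary_def by blast
  have "(`) U L \<in> proj_space m n" if "L \<in> proj_space m n" for L
    using that U by (auto simp: proj_space_def unitary_line[OF U]) (auto simp: unitary_def)
  moreover have "L \<in> (`) U ` proj_space m n" if L: "L \<in> proj_space m n" for L
  proof -
    obtain x where x: "x \<in> NV" "L = line m x" using L by (rule proj_space_cases)
    then have "L = (`) U (line m (V x))" using V by (simp add: unitary_line[OF U])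
    then show ?thesis using V[OF x(1)] by (auto simp: proj_space_def)
  qed
  ultimately show ?thesis by blast
qed

lemma unitary_uv:
  assumes "unitary U"
  shows "uv (U x) (U y) = uv x y"
proof -
  have "H (U x) (U y) = H x y" for x y using assms by (simp add: unitary_def)
  then have "((vn (U x))\<^sup>2 *\<^sub>R e) = ((vn x)\<^sup>2 *\<^sub>R e)" "H (U x) (U y) = H x y" for x y
    by (metis H_self)+
  moreover have "e \<noteq> 0" using norm_unit by auto
  ultimately show ?thesis by (simp add: uv_def)
qed

lemma unitary_ul:
  assumes U: "unitary U" and L: "L \<in> proj_space m n" "L' \<in> proj_space m n"
  shows "ul (U ` L) (U ` L') = ul L L'"
proof -
  obtain x y where xy: "x \<in> NV" "L = line m x" "y \<in> NV" "L' = line m y"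
    using L by (metis proj_space_cases)
  then have "U x \<in> NV" "U y \<in> NV" using U by (auto simp: unitary_def)
  then show ?thesis using xy by (simp add: unitary_line[OF U] ul_line unitary_uv[OF U])
qed

text \<open>The Householder reflection in \<open>x - y\<close> exchanges \<open>x\<close> and \<open>y\<close> only because their Hermitian
  product is real; this is why scalar phases are adjusted first below.\<close>

lemma householder:
  assumes x: "\<And>i. i > n \<Longrightarrow> x i = 0" and y: "\<And>i. i > n \<Longrightarrow> y i = 0"
    and norm: "vn x = vn y" and real: "H x y = r *\<^sub>R e"
  obtains U where "unitary U" "U x = y" "\<And>z. H x z = H y z \<Longrightarrow> U z = z"
proof -
  define w where "w = (\<lambda>i. x i - y i)"
  \<comment> \<open>For \<open>w = 0\<close> division by zero gives \<open>c = 0\<close> and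
    \<open>U\<close> is the identity; \<open>cw\<close> holds in that case as well.\<close>
  define c where "c = 2 / (vn w)\<^sup>2"
  define U where "U z = (\<lambda>i. z i - c *\<^sub>R m (w i) (H w z))" for z
  have w: "w i = 0" if "i > n" for i using x y that by (simp add: w_def)
  have cw: "c * (c * (vn w)\<^sup>2) = 2 * c" by (simp add: c_def)
  have HwU: "H w (U z) = H w z - (c * (vn w)\<^sup>2) *\<^sub>R H w z" for z
    unfolding U_def H_diff_right H_scale_right H_mulr H_self scale_left unit_left by simp
  have HU: "H (U z) z' = H z z' - c *\<^sub>R m (H z w) (H w z')" for z z'
    unfolding U_def H_diff_left H_scale_left H_mulr_left s_H by simp
  have inv: "H (U z) (U z') = H z z'" for z z'
  proof -
    have "H (U z) (U z') = H z (U z') - c *\<^sub>R m (H z w) (H w (U z'))" by (rule HU)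
    also have "H z (U z') = H z z' - c *\<^sub>R m (H z w) (H w z')"
      unfolding U_def H_diff_right H_scale_right H_mulr by simp
    also have "c *\<^sub>R m (H z w) (H w (U z')) = (c - c * (c * (vn w)\<^sup>2)) *\<^sub>R m (H z w) (H w z')"
      unfolding HwU diff_right scale_right by (simp add: algebra_simps)
    finally show ?thesis unfolding cw by (simp add: algebra_simps)
  qed
  have UU: "U (U z) = z" for z
  proof
    fix i
    have "U (U z) i = z i - c *\<^sub>R m (w i) (H w z) - (c - c * (c * (vn w)\<^sup>2)) *\<^sub>R m (w i) (H w z)"
      unfolding U_def[of "U z"] HwU diff_right scale_right by (simp add: U_def algebra_simps)
    then show "U (U z) i = z i" unfolding cw by (simp add: algebra_simps)
  qed
  have e0: "e \<noteq> 0" using norm_unit by auto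
  have vnU: "vn (U z) = vn z" for z
  proof -
    have "(vn (U z))\<^sup>2 *\<^sub>R e = (vn z)\<^sup>2 *\<^sub>R e" using inv[of z z] by (simp only: H_self)
    then show ?thesis using e0 vn_nonneg by (simp add: power2_eq_iff_nonneg)
  qed
  have UNV: "U z \<in> NV" if "z \<in> NV" for z
    using that vnU[of z] w by (auto simp: NV_iff U_def zero_mult)
  have "U (mulr z a) = mulr (U z) a" for z a
    unfolding U_def H_mulr by (simp add: diff_left scale_left assoc)
  then have "unitary U" unfolding unitary_def using UNV inv UU by blast
  moreover have "U x = y"
  proof (cases "vn w = 0")
    case True
    then have "(\<Sum>i\<le>n. (norm (w i))\<^sup>2) = 0" using vn_sq[of w] by simp
    then have "w i = 0" if "i \<le> n" for i using that by (simp add: sum_nonneg_eq_0_iff)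
    then have "w i = 0" for i using w by (cases "i \<le> n") auto
    then show ?thesis by (simp add: U_def w_def zero_mult fun_eq_iff)
  next
    case False
    have "H y x = r *\<^sub>R e" using s_H[of x y] real by (simp add: s_scale s_unit)
    then have 1: "H w x = ((vn x)\<^sup>2 - r) *\<^sub>R e" and 2: "H w y = (r - (vn y)\<^sup>2) *\<^sub>R e"
      by (simp_all add: w_def H_diff_left H_self real algebra_simps)
    \<comment> \<open>As \<open>H x y\<close> is real, the squared norm of \<open>w\<close> is twice
      \<open>(vn x)\<^sup>2 - r\<close>, so the reflection moves \<open>x\<close> by exactly
      \<open>w\<close>.\<close>
    have "H w w = H w x - H w y" by (subst (2) w_def) (rule H_diff_right)
    then have "(vn w)\<^sup>2 *\<^sub>R e = (2 * ((vn x)\<^sup>2 - r)) *\<^sub>R e"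
      unfolding H_self 1 2 norm by (simp add: algebra_simps flip: scaleR_add_left)
    then have "(vn w)\<^sup>2 = 2 * ((vn x)\<^sup>2 - r)" using e0 by simp
    then have "c * ((vn x)\<^sup>2 - r) = 1" using False by (simp add: c_def field_simps)
    then have "U x = (\<lambda>i. x i - w i)"
      unfolding U_def 1 scale_right unit_right by simp
    then show ?thesis by (simp add: w_def)
  qed
  moreover have "U z = z" if "H x z = H y z" for z
  proof -
    have "H w z = 0" using that by (simp add: w_def H_diff_left)
    then show ?thesis by (simp add: U_def zero_mult)
  qed
  ultimately show ?thesis using that by blast
qed

definition vec3 :: "real \<Rightarrow> real \<Rightarrow> real \<Rightarrow> nat \<Rightarrow> 'k" where
  "vec3 x y z = (\<lambda>i. (if i = 0 then x else if i = 1 then y else if i = 2 then z else 0) *\<^sub>R e)"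

text \<open>Real coordinates of the entries of the orthogonal rank-one projection onto the
  line.\<close>

definition coord :: "nat \<times> nat \<times> 'k \<Rightarrow> (nat \<Rightarrow> 'k) set \<Rightarrow> real" where
  "coord = (\<lambda>(i, j, b) L. inner (m (rep L i) (s (rep L j))) b / (vn (rep L))\<^sup>2)"

lemma ul_eq_sum:
  "ul L L' = (\<Sum>a\<in>{..n} \<times> {..n} \<times> Basis. coord a L * coord a L')"
proof -
  define x where "x = rep L"
  define y where "y = rep L'"
  have "(\<Sum>a\<in>{..n} \<times> {..n} \<times> Basis. coord a L * coord a L') =
     (\<Sum>i\<le>n. \<Sum>j\<le>n. \<Sum>b\<in>Basis. coord (i, j, b) L * coord (i, j, b) L')"
    by (simp add: sum.cartesian_product case_prod_unfold)
  also have "\<dots> = (\<Sum>i\<le>n. \<Sum>j\<le>n. inner (m (x i) (s (x j))) (m (y i) (s (y j))) / ((vn x)\<^sup>2 * (vn y)\<^sup>2))"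
  proof (intro sum.cong refl)
    fix i j
    have "inner (m (x i) (s (x j))) (m (y i) (s (y j))) =
        (\<Sum>b\<in>Basis. inner (m (x i) (s (x j))) b * inner (m (y i) (s (y j))) b)"
      by (rule euclidean_inner)
    then show "(\<Sum>b\<in>Basis. coord (i, j, b) L * coord (i, j, b) L') =
        inner (m (x i) (s (x j))) (m (y i) (s (y j))) / ((vn x)\<^sup>2 * (vn y)\<^sup>2)"
      by (simp add: coord_def x_def y_def sum_divide_distrib)
  qed
  also have "\<dots> = ul L L'"
    by (simp add: ul_def uv_def norm_H_sq sum_divide_distrib x_def y_def)
  finally show ?thesis ..
qed

lemma ul_self:
  assumes "L \<in> proj_space m n"
  shows "ul L L = 1"
proof -
  have "vn (rep L) > 0" using proj_space_rep(1)[OF assms] by (simp add: NV_iff)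
  then show ?thesis by (simp add: ul_def uv_def H_self norm_unit power2_eq_square)
qed

text \<open>The feature vectors are unit vectors with inner product 1, so they agree: both lines
  have the same projection, and a nonzero column of it spans the line.\<close>

lemma ul_eq_1D:
  assumes L: "L \<in> proj_space m n" "L' \<in> proj_space m n" and 1: "ul L L' = 1"
  shows "L = L'"
proof -
  define x where "x = rep L"
  define y where "y = rep L'"
  have xy: "x \<in> NV" "y \<in> NV" "line m x = L" "line m y = L'"
    using proj_space_rep L by (auto simp: x_def y_def)
  then have vn0: "vn x > 0" "vn y > 0" by (auto simp: NV_iff)
  let ?A = "{..n} \<times> {..n} \<times> (Basis :: 'k set)"
  have "(\<Sum>a\<in>?A. (coord a L - coord a L')\<^sup>2) = ul L L + ul L' L' - 2 * ul L L'"
    unfolding ul_eq_sum by (simp add: power2_eq_square algebra_simps sum.distrib sum_subtractf sum_distrib_left)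
  also have "\<dots> = 0" using L 1 by (simp add: ul_self)
  finally have eqs: "\<forall>a\<in>?A. coord a L = coord a L'"
    by (subst (asm) sum_nonneg_eq_0_iff) auto
  have *: "(1 / (vn x)\<^sup>2) *\<^sub>R m (x i) (s (x j)) = (1 / (vn y)\<^sup>2) *\<^sub>R m (y i) (s (y j))" if "i \<le> n" "j \<le> n" for i j
  proof (rule euclidean_eqI)
    fix b :: 'k assume "b \<in> Basis"
    then have "coord (i, j, b) L = coord (i, j, b) L'" using eqs that by simp
    then show "inner ((1 / (vn x)\<^sup>2) *\<^sub>R m (x i) (s (x j))) b = inner ((1 / (vn y)\<^sup>2) *\<^sub>R m (y i) (s (y j))) b"
      by (simp add: coord_def x_def[symmetric] y_def[symmetric])
  qed
  obtain j where j: "j \<le> n" "x j \<noteq> 0" using xy(1) by (auto simp: nonzero_vectors_def)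
  \<comment> \<open>Read off from \<open>(norm (x j))\<^sup>2 *\<^sub>R x i = m (m (x i) (s (x j)))
    (x j)\<close> once the inner product of entries is replaced by that of \<open>y\<close>.\<close>
  define a where "a = ((vn x)\<^sup>2 / ((vn y)\<^sup>2 * (norm (x j))\<^sup>2)) *\<^sub>R m (s (y j)) (x j)"
  have "x i = m (y i) a" for i
  proof (cases "i \<le> n")
    case True
    have "(norm (x j))\<^sup>2 *\<^sub>R x i = m (m (x i) (s (x j))) (x j)"
      by (simp add: assoc s_self scale_right unit_right)
    also have "m (x i) (s (x j)) = (vn x)\<^sup>2 *\<^sub>R ((1 / (vn x)\<^sup>2) *\<^sub>R m (x i) (s (x j)))"
      using vn0 by simp
    also have "\<dots> = ((vn x)\<^sup>2 / (vn y)\<^sup>2) *\<^sub>R m (y i) (s (y j))"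
      unfolding *[OF True j(1)] by simp
    also have "m (((vn x)\<^sup>2 / (vn y)\<^sup>2) *\<^sub>R m (y i) (s (y j))) (x j) = (norm (x j))\<^sup>2 *\<^sub>R m (y i) a"
      using j by (simp add: a_def scale_left scale_right assoc)
    finally show ?thesis using j by simp
  next
    case False
    then show ?thesis using xy by (simp add: nonzero_vectors_def zero_mult)
  qed
  then have xa: "x = mulr y a" by auto
  moreover have "a \<noteq> 0" using vn0(1) unfolding xa vn_mulr by auto
  ultimately show ?thesis using line_mulr xy by metis
qed

context
  assumes n: "n \<ge> 2"
begin

lemma sum_vec3:
  fixes h :: "nat \<Rightarrow> 'k"
  assumes "\<And>i. i > 2 \<Longrightarrow> h i = 0"
  shows "(\<Sum>i\<le>n. h i) = h 0 + h 1 + h 2"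
proof -
  have "(\<Sum>i\<le>n. h i) = (\<Sum>i\<in>{0, 1, 2}. h i)"
  proof (rule sum.mono_neutral_right)
    have "h i = 0" if "i \<notin> {0, 1, 2}" for i
      using that by (intro assms) (auto simp: not_le)
    then show "\<forall>i\<in>{..n} - {0, 1, 2}. h i = 0" by blast
  qed (use n in auto)
  then show ?thesis by (simp add: add.assoc)
qed

lemma H_vec3: "H p (vec3 x y z) = x *\<^sub>R s (p 0) + y *\<^sub>R s (p 1) + z *\<^sub>R s (p 2)"
  unfolding herm_def by (subst sum_vec3) (auto simp: vec3_def zero_mult scale_right unit_right)

lemma vn_vec3: "vn (vec3 x y z) = sqrt (x\<^sup>2 + y\<^sup>2 + z\<^sup>2)"
proof -
  have "((vn (vec3 x y z))\<^sup>2) *\<^sub>R e = (x\<^sup>2 + y\<^sup>2 + z\<^sup>2) *\<^sub>R e"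
    unfolding H_self[symmetric] H_vec3
    by (simp add: vec3_def s_scale s_unit power2_eq_square scaleR_add_left)
  moreover have "e \<noteq> 0" using norm_unit by auto
  ultimately have "(vn (vec3 x y z))\<^sup>2 = x\<^sup>2 + y\<^sup>2 + z\<^sup>2" by simp
  then show ?thesis using vn_nonneg by (metis real_sqrt_unique)
qed

lemma vec3_NV: "x\<^sup>2 + y\<^sup>2 + z\<^sup>2 = 1 \<Longrightarrow> vec3 x y z \<in> NV"
  using n by (simp add: NV_iff vn_vec3) (simp add: vec3_def)

text \<open>One reflection moves \<open>p\<close> to axis 0; two more bring \<open>r\<close> into
  the real plane and fix that axis, because each exchanges vectors with equal coordinate 0.
  Reflecting \<open>y\<close> straight onto the target would in general fail, as coordinate 2 of
  \<open>y\<close> need not be real. The detour through \<open>q\<close> absorbs a phase in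
  coordinate 1; beyond coordinate 0, \<open>q\<close> and the target have disjoint supports, so
  their product is real.\<close>

lemma two_vector_normal_form:
  assumes p: "p \<in> NV" and r: "r \<in> NV"
  obtains U \<rho> where "unitary U" "0 \<le> \<rho>" "\<rho> \<le> 1" "line m (U p) = line m (vec3 1 0 0)"
    "line m (U r) = line m (vec3 \<rho> 0 (sqrt (1 - \<rho>\<^sup>2)))"
proof -
  have pz: "p i = 0" "r i = 0" if "i > n" for i using p r that by (auto simp: nonzero_vectors_def)
  have e0: "e \<noteq> 0" using norm_unit by auto
  obtain c where c: "norm c = vn p" "m (s (p 0)) c = (vn p * norm (p 0)) *\<^sub>R e"
    using aligned[of "vn p" "p 0"] vn_nonneg by blast
  define t where "t = mulr (vec3 1 0 0) c"
  have c0: "c \<noteq> 0" using c(1) p by (auto simp: NV_iff)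
  have "H p t = (vn p * norm (p 0)) *\<^sub>R e"
    unfolding t_def H_mulr H_vec3 using c by simp
  moreover have "vn p = vn t" by (simp add: t_def vn_mulr vn_vec3 c)
  moreover have "t i = 0" if "i > n" for i using that n by (simp add: t_def vec3_def zero_mult)
  ultimately obtain U1 where U1: "unitary U1" "U1 p = t"
    using householder[of p t] pz by metis
  define r1 where "r1 = U1 r"
  have r1: "r1 \<in> NV" using U1 r by (auto simp: unitary_def r1_def)
  have vr1: "vn r1 > 0" using r1 by (simp add: NV_iff)
  \<comment> \<open>Right scaling keeps the line of \<open>r1\<close>; \<open>b\<close> normalizes
    it and makes coordinate 0 the real number \<open>\<rho>\<close>.\<close>
  obtain b where b: "norm b = 1 / vn r1" "m (r1 0) b = (norm (r1 0) / vn r1) *\<^sub>R e"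
    using aligned[of "1 / vn r1" "s (r1 0)"] vr1 by (auto simp: s_s norm_s)
  have b0: "b \<noteq> 0" using b(1) vr1 by auto
  define y where "y = mulr r1 b"
  define \<rho> where "\<rho> = norm (r1 0) / vn r1"
  have \<rho>0: "0 \<le> \<rho>" using vr1 by (simp add: \<rho>_def)
  have y0: "y 0 = \<rho> *\<^sub>R e" using b by (simp add: y_def \<rho>_def)
  have vy: "vn y = 1" using b vr1 by (simp add: y_def vn_mulr)
  have yz: "y i = 0" if "i > n" for i using r1 that by (simp add: y_def nonzero_vectors_def zero_mult)
  have "(norm (y 0))\<^sup>2 \<le> (\<Sum>i\<le>n. (norm (y i))\<^sup>2)" by (rule member_le_sum) auto
  then have \<rho>1: "\<rho>\<^sup>2 \<le> 1" using vy by (simp add: y0 norm_unit flip: vn_sq)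
  then have \<rho>_le: "\<rho> \<le> 1" using \<rho>0 by (simp add: abs_square_le_1)
  define \<sigma> where "\<sigma> = sqrt (1 - \<rho>\<^sup>2)"
  have \<sigma>: "\<sigma> \<ge> 0" "\<sigma>\<^sup>2 = 1 - \<rho>\<^sup>2" using \<rho>1 by (simp_all add: \<sigma>_def)
  obtain l where l: "norm l = \<sigma>" "m (s (y 1)) l = (\<sigma> * norm (y 1)) *\<^sub>R e"
    using aligned[OF \<sigma>(1)] by blast
  define q where "q = (\<lambda>i::nat. if i = 0 then \<rho> *\<^sub>R e else if i = 1 then l else (0::'k))"
  have Hq: "H x q = \<rho> *\<^sub>R s (x 0) + m (s (x 1)) l" for x
    unfolding herm_def by (subst sum_vec3) (auto simp: q_def zero_mult scale_right unit_right)
  have "(vn q)\<^sup>2 *\<^sub>R e = (1::real) *\<^sub>R e"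
    unfolding H_self[symmetric] Hq
    by (simp add: q_def s_scale s_unit s_self l \<sigma> power2_eq_square[symmetric] flip: scaleR_add_left)
  then have "(vn q)\<^sup>2 = 1" using e0 unfolding scaleR_cancel_right by simp
  then have vq: "vn q = 1" using vn_nonneg[of q] by (simp add: power2_eq_1_iff)
  have qz: "q i = 0" if "i > n" for i using that n by (simp add: q_def)
  have "H y q = (\<rho> * \<rho> + \<sigma> * norm (y 1)) *\<^sub>R e"
    using l(2) by (simp add: Hq y0 s_scale s_unit scaleR_add_left)
  then obtain U2 where U2: "unitary U2" "U2 y = q" "\<And>z. H y z = H q z \<Longrightarrow> U2 z = z"
    using householder[of y q] yz qz vy vq by metis
  define w where "w = vec3 \<rho> 0 \<sigma>"
  have "H q w = (\<rho> * \<rho>) *\<^sub>R e"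
    unfolding w_def H_vec3 by (simp add: q_def s_scale s_unit s_zero)
  moreover have "vn w = 1" by (simp add: w_def vn_vec3 \<sigma>)
  moreover have "w i = 0" if "i > n" for i using that n by (simp add: w_def vec3_def)
  ultimately obtain U3 where U3: "unitary U3" "U3 q = w" "\<And>z. H q z = H w z \<Longrightarrow> U3 z = z"
    using householder[of q w] qz vq by metis
  have fix2: "U2 (vec3 1 0 0) = vec3 1 0 0"
    by (rule U2(3)) (simp add: H_vec3 y0 q_def)
  have fix3: "U3 (vec3 1 0 0) = vec3 1 0 0"
    by (rule U3(3), unfold H_vec3) (simp add: w_def q_def vec3_def)
  define U where "U = U3 \<circ> U2 \<circ> U1"
  have mul: "V (mulr x a) = mulr (V x) a" if "unitary V" for V x a using that by (simp add: unitary_def)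
  have U: "unitary U" unfolding U_def by (intro unitary_comp U1 U2 U3)
  have "U p = mulr (vec3 1 0 0) c"
    using U1(2) by (simp add: U_def t_def mul[OF U2(1)] mul[OF U3(1)] fix2 fix3)
  then have "line m (U p) = line m (vec3 1 0 0)" using c0 by (simp add: line_mulr)
  moreover have "mulr (U r) b = w"
    using U2(2) U3(2) by (simp add: U_def y_def r1_def flip: mul[OF U2(1)] mul[OF U3(1)])
  then have "line m (U r) = line m w" using line_mulr[OF b0, of "U r"] by simp
  ultimately show ?thesis using that[OF U \<rho>0 \<rho>_le] by (simp add: w_def \<sigma>_def)
qed

lemma two_point_model_proj_space:
  "two_point_model (proj_space m n) ul ({..n} \<times> {..n} \<times> Basis) coord (\<lambda>x y z. line m (vec3 x y z))"
proof
  fix L L' assume L: "L \<in> proj_space m n" "L' \<in> proj_space m n"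
  show "ul L L' = (\<Sum>a\<in>{..n} \<times> {..n} \<times> Basis. coord a L * coord a L')" by (rule ul_eq_sum)
  show "ul L L' \<ge> 0" by (simp add: ul_def uv_def)
  show "L = L'" if "ul L L' = 1" using ul_eq_1D[OF L that] .
  show "\<exists>g. g ` proj_space m n = proj_space m n \<and>
     (\<forall>x\<in>proj_space m n. \<forall>y\<in>proj_space m n. ul (g x) (g y) = ul x y) \<and>
     g L = line m (vec3 1 0 0) \<and> g L' = line m (vec3 (sqrt (ul L L')) 0 (sqrt (1 - ul L L')))"
  proof -
    obtain p r where pr: "p \<in> NV" "L = line m p" "r \<in> NV" "L' = line m r"
      using L by (metis proj_space_cases)
    obtain U \<rho> where U: "unitary U" "0 \<le> \<rho>" "\<rho> \<le> 1" "line m (U p) = line m (vec3 1 0 0)"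
      "line m (U r) = line m (vec3 \<rho> 0 (sqrt (1 - \<rho>\<^sup>2)))"
      using two_vector_normal_form[OF pr(1,3)] by blast
    have \<rho>2: "\<rho>\<^sup>2 \<le> 1" using U by (simp add: abs_square_le_1)
    have g: "(`) U L = line m (vec3 1 0 0)" "(`) U L' = line m (vec3 \<rho> 0 (sqrt (1 - \<rho>\<^sup>2)))"
      using U pr by (simp_all add: unitary_line[OF U(1)])
    have "ul L L' = ul (line m (vec3 1 0 0)) (line m (vec3 \<rho> 0 (sqrt (1 - \<rho>\<^sup>2))))"
      using unitary_ul[OF U(1) L] g by simp
    also have "\<dots> = uv (vec3 1 0 0) (vec3 \<rho> 0 (sqrt (1 - \<rho>\<^sup>2)))"
      using \<rho>2 by (intro ul_line vec3_NV) auto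
    also have "\<dots> = \<rho>\<^sup>2"
      using \<rho>2 U(2) by (simp add: uv_def H_vec3 vn_vec3) (simp add: vec3_def s_unit s_zero norm_unit)
    finally have "ul L L' = \<rho>\<^sup>2" .
    then show ?thesis
      using g U(2) unitary_proj_space[OF U(1)] unitary_ul[OF U(1)]
      by (intro exI[of _ "(`) U"]) simp
  qed
next
  fix L assume L: "L \<in> proj_space m n"
  show "ul L L = 1" by (rule ul_self[OF L])
  obtain p where p: "p \<in> NV" "L = line m p" using L by (rule proj_space_cases)
  have "ul L (line m (vec3 x y z)) = (norm (p 0))\<^sup>2 / (vn p)\<^sup>2 * x\<^sup>2 + (norm (p 1))\<^sup>2 / (vn p)\<^sup>2 * y\<^sup>2 +
     (norm (p 2))\<^sup>2 / (vn p)\<^sup>2 * z\<^sup>2 + 2 * inner (s (p 0)) (s (p 1)) / (vn p)\<^sup>2 * (x * y) +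
     2 * inner (s (p 0)) (s (p 2)) / (vn p)\<^sup>2 * (x * z) + 2 * inner (s (p 1)) (s (p 2)) / (vn p)\<^sup>2 * (y * z)"
    if xyz: "x\<^sup>2 + y\<^sup>2 + z\<^sup>2 = 1" for x y z
  proof -
    have "ul L (line m (vec3 x y z)) = (norm (H p (vec3 x y z)))\<^sup>2 / (vn p)\<^sup>2"
      using p xyz by (simp add: ul_line vec3_NV uv_def vn_vec3)
    also have "(norm (H p (vec3 x y z)))\<^sup>2 = x\<^sup>2 * (norm (p 0))\<^sup>2 + y\<^sup>2 * (norm (p 1))\<^sup>2 + z\<^sup>2 * (norm (p 2))\<^sup>2 +
        2 * (x * y) * inner (s (p 0)) (s (p 1)) + 2 * (x * z) * inner (s (p 0)) (s (p 2)) +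
        2 * (y * z) * inner (s (p 1)) (s (p 2))"
      unfolding H_vec3 norm_s[of "p _", symmetric] power2_norm_eq_inner
      by (simp add: inner_add_left inner_add_right inner_commute power2_eq_square algebra_simps)
    finally show ?thesis by (simp add: add_divide_distrib mult_ac)
  qed
  then show "\<exists>s1 s2 s3 s4 s5 s6. \<forall>x y z. x\<^sup>2 + y\<^sup>2 + z\<^sup>2 = 1 \<longrightarrow> ul L (line m (vec3 x y z)) =
     s1 * x\<^sup>2 + s2 * y\<^sup>2 + s3 * z\<^sup>2 + s4 * (x * y) + s5 * (x * z) + s6 * (y * z)" by blast
next
  fix x y z :: real assume xyz: "x\<^sup>2 + y\<^sup>2 + z\<^sup>2 = 1"
  then show "line m (vec3 x y z) \<in> proj_space m n" using vec3_NV by (simp add: proj_space_def)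
  fix x' y' z' :: real assume xyz': "x'\<^sup>2 + y'\<^sup>2 + z'\<^sup>2 = 1"
  have "H (vec3 x y z) (vec3 x' y' z') = (x * x' + y * y' + z * z') *\<^sub>R e"
    unfolding H_vec3 by (simp add: vec3_def s_scale s_unit scaleR_add_left mult_ac)
  then show "ul (line m (vec3 x y z)) (line m (vec3 x' y' z')) = (x * x' + y * y' + z * z')\<^sup>2"
    using xyz xyz' by (simp add: ul_line vec3_NV uv_def vn_vec3 norm_unit)
qed simp

lemma cos_proj_dist:
  assumes L: "L \<in> proj_space m n" "L' \<in> proj_space m n"
  shows "cos (proj_dist m s n L L' / 2) = 2 * ul L L' - 1"
proof -
  interpret two_point_model "proj_space m n" ul "{..n} \<times> {..n} \<times> Basis" coord "\<lambda>x y z. line m (vec3 x y z)"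
    by (rule two_point_model_proj_space)
  define q where "q = norm (H (rep L) (rep L')) / (vn (rep L) * vn (rep L'))"
  have q2: "q\<^sup>2 = ul L L'" by (simp add: q_def ul_def uv_def power_divide power_mult_distrib)
  have q0: "q \<ge> 0" by (simp add: q_def vn_nonneg)
  have "q\<^sup>2 \<le> 1" using u_le_1[OF L] q2 by simp
  then have "q \<le> 1" using q0 by (simp add: abs_square_le_1)
  then have "cos (2 * arccos q) = 2 * q\<^sup>2 - 1" using q0 by (simp add: cos_double_cos)
  moreover have "proj_dist m s n L L' / 2 = 2 * arccos q"
    unfolding proj_dist_def fs_dist_def rep_def[symmetric] q_def by simp
  ultimately show ?thesis using q2 by simp
qed

end

end

end

interpretation real_scalars: hermitian_scalars "(*)" "\<lambda>a :: real. a" 1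
  by unfold_locales (auto simp: algebra_simps power2_eq_square abs_mult)

interpretation complex_scalars: hermitian_scalars "(*)" cnj 1
proof
  fix a b c :: complex and r :: real
  show "cnj a * a = (norm a)\<^sup>2 *\<^sub>R 1" "a * cnj a = (norm a)\<^sup>2 *\<^sub>R 1"
    using complex_norm_square[of a] by (simp_all add: scaleR_conv_of_real mult.commute)
  show "inner (a * b) c = inner b (cnj a * c)" "inner (a * b) c = inner a (c * cnj b)"
    by (simp_all add: inner_complex_def algebra_simps)
qed (simp_all add: algebra_simps norm_mult)

interpretation quat_scalars: hermitian_scalars quat_mult quat_cnj "(1, 0)"
proof
  fix a b c :: quat and r :: real
  show "quat_mult (quat_mult a b) c = quat_mult a (quat_mult b c)" by (rule quat_mult_assoc)
  show "norm (quat_mult a b) = norm a * norm b" by (rule norm_quat_mult)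
  show "norm (quat_cnj a) = norm a" by (rule norm_quat_cnj)
  show "quat_cnj (quat_mult a b) = quat_mult (quat_cnj b) (quat_cnj a)" by (rule quat_cnj_mult)
  show "quat_mult (quat_cnj a) a = (norm a)\<^sup>2 *\<^sub>R (1, 0)" "quat_mult a (quat_cnj a) = (norm a)\<^sup>2 *\<^sub>R (1, 0)"
    unfolding norm_quat_sq
    by (simp_all add: quat_mult_def quat_cnj_def complex_eq_iff power2_eq_square algebra_simps)
  show "inner (quat_mult a b) c = inner b (quat_mult (quat_cnj a) c)"
    "inner (quat_mult a b) c = inner a (quat_mult c (quat_cnj b))"
    by (simp_all add: quat_mult_def quat_cnj_def inner_prod_def inner_complex_def algebra_simps)
qed (simp_all add: quat_mult_def quat_cnj_def algebra_simps norm_prod_def prod_eq_iff)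

section \<open>The Cayley plane\<close>

lemma oct_comp_cnj: "oct_cnj (oct_cnj x) = x"
  by (simp add: oct_cnj_def quat_cnj_def)

lemma norm_oct_cnj: "norm (oct_cnj x) = norm x"
  by (simp add: norm_prod_def oct_cnj_def quat_cnj_def)

lemma quat_mult_distrib:
  "quat_mult (a + b) c = quat_mult a c + quat_mult b c" "quat_mult a (b + c) = quat_mult a b + quat_mult a c"
  "quat_mult (r *\<^sub>R a) c = r *\<^sub>R quat_mult a c" "quat_mult a (r *\<^sub>R c) = r *\<^sub>R quat_mult a c"
  by (simp_all add: quat_mult_def algebra_simps)

lemma quat_cnj_linear: "quat_cnj (a + b) = quat_cnj a + quat_cnj b" "quat_cnj (r *\<^sub>R a) = r *\<^sub>R quat_cnj a"
  by (simp_all add: quat_cnj_def)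

lemma oct_mult_distrib:
  "oct_mult (a + b) c = oct_mult a c + oct_mult b c" "oct_mult a (b + c) = oct_mult a b + oct_mult a c"
  "oct_mult (r *\<^sub>R a) c = r *\<^sub>R oct_mult a c" "oct_mult a (r *\<^sub>R c) = r *\<^sub>R oct_mult a c"
  by (simp_all add: oct_mult_def quat_mult_distrib quat_cnj_linear scaleR_diff_right scaleR_add_right)

lemma oct_cnj_linear: "oct_cnj (a + b) = oct_cnj a + oct_cnj b" "oct_cnj (r *\<^sub>R a) = r *\<^sub>R oct_cnj a"
  by (simp_all add: oct_cnj_def quat_cnj_linear)

lemma oct_inner_left: "inner (oct_mult a b) c = inner b (oct_mult (oct_cnj a) c)"
  by (simp add: oct_mult_def oct_cnj_def quat_mult_def quat_cnj_def inner_prod_def inner_complex_def algebra_simps)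

lemma oct_inner_right: "inner (oct_mult a b) c = inner a (oct_mult c (oct_cnj b))"
  by (simp add: oct_mult_def oct_cnj_def quat_mult_def quat_cnj_def inner_prod_def inner_complex_def algebra_simps)

lemma oct_cnj_mult: "oct_cnj (oct_mult x y) = oct_mult (oct_cnj y) (oct_cnj x)"
  by (simp add: oct_mult_def oct_cnj_def quat_mult_def quat_cnj_def algebra_simps)

text \<open>The form of the alternative law that replaces associativity below.\<close>

lemma oct_left_inverse: "oct_mult (oct_cnj x) (oct_mult x y) = (norm x)\<^sup>2 *\<^sub>R y"
  unfolding norm_oct_sq norm_quat_sq
  by (simp add: oct_mult_def oct_cnj_def quat_mult_def quat_cnj_def prod_eq_iff
      complex_eq_iff power2_eq_square algebra_simps)

lemma oct_right_inverse: "oct_mult (oct_mult x y) (oct_cnj y) = (norm y)\<^sup>2 *\<^sub>R x"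
proof -
  have "oct_cnj (oct_mult (oct_mult x y) (oct_cnj y)) = oct_mult y (oct_mult (oct_cnj y) (oct_cnj x))"
    by (simp add: oct_cnj_mult oct_comp_cnj)
  also have "\<dots> = (norm y)\<^sup>2 *\<^sub>R oct_cnj x"
    using oct_left_inverse[of "oct_cnj y" "oct_cnj x"] by (simp add: oct_comp_cnj norm_oct_cnj)
  finally show ?thesis by (metis oct_comp_cnj oct_cnj_linear(2))
qed

lemma oct_left_inverse': "oct_mult x (oct_mult (oct_cnj x) y) = (norm x)\<^sup>2 *\<^sub>R y"
  using oct_left_inverse[of "oct_cnj x" y] by (simp add: oct_comp_cnj norm_oct_cnj)

text \<open>Polarization of \<open>oct_left_inverse\<close>: a Clifford relation for left
  multiplications.\<close>

lemma oct_left_polarized: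
  "oct_mult (oct_cnj a) (oct_mult b x) + oct_mult (oct_cnj b) (oct_mult a x) = (2 * inner a b) *\<^sub>R x"
proof -
  have "(norm (a + b))\<^sup>2 *\<^sub>R x = oct_mult (oct_cnj (a + b)) (oct_mult (a + b) x)" by (simp add: oct_left_inverse)
  also have "\<dots> = (norm a)\<^sup>2 *\<^sub>R x + (norm b)\<^sup>2 *\<^sub>R x +
     (oct_mult (oct_cnj a) (oct_mult b x) + oct_mult (oct_cnj b) (oct_mult a x))"
    by (simp add: oct_cnj_linear oct_mult_distrib oct_left_inverse)
  finally show ?thesis
    by (simp add: power2_norm_eq_inner inner_add_left inner_add_right inner_commute algebra_simps)
qed

lemma oct_minus: "oct_mult (- a) b = - oct_mult a b" "oct_mult a (- b) = - oct_mult a b"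
  using oct_mult_distrib(3)[of "-1" a b] oct_mult_distrib(4)[of a "-1" b] by simp_all

lemma oct_diff: "oct_mult (a - c) b = oct_mult a b - oct_mult c b" "oct_mult a (b - c) = oct_mult a b - oct_mult a c"
  "oct_cnj (a - c) = oct_cnj a - oct_cnj c"
  using oct_mult_distrib(1)[of a "- c" b] oct_mult_distrib(2)[of a b "- c"] oct_cnj_linear(1)[of a "- c"]
    oct_cnj_linear(2)[of "-1" c]
  by (simp_all add: oct_minus)

lemma oct_zero: "oct_mult 0 a = 0" "oct_mult a 0 = 0" "oct_cnj 0 = 0"
  using oct_mult_distrib(3)[of 0 0 a] oct_mult_distrib(4)[of a 0 0] oct_cnj_linear(2)[of 0 0] by simp_all

lemma norm_oct_one: "norm oct_one = 1"
  by (simp add: oct_one_def norm_prod_def)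

lemma inner_oct_one: "inner oct_one oct_one = 1"
  using norm_oct_one by (simp add: norm_eq_sqrt_inner)

lemma oct_cnj_one: "oct_cnj oct_one = oct_one"
  by (simp add: oct_cnj_def oct_one_def quat_cnj_def zero_prod_def)

text \<open>The tuple \<open>(\<alpha>, \<beta>, \<gamma>, x, y, w)\<close> stands for the Hermitian matrix with diagonal \<open>\<alpha>, \<beta>, \<gamma>\<close> and lower
  entries \<open>x\<close> (21), \<open>y\<close> (31), \<open>w\<close> (32). The single relation \<open>\<beta> y = w x\<close> already forces the other two
  off-diagonal equations of an idempotent, because \<open>x = w = 0\<close> when \<open>\<beta> = 0\<close>.\<close>

type_synonym oct_herm3 = "real \<times> real \<times> real \<times> oct \<times> oct \<times> oct"

definition cayley_tuples :: "oct_herm3 set" where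
  "cayley_tuples = {(\<alpha>, \<beta>, \<gamma>, x, y, w). \<alpha> + \<beta> + \<gamma> = 1 \<and> (norm x)\<^sup>2 = \<alpha> * \<beta> \<and> (norm y)\<^sup>2 = \<alpha> * \<gamma> \<and>
     (norm w)\<^sup>2 = \<beta> * \<gamma> \<and> \<beta> *\<^sub>R y = oct_mult w x}"

text \<open>The trace form of the Jordan product; each off-diagonal entry occurs twice in the
  matrix, hence the factors 2.\<close>

definition tuple_inner :: "oct_herm3 \<Rightarrow> oct_herm3 \<Rightarrow> real" where
  "tuple_inner = (\<lambda>(\<alpha>, \<beta>, \<gamma>, x, y, w) (\<alpha>', \<beta>', \<gamma>', x', y', w').
     \<alpha> * \<alpha>' + \<beta> * \<beta>' + \<gamma> * \<gamma>' + 2 * inner x x' + 2 * inner y y' + 2 * inner w w')"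

text \<open>For a real unit vector, the orthogonal projection onto its line.\<close>

definition real_tuple :: "real \<Rightarrow> real \<Rightarrow> real \<Rightarrow> oct_herm3" where
  "real_tuple x y z = (x\<^sup>2, y\<^sup>2, z\<^sup>2, (x * y) *\<^sub>R oct_one, (x * z) *\<^sub>R oct_one, (y * z) *\<^sub>R oct_one)"

text \<open>Conjugation by the Hermitian involution with lower right block \<open>(r, b\<^sup>*; b, -r)\<close>: a reflection of
  \<open>((\<beta> - \<gamma>) / 2, w)\<close> in the nine-dimensional vector \<open>(r, b)\<close>, and the corresponding Clifford action
  on \<open>(x, y)\<close>.\<close>

definition cayley_reflection :: "real \<Rightarrow> oct \<Rightarrow> oct_herm3 \<Rightarrow> oct_herm3" where
  "cayley_reflection r b = (\<lambda>(\<alpha>, \<beta>, \<gamma>, x, y, w).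
     let k = r * ((\<beta> - \<gamma>) / 2) + inner w b in
     (\<alpha>, \<gamma> + 2 * k * r, \<beta> - 2 * k * r, r *\<^sub>R x + oct_mult (oct_cnj b) y, oct_mult b x - r *\<^sub>R y, (2 * k) *\<^sub>R b - w))"

text \<open>Conjugation by the exchange of the first two basis vectors: entry 21 becomes entry 12,
  hence the conjugate, and entries 31 and 32 trade places.\<close>

definition cayley_swap :: "oct_herm3 \<Rightarrow> oct_herm3" where
  "cayley_swap = (\<lambda>(\<alpha>, \<beta>, \<gamma>, x, y, w). (\<beta>, \<alpha>, \<gamma>, oct_cnj x, w, y))"

section \<open>Trace-one idempotents as tuples, and their isometries\<close>

text \<open>For nonzero \<open>\<beta>\<close>, multiply the defining relation by the conjugate of
  \<open>w\<close> on the left or of \<open>x\<close> on the right, apply the alternative laws and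
  cancel \<open>\<beta>\<close>.\<close>

lemma cayley_tuples_eqs:
  assumes "(\<alpha>, \<beta>, \<gamma>, x, y, w) \<in> cayley_tuples"
  shows "oct_mult (oct_cnj w) y = \<gamma> *\<^sub>R x" "oct_mult y (oct_cnj x) = \<alpha> *\<^sub>R w"
proof -
  have *: "(norm x)\<^sup>2 = \<alpha> * \<beta>" "(norm w)\<^sup>2 = \<beta> * \<gamma>" "\<beta> *\<^sub>R y = oct_mult w x"
    using assms by (auto simp: cayley_tuples_def)
  have 1: "\<beta> *\<^sub>R oct_mult (oct_cnj w) y = \<beta> *\<^sub>R (\<gamma> *\<^sub>R x)"
    using oct_left_inverse[of w x] *(2) by (simp add: *(3)[symmetric] oct_mult_distrib)
  have 2: "\<beta> *\<^sub>R oct_mult y (oct_cnj x) = \<beta> *\<^sub>R (\<alpha> *\<^sub>R w)"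
    using oct_right_inverse[of w x] *(1) by (simp add: *(3)[symmetric] oct_mult_distrib mult.commute)
  have "(oct_mult (oct_cnj w) y = \<gamma> *\<^sub>R x) \<and> (oct_mult y (oct_cnj x) = \<alpha> *\<^sub>R w)"
  proof (cases "\<beta> = 0")
    case True
    then have "x = 0" "w = 0" using *(1,2) by simp_all
    then show ?thesis by (simp add: oct_zero)
  next
    case False
    then show ?thesis using 1 2 unfolding scaleR_cancel_left by blast
  qed
  then show "oct_mult (oct_cnj w) y = \<gamma> *\<^sub>R x" "oct_mult y (oct_cnj x) = \<alpha> *\<^sub>R w" by auto
qed

text \<open>Trace and norm conditions give \<open>\<alpha> - \<alpha>\<^sup>2 = (norm x)\<^sup>2 +
  (norm y)\<^sup>2\<close>.\<close>

lemma cayley_tuples_nonneg: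
  assumes "(\<alpha>, \<beta>, \<gamma>, x, y, w) \<in> cayley_tuples"
  shows "0 \<le> \<alpha>" "\<alpha> \<le> 1"
proof -
  have *: "\<alpha> + \<beta> + \<gamma> = 1" "\<alpha> * \<beta> \<ge> 0" "\<alpha> * \<gamma> \<ge> 0"
    using assms zero_le_power2[of "norm x"] zero_le_power2[of "norm y"] by (auto simp: cayley_tuples_def)
  have "\<alpha> - \<alpha> * \<alpha> = \<alpha> * \<beta> + \<alpha> * \<gamma>"
  proof -
    have "\<alpha> * \<beta> + \<alpha> * \<gamma> = \<alpha> * (\<beta> + \<gamma>)" by (simp add: algebra_simps)
    also have "\<beta> + \<gamma> = 1 - \<alpha>" using *(1) by simp
    finally show ?thesis by (simp add: algebra_simps)
  qed
  then have "\<alpha> * \<alpha> \<le> \<alpha>" using * by simp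
  moreover then show "0 \<le> \<alpha>" using zero_le_square[of \<alpha>] by linarith
  ultimately show "\<alpha> \<le> 1" using mult_left_mono[of 1 \<alpha> \<alpha>] by (cases "\<alpha> = 0") (auto simp: not_le[symmetric] mult_le_cancel_left1)
qed

lemma cayley_reflection_in:
  assumes rb: "r\<^sup>2 + (norm b)\<^sup>2 = 1" and p: "p \<in> cayley_tuples"
  shows "cayley_reflection r b p \<in> cayley_tuples"
proof -
  obtain \<alpha> \<beta> \<gamma> x y w where peq: "p = (\<alpha>, \<beta>, \<gamma>, x, y, w)" by (cases p)
  have pt: "(\<alpha>, \<beta>, \<gamma>, x, y, w) \<in> cayley_tuples" using p peq by simp
  have tr: "\<alpha> + \<beta> + \<gamma> = 1" and nx: "(norm x)\<^sup>2 = \<alpha> * \<beta>" and ny: "(norm y)\<^sup>2 = \<alpha> * \<gamma>"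
    and nw: "(norm w)\<^sup>2 = \<beta> * \<gamma>" and yw: "\<beta> *\<^sub>R y = oct_mult w x"
    using pt by (auto simp: cayley_tuples_def)
  have wy: "oct_mult (oct_cnj w) y = \<gamma> *\<^sub>R x" and yx: "oct_mult y (oct_cnj x) = \<alpha> *\<^sub>R w"
    using cayley_tuples_eqs[OF pt] .
  define B where "B = inner w b"
  define k where "k = r * ((\<beta> - \<gamma>) / 2) + B"
  have nb: "(norm b)\<^sup>2 = 1 - r\<^sup>2" using rb by simp
  \<comment> \<open>The mixed term of both new norms: \<open>yx\<close> trades the pair
    \<open>x\<close>, \<open>y\<close> for \<open>w\<close>.\<close>
  have cross: "inner (oct_mult b x) y = \<alpha> * B"
  proof -
    have "inner (oct_mult b x) y = inner b (oct_mult y (oct_cnj x))" by (rule oct_inner_right)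
    then show ?thesis by (simp add: yx B_def inner_commute)
  qed
  have cross': "inner x (oct_mult (oct_cnj b) y) = \<alpha> * B"
    using oct_inner_left[of b x y] cross by simp
  have nx': "(norm (r *\<^sub>R x + oct_mult (oct_cnj b) y))\<^sup>2 = \<alpha> * (\<gamma> + 2 * k * r)"
  proof -
    have "(norm (r *\<^sub>R x + oct_mult (oct_cnj b) y))\<^sup>2 =
       r\<^sup>2 * (norm x)\<^sup>2 + 2 * r * inner x (oct_mult (oct_cnj b) y) + (norm (oct_mult (oct_cnj b) y))\<^sup>2"
      unfolding power2_norm_eq_inner
      by (simp add: inner_add_left inner_add_right inner_commute power2_eq_square algebra_simps)
    also have "\<dots> = r\<^sup>2 * (\<alpha> * \<beta>) + 2 * r * (\<alpha> * B) + (1 - r\<^sup>2) * (\<alpha> * \<gamma>)"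
      by (simp add: cross' nx norm_oct_mult norm_oct_cnj power_mult_distrib nb ny)
    finally show ?thesis by (simp add: k_def power2_eq_square algebra_simps diff_divide_distrib)
  qed
  have ny': "(norm (oct_mult b x - r *\<^sub>R y))\<^sup>2 = \<alpha> * (\<beta> - 2 * k * r)"
  proof -
    have "(norm (oct_mult b x - r *\<^sub>R y))\<^sup>2 =
       (norm (oct_mult b x))\<^sup>2 - 2 * r * inner (oct_mult b x) y + r\<^sup>2 * (norm y)\<^sup>2"
      unfolding power2_norm_eq_inner
      by (simp add: inner_diff_left inner_diff_right inner_commute power2_eq_square algebra_simps)
    also have "\<dots> = (1 - r\<^sup>2) * (\<alpha> * \<beta>) - 2 * r * (\<alpha> * B) + r\<^sup>2 * (\<alpha> * \<gamma>)"
      by (simp add: cross ny norm_oct_mult power_mult_distrib nb nx)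
    finally show ?thesis by (simp add: k_def power2_eq_square algebra_simps diff_divide_distrib)
  qed
  have nw': "(norm ((2 * k) *\<^sub>R b - w))\<^sup>2 = (\<gamma> + 2 * k * r) * (\<beta> - 2 * k * r)"
  proof -
    have "(norm ((2 * k) *\<^sub>R b - w))\<^sup>2 = 4 * k\<^sup>2 * (norm b)\<^sup>2 - 4 * k * B + (norm w)\<^sup>2"
      unfolding power2_norm_eq_inner
      by (simp add: B_def inner_diff_left inner_diff_right inner_commute power2_eq_square algebra_simps)
    also have "\<dots> = 4 * k * (k - B) - 4 * k\<^sup>2 * r\<^sup>2 + \<beta> * \<gamma>"
      unfolding nb nw by (simp add: power2_eq_square algebra_simps)
    also have "k - B = r * ((\<beta> - \<gamma>) / 2)" by (simp add: k_def)
    finally show ?thesis by (simp add: power2_eq_square algebra_simps diff_divide_distrib)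
  qed
  have "(\<gamma> + 2 * k * r) *\<^sub>R (oct_mult b x - r *\<^sub>R y) =
      oct_mult ((2 * k) *\<^sub>R b - w) (r *\<^sub>R x + oct_mult (oct_cnj b) y)"
  proof -
    \<comment> \<open>The Clifford relation interchanges the two left multiplications, after which
      \<open>wy\<close> applies without associativity.\<close>
    have pol: "oct_mult w (oct_mult (oct_cnj b) y) = (2 * B) *\<^sub>R y - \<gamma> *\<^sub>R oct_mult b x"
    proof -
      have "oct_mult (oct_cnj (oct_cnj w)) (oct_mult (oct_cnj b) y) + oct_mult (oct_cnj (oct_cnj b)) (oct_mult (oct_cnj w) y)
         = (2 * inner (oct_cnj w) (oct_cnj b)) *\<^sub>R y" by (rule oct_left_polarized)
      moreover have "inner (oct_cnj w) (oct_cnj b) = B"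
        by (simp add: B_def oct_cnj_def quat_cnj_def inner_prod_def inner_complex_def)
      ultimately show ?thesis by (simp add: oct_comp_cnj wy oct_mult_distrib algebra_simps)
    qed
    have "oct_mult ((2 * k) *\<^sub>R b - w) (r *\<^sub>R x + oct_mult (oct_cnj b) y) =
       (2 * k * r) *\<^sub>R oct_mult b x + (2 * k * (norm b)\<^sup>2) *\<^sub>R y - (r * \<beta>) *\<^sub>R y - (2 * B) *\<^sub>R y + \<gamma> *\<^sub>R oct_mult b x"
      by (simp add: oct_diff oct_mult_distrib oct_left_inverse' pol algebra_simps flip: yw)
    also have "\<dots> = (\<gamma> + 2 * k * r) *\<^sub>R oct_mult b x + (2 * k * (norm b)\<^sup>2 - r * \<beta> - 2 * B) *\<^sub>R y"
      by (simp add: algebra_simps)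
    also have "2 * k * (norm b)\<^sup>2 - r * \<beta> - 2 * B = - ((\<gamma> + 2 * k * r) * r)"
      unfolding nb by (simp add: k_def power2_eq_square algebra_simps diff_divide_distrib)
    finally show ?thesis by (simp add: algebra_simps)
  qed
  moreover have "cayley_reflection r b p = (\<alpha>, \<gamma> + 2 * k * r, \<beta> - 2 * k * r,
      r *\<^sub>R x + oct_mult (oct_cnj b) y, oct_mult b x - r *\<^sub>R y, (2 * k) *\<^sub>R b - w)"
    by (simp add: peq cayley_reflection_def Let_def k_def B_def)
  ultimately show ?thesis using tr nx' ny' nw' by (simp add: cayley_tuples_def)
qed

lemma cayley_reflection_invol:
  assumes rb: "r\<^sup>2 + (norm b)\<^sup>2 = 1"
  shows "cayley_reflection r b (cayley_reflection r b p) = p"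
proof -
  obtain \<alpha> \<beta> \<gamma> x y w where peq: "p = (\<alpha>, \<beta>, \<gamma>, x, y, w)" by (cases p)
  define k where "k = r * ((\<beta> - \<gamma>) / 2) + inner w b"
  have nb: "(norm b)\<^sup>2 = 1 - r\<^sup>2" using rb by simp
  have B: "inner w b = k - r * ((\<beta> - \<gamma>) / 2)" by (simp add: k_def)
  \<comment> \<open>The vector \<open>((\<beta> - \<gamma>) / 2, w)\<close> is sent to
    \<open>2 * k\<close> times the unit vector \<open>(r, b)\<close> minus itself, whose product
    with \<open>(r, b)\<close> is again \<open>2 * k - k = k\<close>.\<close>
  have k': "r * (((\<gamma> + 2 * k * r) - (\<beta> - 2 * k * r)) / 2) + inner ((2 * k) *\<^sub>R b - w) b = k"
  proof -
    have "inner ((2 * k) *\<^sub>R b - w) b = 2 * k * (norm b)\<^sup>2 - inner w b"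
      by (simp add: inner_diff_left power2_norm_eq_inner)
    also have "\<dots> = 2 * k - 2 * k * r\<^sup>2 - (k - r * ((\<beta> - \<gamma>) / 2))"
      unfolding nb B by (simp add: algebra_simps)
    finally show ?thesis
      by (simp add: power2_eq_square algebra_simps add_divide_distrib diff_divide_distrib)
  qed
  have 1: "r *\<^sub>R (r *\<^sub>R x + oct_mult (oct_cnj b) y) + oct_mult (oct_cnj b) (oct_mult b x - r *\<^sub>R y) = x"
  proof -
    have "r *\<^sub>R (r *\<^sub>R x + oct_mult (oct_cnj b) y) + oct_mult (oct_cnj b) (oct_mult b x - r *\<^sub>R y) = (r\<^sup>2 + (norm b)\<^sup>2) *\<^sub>R x"
      by (simp add: oct_diff oct_mult_distrib oct_left_inverse power2_eq_square algebra_simps)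
    then show ?thesis by (simp add: rb)
  qed
  have 2: "oct_mult b (r *\<^sub>R x + oct_mult (oct_cnj b) y) - r *\<^sub>R (oct_mult b x - r *\<^sub>R y) = y"
  proof -
    have "oct_mult b (r *\<^sub>R x + oct_mult (oct_cnj b) y) - r *\<^sub>R (oct_mult b x - r *\<^sub>R y) = (r\<^sup>2 + (norm b)\<^sup>2) *\<^sub>R y"
      by (simp add: oct_mult_distrib oct_left_inverse' power2_eq_square algebra_simps)
    then show ?thesis by (simp add: rb)
  qed
  have "cayley_reflection r b p = (\<alpha>, \<gamma> + 2 * k * r, \<beta> - 2 * k * r, r *\<^sub>R x + oct_mult (oct_cnj b) y, oct_mult b x - r *\<^sub>R y, (2 * k) *\<^sub>R b - w)"
    by (simp add: peq cayley_reflection_def Let_def k_def)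
  then show ?thesis
    by (simp only: cayley_reflection_def Let_def prod.case k' 1 2) (simp add: peq)
qed

lemma cayley_reflection_inner:
  assumes rb: "r\<^sup>2 + (norm b)\<^sup>2 = 1"
  shows "tuple_inner (cayley_reflection r b p) (cayley_reflection r b q) = tuple_inner p q"
proof -
  obtain \<alpha> \<beta> \<gamma> x y w where peq: "p = (\<alpha>, \<beta>, \<gamma>, x, y, w)" by (cases p)
  obtain \<alpha>' \<beta>' \<gamma>' x' y' w' where qeq: "q = (\<alpha>', \<beta>', \<gamma>', x', y', w')" by (cases q)
  define k where "k = r * ((\<beta> - \<gamma>) / 2) + inner w b"
  define k' where "k' = r * ((\<beta>' - \<gamma>') / 2) + inner w' b"
  have nb: "inner b b = 1 - r * r" using rb by (simp add: power2_norm_eq_inner[symmetric] power2_eq_square)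
  have adj: "inner (oct_mult (oct_cnj b) y) x' = inner (oct_mult b x') y" for y x'
    by (metis inner_commute oct_inner_left)
  have nm: "inner (oct_mult (oct_cnj b) y) (oct_mult (oct_cnj b) y') = (1 - r * r) * inner y y'"
    using oct_inner_left[of "oct_cnj b" y "oct_mult (oct_cnj b) y'"]
    by (simp add: oct_comp_cnj oct_left_inverse' power2_norm_eq_inner nb)
  have nm': "inner (oct_mult b x) (oct_mult b x') = (1 - r * r) * inner x x'"
    using oct_inner_left[of b x "oct_mult b x'"] by (simp add: oct_left_inverse power2_norm_eq_inner nb)
  \<comment> \<open>The Clifford action on the pair \<open>(x, y)\<close> is orthogonal.\<close>
  have xy: "inner (r *\<^sub>R x + oct_mult (oct_cnj b) y) (r *\<^sub>R x' + oct_mult (oct_cnj b) y') +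
      inner (oct_mult b x - r *\<^sub>R y) (oct_mult b x' - r *\<^sub>R y') = inner x x' + inner y y'"
    by (simp add: inner_add_left inner_add_right inner_diff_left inner_diff_right nm nm' adj[of y x'] adj[of y' x]
        inner_commute[of x "oct_mult (oct_cnj b) y'"] inner_commute[of y "oct_mult b x'"] algebra_simps)
  have ww: "inner ((2 * k) *\<^sub>R b - w) ((2 * k') *\<^sub>R b - w') =
      4 * k * k' * (1 - r * r) - 2 * k * (k' - r * ((\<beta>' - \<gamma>') / 2)) - 2 * k' * (k - r * ((\<beta> - \<gamma>) / 2)) + inner w w'"
  proof -
    have "inner ((2 * k) *\<^sub>R b - w) ((2 * k') *\<^sub>R b - w') =
      4 * k * k' * inner b b - 2 * k * inner w' b - 2 * k' * inner w b + inner w w'"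
      by (simp add: inner_diff_left inner_diff_right inner_commute[of b w'] algebra_simps)
    then show ?thesis unfolding nb by (simp add: k_def k'_def)
  qed
  have "tuple_inner (cayley_reflection r b p) (cayley_reflection r b q) =
     \<alpha> * \<alpha>' + (\<gamma> + 2 * k * r) * (\<gamma>' + 2 * k' * r) + (\<beta> - 2 * k * r) * (\<beta>' - 2 * k' * r) +
     2 * (inner (r *\<^sub>R x + oct_mult (oct_cnj b) y) (r *\<^sub>R x' + oct_mult (oct_cnj b) y') +
      inner (oct_mult b x - r *\<^sub>R y) (oct_mult b x' - r *\<^sub>R y')) +
     2 * inner ((2 * k) *\<^sub>R b - w) ((2 * k') *\<^sub>R b - w')"
    unfolding peq qeq cayley_reflection_def tuple_inner_def Let_def prod.case k_def k'_def by (simp only: distrib_left add.assoc)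
  also have "\<dots> = tuple_inner p q"
    unfolding xy ww by (simp add: peq qeq tuple_inner_def field_simps)
  finally show ?thesis .
qed

definition cayley_isometry :: "(oct_herm3 \<Rightarrow> oct_herm3) \<Rightarrow> bool" where
  "cayley_isometry g \<longleftrightarrow> g ` cayley_tuples = cayley_tuples \<and>
     (\<forall>p\<in>cayley_tuples. \<forall>q\<in>cayley_tuples. tuple_inner (g p) (g q) = tuple_inner p q)"

lemma cayley_isometry_in: "cayley_isometry g \<Longrightarrow> p \<in> cayley_tuples \<Longrightarrow> g p \<in> cayley_tuples"
  unfolding cayley_isometry_def by blast

lemma cayley_isometry_comp:
  assumes g: "cayley_isometry g" and h: "cayley_isometry h"
  shows "cayley_isometry (g \<circ> h)"
proof -
  have "(g \<circ> h) ` cayley_tuples = cayley_tuples"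
    using g h unfolding cayley_isometry_def by (simp only: image_comp[symmetric])
  moreover have "tuple_inner (g (h p)) (g (h q)) = tuple_inner p q" if "p \<in> cayley_tuples" "q \<in> cayley_tuples" for p q
    using g h that cayley_isometry_in[OF h] unfolding cayley_isometry_def by metis
  ultimately show ?thesis by (simp add: cayley_isometry_def)
qed

lemma cayley_isometry_reflection:
  assumes "r\<^sup>2 + (norm b)\<^sup>2 = 1"
  shows "cayley_isometry (cayley_reflection r b)"
proof -
  have "p \<in> cayley_reflection r b ` cayley_tuples" if "p \<in> cayley_tuples" for p
    using cayley_reflection_invol[OF assms, of p] cayley_reflection_in[OF assms that] by (metis imageI)
  then show ?thesis
    using cayley_reflection_in[OF assms] cayley_reflection_inner[OF assms] by (auto simp: cayley_isometry_def)
qed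

lemma cayley_isometry_swap: "cayley_isometry cayley_swap"
proof -
  have "cayley_swap p \<in> cayley_tuples" if "p \<in> cayley_tuples" for p
  proof -
    obtain \<alpha> \<beta> \<gamma> x y w where peq: "p = (\<alpha>, \<beta>, \<gamma>, x, y, w)" by (cases p)
    then have pt: "(\<alpha>, \<beta>, \<gamma>, x, y, w) \<in> cayley_tuples" using that by simp
    then show ?thesis using cayley_tuples_eqs(2)[OF pt]
      by (simp add: peq cayley_swap_def cayley_tuples_def norm_oct_cnj mult.commute algebra_simps)
  qed
  moreover have invol: "cayley_swap (cayley_swap p) = p" for p
    by (cases p) (simp add: cayley_swap_def oct_comp_cnj)
  moreover have "inner (oct_cnj x) (oct_cnj y) = inner x y" for x y
    by (simp add: oct_cnj_def quat_cnj_def inner_prod_def inner_complex_def)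
  then have "tuple_inner (cayley_swap p) (cayley_swap q) = tuple_inner p q" for p q
    by (cases p, cases q) (simp add: cayley_swap_def tuple_inner_def)
  moreover have "p \<in> cayley_swap ` cayley_tuples" if "p \<in> cayley_tuples" for p
    using calculation(1)[OF that] invol[of p] by (metis imageI)
  ultimately show ?thesis unfolding cayley_isometry_def by auto
qed

lemma real_tuple_in:
  assumes "x\<^sup>2 + y\<^sup>2 + z\<^sup>2 = 1"
  shows "real_tuple x y z \<in> cayley_tuples"
  using assms
  by (simp add: real_tuple_def cayley_tuples_def norm_oct_one power_mult_distrib oct_mult_distrib oct_mult_one power2_eq_square mult_ac)

lemma cayley_reflection_base: "cayley_reflection r b (real_tuple 1 0 0) = real_tuple 1 0 0"
  by (simp add: cayley_reflection_def real_tuple_def oct_zero)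

text \<open>One reflection annihilates the second diagonal entry, and with it \<open>x\<close> and
  \<open>w\<close> by the norm conditions; two reflections with \<open>r = 0\<close> then make
  \<open>y\<close> a nonnegative real. All three fix the base point by
  \<open>cayley_reflection_base\<close>.\<close>

lemma cayley_stabilizer_normal_form:
  assumes p: "p \<in> cayley_tuples"
  obtains g where "cayley_isometry g" "g (real_tuple 1 0 0) = real_tuple 1 0 0"
    "g p = real_tuple (sqrt (fst p)) 0 (sqrt (1 - fst p))"
proof -
  obtain \<alpha> \<beta> \<gamma> x y w where peq: "p = (\<alpha>, \<beta>, \<gamma>, x, y, w)" by (cases p)
  have pt: "(\<alpha>, \<beta>, \<gamma>, x, y, w) \<in> cayley_tuples" using p peq by simp
  then have tr: "\<alpha> + \<beta> + \<gamma> = 1" and nw: "(norm w)\<^sup>2 = \<beta> * \<gamma>" by (auto simp: cayley_tuples_def)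
  have \<alpha>: "0 \<le> \<alpha>" "\<alpha> \<le> 1" using cayley_tuples_nonneg[OF pt] .
  have "\<exists>r b. r\<^sup>2 + (norm b)\<^sup>2 = 1 \<and> \<gamma> + 2 * (r * ((\<beta> - \<gamma>) / 2) + inner w b) * r = 0"
  proof (cases "\<gamma> = 0")
    case True
    then show ?thesis by (intro exI[of _ 0] exI[of _ oct_one]) (simp add: norm_oct_one)
  next
    case False
    \<comment> \<open>The length of \<open>(- \<gamma>, w)\<close>, which is the sum of
      \<open>((\<beta> - \<gamma>) / 2, w)\<close> and its wanted image
      \<open>(- (\<beta> + \<gamma>) / 2, 0)\<close>. These have equal length, so the reflection in
      the direction of their sum exchanges them.\<close>
    define s where "s = sqrt (\<gamma>\<^sup>2 + (norm w)\<^sup>2)"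
    have pos: "\<gamma>\<^sup>2 + (norm w)\<^sup>2 > 0" using False by (simp add: add_pos_nonneg)
    have s0: "s > 0" and s2: "s\<^sup>2 = \<gamma>\<^sup>2 + \<beta> * \<gamma>" using nw pos by (simp_all add: s_def)
    have "(- \<gamma> / s)\<^sup>2 + (norm ((1 / s) *\<^sub>R w))\<^sup>2 = (\<gamma>\<^sup>2 + (norm w)\<^sup>2) / s\<^sup>2"
      using s0 by (simp add: power_divide power_mult_distrib add_divide_distrib)
    also have "\<dots> = 1" using pos s2 nw by simp
    finally have 1: "(- \<gamma> / s)\<^sup>2 + (norm ((1 / s) *\<^sub>R w))\<^sup>2 = 1" .
    have "inner w ((1 / s) *\<^sub>R w) = \<beta> * \<gamma> / s" using nw by (simp add: power2_norm_eq_inner)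
    then have "\<gamma> + 2 * ((- \<gamma> / s) * ((\<beta> - \<gamma>) / 2) + inner w ((1 / s) *\<^sub>R w)) * (- \<gamma> / s) =
        \<gamma> - \<gamma> * (\<gamma>\<^sup>2 + \<beta> * \<gamma>) / s\<^sup>2"
      using s0 by (simp add: field_simps power2_eq_square)
    also have "\<dots> = 0" using s0 by (simp flip: s2)
    finally show ?thesis using 1 by blast
  qed
  then obtain r b where rb: "r\<^sup>2 + (norm b)\<^sup>2 = 1" and zero: "\<gamma> + 2 * (r * ((\<beta> - \<gamma>) / 2) + inner w b) * r = 0"
    by blast
  define g1 where "g1 = cayley_reflection r b"
  have g1: "cayley_isometry g1" unfolding g1_def by (rule cayley_isometry_reflection[OF rb])
  obtain \<gamma>1 x1 y1 w1 where g1p: "g1 p = (\<alpha>, 0, \<gamma>1, x1, y1, w1)"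
    using zero unfolding g1_def peq cayley_reflection_def Let_def prod.case by metis
  have "g1 p \<in> cayley_tuples" using g1 p by (rule cayley_isometry_in)
  then have *: "\<gamma>1 = 1 - \<alpha>" "x1 = 0" "w1 = 0" "(norm y1)\<^sup>2 = \<alpha> * (1 - \<alpha>)"
    by (auto simp: g1p cayley_tuples_def)
  have ny: "norm y1 = sqrt \<alpha> * sqrt (1 - \<alpha>)"
    using *(4) by (metis norm_ge_zero real_sqrt_mult real_sqrt_unique)
  have target: "real_tuple (sqrt \<alpha>) 0 (sqrt (1 - \<alpha>)) = (\<alpha>, 0, 1 - \<alpha>, 0, norm y1 *\<^sub>R oct_one, 0)"
    using \<alpha> by (simp add: real_tuple_def ny)
  define c where "c = (if y1 = 0 then oct_one else (1 / norm y1) *\<^sub>R y1)"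
  have c: "norm c = 1" by (simp add: c_def norm_oct_one)
  have cy: "oct_mult (oct_cnj c) y1 = norm y1 *\<^sub>R oct_one"
  proof (cases "y1 = 0")
    case False
    have "oct_mult (oct_cnj y1) (oct_mult y1 oct_one) = (norm y1)\<^sup>2 *\<^sub>R oct_one" by (rule oct_left_inverse)
    then show ?thesis using False
      by (simp add: c_def oct_cnj_linear oct_mult_distrib oct_mult_one power2_eq_square)
  qed (simp add: oct_zero)
  \<comment> \<open>The reflection with \<open>c\<close> moves \<open>y1\<close> to the place of
    \<open>x\<close> and strips its phase; the one with \<open>oct_one\<close> moves it back. The
    diagonal entries are exchanged twice.\<close>
  define g where "g = cayley_reflection 0 oct_one \<circ> cayley_reflection 0 c \<circ> g1"
  have "cayley_isometry g"
    unfolding g_def using c norm_oct_one by (intro cayley_isometry_comp cayley_isometry_reflection g1) auto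
  moreover have "g (real_tuple 1 0 0) = real_tuple 1 0 0"
    by (simp add: g_def g1_def cayley_reflection_base)
  moreover have fp: "fst p = \<alpha>" by (simp add: peq)
  have "g p = real_tuple (sqrt (fst p)) 0 (sqrt (1 - fst p))"
    unfolding g_def comp_def g1p * fp target
    by (simp add: cayley_reflection_def cy oct_zero oct_mult_distrib oct_mult_one oct_cnj_one)
  ultimately show ?thesis by (rule that)
qed

text \<open>Reflections keep the first diagonal entry, so the remaining motion within the real plane
  is done in the last two coordinates, between two swaps.\<close>

lemma cayley_transitive:
  assumes p: "p \<in> cayley_tuples"
  obtains g where "cayley_isometry g" "g p = real_tuple 1 0 0"
proof -
  define a where "a = sqrt (fst p)"
  define c where "c = sqrt (1 - fst p)"
  obtain \<alpha> \<beta> \<gamma> x y w where peq: "p = (\<alpha>, \<beta>, \<gamma>, x, y, w)" by (cases p)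
  have "0 \<le> fst p" "fst p \<le> 1" using cayley_tuples_nonneg[of \<alpha> \<beta> \<gamma> x y w] p peq by auto
  then have ac: "a\<^sup>2 + c\<^sup>2 = 1" by (simp add: a_def c_def)
  obtain g where g: "cayley_isometry g" "g p = real_tuple a 0 c"
    using cayley_stabilizer_normal_form[OF p] unfolding a_def c_def by metis
  \<comment> \<open>The block with rows \<open>(a, c)\<close> and \<open>(c, -a)\<close> sends the
    unit vector \<open>(a, c)\<close> to \<open>(1, 0)\<close>.\<close>
  define R where "R = cayley_reflection a (c *\<^sub>R oct_one)"
  have "cayley_isometry R" unfolding R_def
    by (rule cayley_isometry_reflection) (simp add: norm_oct_one ac)
  then have iso: "cayley_isometry (cayley_swap \<circ> R \<circ> cayley_swap \<circ> g)"
    by (intro cayley_isometry_comp cayley_isometry_swap g)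
  have swap: "cayley_swap (real_tuple x y z) = real_tuple y x z" for x y z
    by (simp add: cayley_swap_def real_tuple_def oct_cnj_linear oct_cnj_one mult.commute)
  have k: "a * ((a\<^sup>2 - c\<^sup>2) / 2) + inner ((a * c) *\<^sub>R oct_one) (c *\<^sub>R oct_one) = a / 2"
  proof -
    have "a * ((a\<^sup>2 - c\<^sup>2) / 2) + inner ((a * c) *\<^sub>R oct_one) (c *\<^sub>R oct_one) = a * (a\<^sup>2 + c\<^sup>2) / 2"
      by (simp add: inner_oct_one power2_eq_square field_simps)
    then show ?thesis by (simp add: ac)
  qed
  have "R (real_tuple 0 a c) = real_tuple 0 1 0"
    unfolding R_def cayley_reflection_def real_tuple_def prod.case Let_def k
    using ac by (simp add: oct_zero power2_eq_square algebra_simps)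
  then have "(cayley_swap \<circ> R \<circ> cayley_swap \<circ> g) p = real_tuple 1 0 0"
    by (simp add: g swap)
  then show ?thesis using that iso by blast
qed

text \<open>The weights \<open>sqrt 2\<close> turn the trace form into the Euclidean inner product,
  which yields the features.\<close>

definition tuple_vector :: "oct_herm3 \<Rightarrow> oct_herm3" where
  "tuple_vector = (\<lambda>(\<alpha>, \<beta>, \<gamma>, x, y, w). (\<alpha>, \<beta>, \<gamma>, sqrt 2 *\<^sub>R x, sqrt 2 *\<^sub>R y, sqrt 2 *\<^sub>R w))"

lemma tuple_inner_eq: "tuple_inner p q = inner (tuple_vector p) (tuple_vector q)"
  by (cases p, cases q) (simp add: tuple_inner_def tuple_vector_def inner_prod_def[of "(_, _)"] flip: mult.assoc)

lemma tuple_inner_self: "p \<in> cayley_tuples \<Longrightarrow> tuple_inner p p = 1"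
proof -
  assume p: "p \<in> cayley_tuples"
  obtain \<alpha> \<beta> \<gamma> x y w where peq: "p = (\<alpha>, \<beta>, \<gamma>, x, y, w)" by (cases p)
  have "tuple_inner p p = \<alpha> * \<alpha> + \<beta> * \<beta> + \<gamma> * \<gamma> + 2 * (\<alpha> * \<beta>) + 2 * (\<alpha> * \<gamma>) + 2 * (\<beta> * \<gamma>)"
    using p by (simp add: peq tuple_inner_def cayley_tuples_def flip: power2_norm_eq_inner)
  also have "\<dots> = (\<alpha> + \<beta> + \<gamma>)\<^sup>2" by (simp add: power2_eq_square algebra_simps)
  also have "\<dots> = 1" using p by (simp add: peq cayley_tuples_def)
  finally show ?thesis .
qed

lemma tuple_inner_base: "tuple_inner (real_tuple 1 0 0) p = fst p"
  by (cases p) (simp add: tuple_inner_def real_tuple_def)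

text \<open>Once \<open>p\<close> is moved to the base point, its form with \<open>q\<close> is the
  first diagonal entry of the moved \<open>q\<close>; nonnegativity and the normal form of pairs
  both come from this.\<close>

lemma two_point_model_cayley:
  "two_point_model cayley_tuples tuple_inner Basis (\<lambda>b p. inner (tuple_vector p) b) real_tuple"
proof
  fix p q assume pq: "p \<in> cayley_tuples" "q \<in> cayley_tuples"
  show "tuple_inner p q = (\<Sum>b\<in>Basis. inner (tuple_vector p) b * inner (tuple_vector q) b)"
    unfolding tuple_inner_eq by (rule euclidean_inner)
  show "p = q" if "tuple_inner p q = 1"
  proof -
    have "inner (tuple_vector p - tuple_vector q) (tuple_vector p - tuple_vector q) =
       tuple_inner p p + tuple_inner q q - 2 * tuple_inner p q"
      by (simp add: tuple_inner_eq inner_diff_left inner_diff_right inner_commute)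
    then have "tuple_vector p = tuple_vector q" using that pq by (simp add: tuple_inner_self)
    then show ?thesis by (cases p, cases q) (simp add: tuple_vector_def)
  qed
  obtain h where h: "cayley_isometry h" "h p = real_tuple 1 0 0" using cayley_transitive[OF pq(1)] .
  have hq: "h q \<in> cayley_tuples" using h(1) pq(2) by (rule cayley_isometry_in)
  obtain k where k: "cayley_isometry k" "k (real_tuple 1 0 0) = real_tuple 1 0 0"
    "k (h q) = real_tuple (sqrt (fst (h q))) 0 (sqrt (1 - fst (h q)))"
    using cayley_stabilizer_normal_form[OF hq] .
  have "tuple_inner p q = tuple_inner (h p) (h q)" using h(1) pq by (simp add: cayley_isometry_def)
  then have u: "tuple_inner p q = fst (h q)" by (simp add: h(2) tuple_inner_base)
  show "0 \<le> tuple_inner p q" unfolding u using hq cayley_tuples_nonneg(1) by (metis prod.collapse)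
  have "cayley_isometry (k \<circ> h)" by (intro cayley_isometry_comp k h)
  then show "\<exists>g. g ` cayley_tuples = cayley_tuples \<and>
      (\<forall>x\<in>cayley_tuples. \<forall>y\<in>cayley_tuples. tuple_inner (g x) (g y) = tuple_inner x y) \<and>
      g p = real_tuple 1 0 0 \<and> g q = real_tuple (sqrt (tuple_inner p q)) 0 (sqrt (1 - tuple_inner p q))"
    by (intro exI[of _ "k \<circ> h"]) (simp add: cayley_isometry_def u h(2) k(2,3))
next
  fix p assume p: "p \<in> cayley_tuples"
  show "tuple_inner p p = 1" by (rule tuple_inner_self[OF p])
  obtain \<alpha> \<beta> \<gamma> x' y' w' where peq: "p = (\<alpha>, \<beta>, \<gamma>, x', y', w')" by (cases p)
  have "tuple_inner p (real_tuple x y z) = \<alpha> * x\<^sup>2 + \<beta> * y\<^sup>2 + \<gamma> * z\<^sup>2 + (2 * inner x' oct_one) * (x * y) +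
      (2 * inner y' oct_one) * (x * z) + (2 * inner w' oct_one) * (y * z)" for x y z
    by (simp add: peq tuple_inner_def real_tuple_def)
  then show "\<exists>s1 s2 s3 s4 s5 s6. \<forall>x y z. x\<^sup>2 + y\<^sup>2 + z\<^sup>2 = 1 \<longrightarrow> tuple_inner p (real_tuple x y z) =
     s1 * x\<^sup>2 + s2 * y\<^sup>2 + s3 * z\<^sup>2 + s4 * (x * y) + s5 * (x * z) + s6 * (y * z)" by blast
next
  fix x y z :: real assume "x\<^sup>2 + y\<^sup>2 + z\<^sup>2 = 1"
  then show "real_tuple x y z \<in> cayley_tuples" by (rule real_tuple_in)
  fix x' y' z' :: real
  show "tuple_inner (real_tuple x y z) (real_tuple x' y' z') = (x * x' + y * y' + z * z')\<^sup>2"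
    by (simp add: tuple_inner_def real_tuple_def inner_oct_one power2_eq_square algebra_simps)
qed simp

section \<open>Identification of the tuples with the Cayley plane\<close>

definition tuple_matrix :: "oct_herm3 \<Rightarrow> oct^3^3" where
  "tuple_matrix = (\<lambda>(\<alpha>, \<beta>, \<gamma>, x, y, w). vector
     [vector [\<alpha> *\<^sub>R oct_one, oct_cnj x, oct_cnj y],
      vector [x, \<beta> *\<^sub>R oct_one, oct_cnj w],
      vector [y, w, \<gamma> *\<^sub>R oct_one]])"

lemma oct_self_adjoint: "x = oct_cnj x \<Longrightarrow> x = oct_Re x *\<^sub>R oct_one"
  by (simp add: oct_cnj_def quat_cnj_def oct_Re_def oct_one_def prod_eq_iff complex_eq_iff zero_prod_def)

lemma oct_cnj_mult_self: "oct_mult (oct_cnj x) x = (norm x)\<^sup>2 *\<^sub>R oct_one"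
  using oct_mult_cnj[of "oct_cnj x"] by (simp add: oct_comp_cnj norm_oct_cnj)

lemma jordan_mult_self: "jordan_mult p p = oct_matrix_mult p p"
  by (simp add: jordan_mult_def flip: scaleR_2)

lemma tuple_matrix_in:
  assumes p: "p \<in> cayley_tuples"
  shows "tuple_matrix p \<in> cayley_plane"
proof -
  obtain \<alpha> \<beta> \<gamma> x y w where peq: "p = (\<alpha>, \<beta>, \<gamma>, x, y, w)" by (cases p)
  have pt: "(\<alpha>, \<beta>, \<gamma>, x, y, w) \<in> cayley_tuples" using p peq by simp
  then have *: "\<alpha> + \<beta> + \<gamma> = 1" "(norm x)\<^sup>2 = \<alpha> * \<beta>" "(norm y)\<^sup>2 = \<alpha> * \<gamma>" "(norm w)\<^sup>2 = \<beta> * \<gamma>" "oct_mult w x = \<beta> *\<^sub>R y"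
    by (auto simp: cayley_tuples_def)
  note eqs = cayley_tuples_eqs[OF pt]
  have \<alpha>: "\<alpha> = 1 - \<beta> - \<gamma>" using *(1) by simp
  have eqs': "oct_mult (oct_cnj y) w = \<gamma> *\<^sub>R oct_cnj x" "oct_mult x (oct_cnj y) = \<alpha> *\<^sub>R oct_cnj w"
    "oct_mult (oct_cnj x) (oct_cnj w) = \<beta> *\<^sub>R oct_cnj y"
    using arg_cong[OF eqs(1), of oct_cnj] arg_cong[OF eqs(2), of oct_cnj] arg_cong[OF *(5), of oct_cnj]
    by (simp_all add: oct_cnj_mult oct_comp_cnj oct_cnj_linear)
  have "tuple_matrix p \<in> albert_algebra"
    by (simp add: albert_algebra_def tuple_matrix_def peq forall_3 oct_comp_cnj oct_cnj_linear oct_cnj_one)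
  moreover have "oct_trace (tuple_matrix p) = oct_one"
    using *(1) by (simp add: oct_trace_def sum_3 tuple_matrix_def peq flip: scaleR_add_left)
  moreover have "oct_matrix_mult (tuple_matrix p) (tuple_matrix p) = tuple_matrix p"
    by (simp add: oct_matrix_mult_def tuple_matrix_def peq vec_eq_iff forall_3 sum_3 oct_mult_distrib oct_mult_one
        eqs eqs' *(2-5) oct_mult_cnj oct_cnj_mult_self norm_oct_cnj flip: scaleR_add_left)
      (simp add: \<alpha> algebra_simps)
  ultimately show ?thesis by (simp add: cayley_plane_def jordan_mult_self)
qed

lemma cayley_plane_tuple:
  assumes P: "P \<in> cayley_plane"
  shows "\<exists>p\<in>cayley_tuples. tuple_matrix p = P"
proof -
  have herm: "P $ i $ j = oct_cnj (P $ j $ i)" for i j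
    using P unfolding cayley_plane_def albert_algebra_def by blast
  define \<alpha> \<beta> \<gamma> where "\<alpha> = oct_Re (P $ 1 $ 1)" and "\<beta> = oct_Re (P $ 2 $ 2)" and "\<gamma> = oct_Re (P $ 3 $ 3)"
  define x y w where "x = P $ 2 $ 1" and "y = P $ 3 $ 1" and "w = P $ 3 $ 2"
  have diag: "P $ 1 $ 1 = \<alpha> *\<^sub>R oct_one" "P $ 2 $ 2 = \<beta> *\<^sub>R oct_one" "P $ 3 $ 3 = \<gamma> *\<^sub>R oct_one"
    unfolding \<alpha>_def \<beta>_def \<gamma>_def by (intro oct_self_adjoint herm)+
  have eq: "tuple_matrix (\<alpha>, \<beta>, \<gamma>, x, y, w) = P"
    using diag herm[of 1 2] herm[of 1 3] herm[of 2 3]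
    by (simp add: tuple_matrix_def vec_eq_iff forall_3 x_def y_def w_def)
  have one0: "oct_one \<noteq> 0" using norm_oct_one by auto
  have "oct_trace (tuple_matrix (\<alpha>, \<beta>, \<gamma>, x, y, w)) = oct_one" using P eq by (simp add: cayley_plane_def)
  then have "(\<alpha> + \<beta> + \<gamma>) *\<^sub>R oct_one = (1::real) *\<^sub>R oct_one"
    by (simp add: oct_trace_def sum_3 tuple_matrix_def scaleR_add_left)
  then have tr: "\<alpha> + \<beta> + \<gamma> = 1" using one0 unfolding scaleR_cancel_right by simp
  have idem: "oct_matrix_mult (tuple_matrix (\<alpha>, \<beta>, \<gamma>, x, y, w)) (tuple_matrix (\<alpha>, \<beta>, \<gamma>, x, y, w)) $ i $ j
     = tuple_matrix (\<alpha>, \<beta>, \<gamma>, x, y, w) $ i $ j" for i j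
    using P eq by (simp add: cayley_plane_def jordan_mult_self)
  have "(\<alpha> * \<alpha> + (norm x)\<^sup>2 + (norm y)\<^sup>2) *\<^sub>R oct_one = \<alpha> *\<^sub>R oct_one"
    using idem[of 1 1] by (simp add: oct_matrix_mult_def tuple_matrix_def sum_3 oct_mult_distrib oct_mult_one
        oct_cnj_mult_self scaleR_add_left)
  moreover have "(\<beta> * \<beta> + (norm x)\<^sup>2 + (norm w)\<^sup>2) *\<^sub>R oct_one = \<beta> *\<^sub>R oct_one"
    using idem[of 2 2] by (simp add: oct_matrix_mult_def tuple_matrix_def sum_3 oct_mult_distrib oct_mult_one
        oct_cnj_mult_self oct_mult_cnj scaleR_add_left add_ac)
  moreover have "(\<gamma> * \<gamma> + (norm y)\<^sup>2 + (norm w)\<^sup>2) *\<^sub>R oct_one = \<gamma> *\<^sub>R oct_one"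
    using idem[of 3 3] by (simp add: oct_matrix_mult_def tuple_matrix_def sum_3 oct_mult_distrib oct_mult_one
        oct_mult_cnj scaleR_add_left add_ac)
  ultimately have d: "\<alpha> * \<alpha> + (norm x)\<^sup>2 + (norm y)\<^sup>2 = \<alpha>" "\<beta> * \<beta> + (norm x)\<^sup>2 + (norm w)\<^sup>2 = \<beta>"
    "\<gamma> * \<gamma> + (norm y)\<^sup>2 + (norm w)\<^sup>2 = \<gamma>"
    using one0 unfolding scaleR_cancel_right by simp_all
  have "\<alpha> *\<^sub>R y + oct_mult w x + \<gamma> *\<^sub>R y = y"
    using idem[of 3 1] by (simp add: oct_matrix_mult_def tuple_matrix_def sum_3 oct_mult_distrib oct_mult_one)
  then have "oct_mult w x = (1 - \<alpha> - \<gamma>) *\<^sub>R y" by (simp add: algebra_simps)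
  then have wx: "\<beta> *\<^sub>R y = oct_mult w x" using tr by (simp add: algebra_simps flip: tr)
  \<comment> \<open>The diagonal equations are linear in the three squared norms; eliminating
    \<open>\<gamma>\<close> by the trace turns their solution into the required products.\<close>
  have g: "\<gamma> = 1 - \<alpha> - \<beta>" using tr by simp
  have "(norm x)\<^sup>2 = \<alpha> * \<beta>" "(norm y)\<^sup>2 = \<alpha> * \<gamma>" "(norm w)\<^sup>2 = \<beta> * \<gamma>"
    using d unfolding g by (simp_all add: algebra_simps)
  then show ?thesis using eq tr wx by (intro bexI[of _ "(\<alpha>, \<beta>, \<gamma>, x, y, w)"]) (auto simp: cayley_tuples_def)
qed

lemma tuple_matrix_bij: "bij_betw tuple_matrix cayley_tuples cayley_plane"
proof (rule bij_betwI')
  fix p q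
  show "tuple_matrix p = tuple_matrix q \<longleftrightarrow> p = q"
  proof
    assume eq: "tuple_matrix p = tuple_matrix q"
    have one0: "oct_one \<noteq> 0" using norm_oct_one by auto
    show "p = q"
      using eq one0 by (cases p, cases q) (auto simp: tuple_matrix_def vec_eq_iff forall_3)
  qed simp
qed (use tuple_matrix_in cayley_plane_tuple in \<open>auto simp: eq_commute\<close>)

lemma oct_Re_mult_cnj: "oct_Re (oct_mult x (oct_cnj y)) = inner x y" "oct_Re (oct_mult (oct_cnj x) y) = inner x y"
  by (simp_all add: oct_Re_def oct_mult_def oct_cnj_def quat_mult_def quat_cnj_def inner_prod_def inner_complex_def algebra_simps)

lemma cayley_dist_tuple:
  "cayley_dist (tuple_matrix p) (tuple_matrix q) = 4 * arccos (sqrt (tuple_inner p q))"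
proof -
  have lin: "oct_Re (a + b) = oct_Re a + oct_Re b" "oct_Re (r *\<^sub>R a) = r * oct_Re a" for a b r
    by (simp_all add: oct_Re_def)
  have one: "oct_Re oct_one = 1" by (simp add: oct_Re_def oct_one_def)
  have tr: "oct_Re (oct_trace (oct_matrix_mult (tuple_matrix p) (tuple_matrix q))) = tuple_inner p q" for p q
  proof -
    obtain \<alpha> \<beta> \<gamma> x y w where p: "p = (\<alpha>, \<beta>, \<gamma>, x, y, w)" by (cases p)
    obtain \<alpha>' \<beta>' \<gamma>' x' y' w' where q: "q = (\<alpha>', \<beta>', \<gamma>', x', y', w')" by (cases q)
    show ?thesis
      unfolding p q oct_trace_def oct_matrix_mult_def tuple_matrix_def tuple_inner_def prod.case sum_3
      by (simp add: lin one oct_mult_distrib oct_mult_one oct_Re_mult_cnj)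
  qed
  have sym: "tuple_inner q p = tuple_inner p q"
    by (simp add: tuple_inner_eq inner_commute)
  have J: "oct_Re (oct_trace (jordan_mult P Q)) =
      (oct_Re (oct_trace (oct_matrix_mult P Q)) + oct_Re (oct_trace (oct_matrix_mult Q P))) / 2" for P Q
    by (simp add: jordan_mult_def oct_trace_def lin sum_3 add_divide_distrib)
  have "oct_Re (oct_trace (jordan_mult (tuple_matrix p) (tuple_matrix q))) = tuple_inner p q"
    unfolding J tr sym by simp
  then show ?thesis by (simp add: cayley_dist_def)
qed

lemma cos_cayley_dist:
  assumes "p \<in> cayley_tuples" "q \<in> cayley_tuples"
  shows "cos (cayley_dist (tuple_matrix p) (tuple_matrix q) / 2) = 2 * tuple_inner p q - 1"
proof -
  interpret two_point_model cayley_tuples tuple_inner Basis "\<lambda>b p. inner (tuple_vector p) b" real_tuple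
    by (rule two_point_model_cayley)
  define c where "c = sqrt (tuple_inner p q)"
  have t: "0 \<le> tuple_inner p q" "tuple_inner p q \<le> 1" using u_nonneg u_le_1 assms by auto
  then have "0 \<le> c" "c \<le> 1" by (simp_all add: c_def)
  then have "cos (2 * arccos c) = 2 * c\<^sup>2 - 1" by (simp add: cos_double_cos)
  then show ?thesis using t by (simp add: cayley_dist_tuple c_def)
qed

section \<open>Passage to isometric copies and the four families\<close>

lemma isotropic_part_spd_equivalence_isometric:
  assumes model: "two_point_model N u A e \<nu>" and iso: "isometric_spaces M \<delta> N \<rho>"
    and \<rho>: "\<And>x y. x \<in> N \<Longrightarrow> y \<in> N \<Longrightarrow> cos (\<rho> x y / 2) = 2 * u x y - 1"
    and "\<exists>t\<in>{-1..1}. f t \<noteq> 0" "\<exists>t\<in>{-1..1}. g t \<noteq> 0"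
    and "isotropic_part_pd M \<delta> f" "isotropic_part_pd M \<delta> g"
  shows "(isotropic_part_spd M \<delta> (\<lambda>t. f t * g t) \<longleftrightarrow>
            isotropic_part_spd M \<delta> f \<or> isotropic_part_spd M \<delta> g) \<and>
         (isotropic_part_spd M \<delta> f \<or> isotropic_part_spd M \<delta> g \<longleftrightarrow>
            \<not> polynomial_on_interval f \<or> \<not> polynomial_on_interval g)"
  unfolding isotropic_part_isometric(2)[OF iso]
proof (rule two_point_model.isotropic_part_spd_equivalence[OF model])
  show "isotropic_part_pd N \<rho> f" "isotropic_part_pd N \<rho> g"
    using assms(6,7) by (simp_all add: isotropic_part_isometric(1)[OF iso])
qed (fact \<rho> assms(4,5))+

lemma isometric_spaces_cayley_tuples:
  assumes "isometric_spaces M \<delta> cayley_plane cayley_dist"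
  shows "isometric_spaces M \<delta> cayley_tuples (\<lambda>p q. cayley_dist (tuple_matrix p) (tuple_matrix q))"
proof -
  obtain h where h: "bij_betw h M cayley_plane" "\<And>x y. x \<in> M \<Longrightarrow> y \<in> M \<Longrightarrow> cayley_dist (h x) (h y) = \<delta> x y"
    using assms by (auto simp: isometric_spaces_def)
  define k where "k = inv_into cayley_tuples tuple_matrix"
  have "bij_betw (k \<circ> h) M cayley_tuples"
    unfolding k_def by (intro bij_betw_trans[OF h(1)] bij_betw_inv_into tuple_matrix_bij)
  moreover have "tuple_matrix (k (h x)) = h x" if "x \<in> M" for x
    using bij_betw_inv_into_right[OF tuple_matrix_bij, of "h x"] h(1) that by (auto simp: k_def bij_betw_def)
  ultimately show ?thesis using h(2) unfolding isometric_spaces_def by (intro exI[of _ "k \<circ> h"]) simp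
qed

theorem theorem2p5:
  fixes d :: nat and M :: "'a set" and \<delta> :: "'a \<Rightarrow> 'a \<Rightarrow> real" and f g :: "real \<Rightarrow> real"
  assumes "nonspherical_two_point_homogeneous d M \<delta>"
    and "continuous_on {-1..1} f" and "continuous_on {-1..1} g"
    and "\<exists>t\<in>{-1..1}. f t \<noteq> 0" and "\<exists>t\<in>{-1..1}. g t \<noteq> 0"
    and "isotropic_part_pd M \<delta> f" and "isotropic_part_pd M \<delta> g"
  shows "(isotropic_part_spd M \<delta> (\<lambda>t. f t * g t) \<longleftrightarrow>
            isotropic_part_spd M \<delta> f \<or> isotropic_part_spd M \<delta> g) \<and>
         (isotropic_part_spd M \<delta> f \<or> isotropic_part_spd M \<delta> g \<longleftrightarrow>
            \<not> polynomial_on_interval f \<or> \<not> polynomial_on_interval g)"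
  using assms(1) unfolding nonspherical_two_point_homogeneous_def
proof (elim disjE exE conjE)
  assume "d \<ge> 2" and iso: "isometric_spaces M \<delta> (real_proj_space d) (real_proj_dist d)"
  show ?thesis
    by (rule isotropic_part_spd_equivalence_isometric[OF
          real_scalars.two_point_model_proj_space[OF \<open>d \<ge> 2\<close>] iso _ assms(4-7)])
      (rule real_scalars.cos_proj_dist[OF \<open>d \<ge> 2\<close>])
next
  fix n :: nat
  assume "n \<ge> 2" and iso: "isometric_spaces M \<delta> (complex_proj_space n) (complex_proj_dist n)"
  show ?thesis
    by (rule isotropic_part_spd_equivalence_isometric[OF
          complex_scalars.two_point_model_proj_space[OF \<open>n \<ge> 2\<close>] iso _ assms(4-7)])
      (rule complex_scalars.cos_proj_dist[OF \<open>n \<ge> 2\<close>])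
next
  fix n :: nat
  assume "n \<ge> 2" and iso: "isometric_spaces M \<delta> (quat_proj_space n) (quat_proj_dist n)"
  show ?thesis
    by (rule isotropic_part_spd_equivalence_isometric[OF
          quat_scalars.two_point_model_proj_space[OF \<open>n \<ge> 2\<close>] iso _ assms(4-7)])
      (rule quat_scalars.cos_proj_dist[OF \<open>n \<ge> 2\<close>])
next
  assume iso: "isometric_spaces M \<delta> cayley_plane cayley_dist"
  show ?thesis
    by (rule isotropic_part_spd_equivalence_isometric[OF
          two_point_model_cayley isometric_spaces_cayley_tuples[OF iso] _ assms(4-7)])
      (rule cos_cayley_dist)
qed

end
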